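(* (a) Reachability in undirected graphs is in $\mathrm{DynFOLL}$ under insertions and deletions of $(\log n)^{O(\log\log n)}$ edges (i.e., of sets of at most $(\log n)^{e\log\log n}$ edges at once, for an arbitrary fixed constant $e$). (b) For every regular language $L$, membership of the current word in $L$ is in $\mathrm{DynFOLL}$ under changes that modify the symbols at $(\log n)^{O(\log\log n)}$ positions at once.
   Context: Dynamic complexity setting. All structures have domain $\{0,\dots,n-1\}$ with its linear order; a word of length $n$ is represented with positions as domain elements and a unary relation per alphabet symbol. Input changes are insertions/deletions of sets of tuples whose size is bounded by a given function $s(n)$ (for words: changing the symbols at a set of positions). A dynamic program stores auxiliary relations over the same domain; for each auxiliary relation and change operation it has an update program which, evaluated on the changed input together with the old auxiliary relations, defines the new auxiliary relation. The initial input is empty and initial auxiliary relations are first-order definable from it. The program maintains a query if, after every sequence of allowed changes from the empty initial input, a designated auxiliary relation equals the query result on the current input. $\mathrm{DynFOLL}$: update programs are DLOGTIME-uniform polynomial-size circuits of depth $O(\log\log n)$ with NOT gates and unbounded fan-in AND/OR gates, equivalently a first-order formula with $\leq,+,\times$ iterated $O(\log\log n)$ times. Reachability in undirected graphs: maintain the relation of pairs $(u,v)$ connected by a path. *)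

theory Defs
  imports Complex_Main
begin

section \<open>First-order logic with arithmetic over the domain \<open>{0..<n}\<close>\<close>

datatype 's fo =
    Eq nat nat
  | Leq nat nat
  | Add nat nat nat
  | Mul nat nat nat
  | Rel 's "nat list"
  | Neg "'s fo"
  | Conj "'s fo" "'s fo"
  | Exists nat "'s fo"

type_synonym 's struct = "'s \<Rightarrow> nat list set"

primrec sat :: "nat \<Rightarrow> 's struct \<Rightarrow> (nat \<Rightarrow> nat) \<Rightarrow> 's fo \<Rightarrow> bool" where
  "sat n S a (Eq x y) \<longleftrightarrow> a x = a y"
| "sat n S a (Leq x y) \<longleftrightarrow> a x \<le> a y"
| "sat n S a (Add x y z) \<longleftrightarrow> a x + a y = a z"
| "sat n S a (Mul x y z) \<longleftrightarrow> a x * a y = a z"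
| "sat n S a (Rel r xs) \<longleftrightarrow> map a xs \<in> S r"
| "sat n S a (Neg \<phi>) \<longleftrightarrow> \<not> sat n S a \<phi>"
| "sat n S a (Conj \<phi> \<psi>) \<longleftrightarrow> sat n S a \<phi> \<and> sat n S a \<psi>"
| "sat n S a (Exists x \<phi>) \<longleftrightarrow> (\<exists>d<n. sat n S (a(x := d)) \<phi>)"

text \<open>\<open>wf_fo ar V \<phi>\<close>: the free variables of \<open>\<phi>\<close> lie in \<open>V\<close>, and \<open>\<phi>\<close> uses only the
  relation symbols that have an arity in \<open>ar\<close>, each with that arity.\<close>

primrec wf_fo :: "('s \<Rightarrow> nat option) \<Rightarrow> nat set \<Rightarrow> 's fo \<Rightarrow> bool" where
  "wf_fo ar V (Eq x y) \<longleftrightarrow> {x, y} \<subseteq> V"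
| "wf_fo ar V (Leq x y) \<longleftrightarrow> {x, y} \<subseteq> V"
| "wf_fo ar V (Add x y z) \<longleftrightarrow> {x, y, z} \<subseteq> V"
| "wf_fo ar V (Mul x y z) \<longleftrightarrow> {x, y, z} \<subseteq> V"
| "wf_fo ar V (Rel r xs) \<longleftrightarrow> ar r = Some (length xs) \<and> set xs \<subseteq> V"
| "wf_fo ar V (Neg \<phi>) \<longleftrightarrow> wf_fo ar V \<phi>"
| "wf_fo ar V (Conj \<phi> \<psi>) \<longleftrightarrow> wf_fo ar V \<phi> \<and> wf_fo ar V \<psi>"
| "wf_fo ar V (Exists x \<phi>) \<longleftrightarrow> wf_fo ar (insert x V) \<phi>"

text \<open>The \<open>k\<close>-ary relation defined by a formula with free variables \<open>0, \<dots>, k - 1\<close>. The value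
  of the assignment outside \<open>{..<k}\<close> is irrelevant for well-formed formulas.\<close>

definition defined_rel :: "nat \<Rightarrow> 's struct \<Rightarrow> nat \<Rightarrow> 's fo \<Rightarrow> nat list set" where
  "defined_rel n S k \<phi> =
     {t. length t = k \<and> set t \<subseteq> {..<n} \<and> sat n S (\<lambda>x. if x < k then t ! x else 0) \<phi>}"


section \<open>Update programs: first-order formulas iterated \<open>O(log log n)\<close> times\<close>

definition loglog :: "nat \<Rightarrow> nat" where
  "loglog n = nat \<lceil>log 2 (log 2 (real n))\<rceil>"

text \<open>The symbols available to an update program: the changed input, the old auxiliary
  relations, and the relation that is being iterated.\<close>

datatype 'r sym = Inp 'r | Aux nat | Iter

definition combine :: "'r struct \<Rightarrow> (nat \<Rightarrow> nat list set) \<Rightarrow> nat list set \<Rightarrow> 'r sym struct" where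
  "combine I A X = (\<lambda>s. case s of Inp r \<Rightarrow> I r | Aux i \<Rightarrow> A i | Iter \<Rightarrow> X)"

text \<open>Starting from the empty relation, the formula \<open>iter_formula\<close> is applied
  \<open>iter_factor * loglog n\<close> times to the relation \<open>Iter\<close>; the new auxiliary relation is then
  read off by \<open>result_formula\<close>. The number of rounds is a fixed multiple of \<open>loglog n\<close> rather
  than an arbitrary function in \<open>O(log log n)\<close>, since the latter could carry non-uniform
  advice. The iteration need not be monotone, which corresponds to circuits with negation
  gates.\<close>

record 'r update_prog =
  iter_arity :: nat
  iter_formula :: "'r sym fo"
  iter_factor :: nat
  result_formula :: "'r sym fo"

definition run_update ::
  "nat \<Rightarrow> 'r struct \<Rightarrow> (nat \<Rightarrow> nat list set) \<Rightarrow> nat \<Rightarrow> 'r update_prog \<Rightarrow> nat list set" where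
  "run_update n I A k u =
     (let step = (\<lambda>X. defined_rel n (combine I A X) (iter_arity u) (iter_formula u));
          X = (step ^^ (iter_factor u * loglog n)) {}
      in defined_rel n (combine I A X) k (result_formula u))"


section \<open>Dynamic problems, dynamic programs and DynFOLL\<close>

text \<open>\<open>change n c I I'\<close>: on domain \<open>{0..<n}\<close>, some allowed change of kind \<open>c\<close> turns the
  input \<open>I\<close> into \<open>I'\<close>.\<close>

record ('r, 'c) dyn_problem =
  input_arity :: "'r \<Rightarrow> nat"
  change :: "nat \<Rightarrow> 'c \<Rightarrow> 'r struct \<Rightarrow> 'r struct \<Rightarrow> bool"
  query :: "nat \<Rightarrow> 'r struct \<Rightarrow> nat list set"

text \<open>The auxiliary relations are numbered by \<open>i < length aux_arities\<close>.\<close>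

record ('r, 'c) dyn_prog =
  aux_arities :: "nat list"
  init_formula :: "nat \<Rightarrow> 'r fo"
  update :: "'c \<Rightarrow> nat \<Rightarrow> 'r update_prog"
  answer :: nat

definition sym_arity :: "('r \<Rightarrow> nat) \<Rightarrow> nat list \<Rightarrow> nat \<Rightarrow> 'r sym \<Rightarrow> nat option" where
  "sym_arity iar aar k s =
     (case s of
        Inp r \<Rightarrow> Some (iar r)
      | Aux i \<Rightarrow> (if i < length aar then Some (aar ! i) else None)
      | Iter \<Rightarrow> Some k)"

definition wf_prog :: "('r \<Rightarrow> nat) \<Rightarrow> ('r, 'c) dyn_prog \<Rightarrow> bool" where
  "wf_prog iar P \<longleftrightarrow>
     answer P < length (aux_arities P) \<and>
     (\<forall>i < length (aux_arities P).
        wf_fo (Some \<circ> iar) {..<aux_arities P ! i} (init_formula P i) \<and>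
        (\<forall>c. let u = update P c i; ar = sym_arity iar (aux_arities P) (iter_arity u)
             in wf_fo ar {..<iter_arity u} (iter_formula u) \<and>
                wf_fo ar {..<aux_arities P ! i} (result_formula u)))"

definition empty_input :: "'r struct" where
  "empty_input = (\<lambda>_. {})"

definition init_aux :: "nat \<Rightarrow> ('r, 'c) dyn_prog \<Rightarrow> nat \<Rightarrow> nat list set" where
  "init_aux n P i =
     (if i < length (aux_arities P)
      then defined_rel n empty_input (aux_arities P ! i) (init_formula P i) else {})"

definition update_aux ::
  "nat \<Rightarrow> ('r, 'c) dyn_prog \<Rightarrow> 'c \<Rightarrow> 'r struct \<Rightarrow> (nat \<Rightarrow> nat list set) \<Rightarrow> nat \<Rightarrow> nat list set" where
  "update_aux n P c I A i =
     (if i < length (aux_arities P)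
      then run_update n I A (aux_arities P ! i) (update P c i) else {})"

inductive reaches ::
  "('r, 'c) dyn_problem \<Rightarrow> ('r, 'c) dyn_prog \<Rightarrow> nat \<Rightarrow> 'r struct \<Rightarrow> (nat \<Rightarrow> nat list set) \<Rightarrow> bool"
  for Q P n where
  start: "reaches Q P n empty_input (init_aux n P)"
| change: "reaches Q P n I A \<Longrightarrow> change Q n c I I' \<Longrightarrow> reaches Q P n I' (update_aux n P c I' A)"

definition maintains :: "('r, 'c) dyn_prog \<Rightarrow> ('r, 'c) dyn_problem \<Rightarrow> bool" where
  "maintains P Q \<longleftrightarrow> (\<forall>n I A. reaches Q P n I A \<longrightarrow> A (answer P) = query Q n I)"

definition in_DynFOLL :: "('r::finite, 'c::finite) dyn_problem \<Rightarrow> bool" where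
  "in_DynFOLL Q \<longleftrightarrow> (\<exists>P. wf_prog (input_arity Q) P \<and> maintains P Q)"


section \<open>Undirected reachability\<close>

datatype graph_sym = Edge

instance graph_sym :: finite
proof
  have "(UNIV :: graph_sym set) = {Edge}" by (auto intro: graph_sym.exhaust)
  then show "finite (UNIV :: graph_sym set)" by (metis finite.emptyI finite.insertI)
qed

datatype graph_change = InsertEdges | DeleteEdges

instance graph_change :: finite
proof
  have "(UNIV :: graph_change set) = {InsertEdges, DeleteEdges}"
    by (auto intro: graph_change.exhaust)
  then show "finite (UNIV :: graph_change set)" by (metis finite.emptyI finite.insertI)
qed

text \<open>A pair \<open>(u, v)\<close> in \<open>D\<close> stands for the undirected edge between \<open>u\<close> and \<open>v\<close>, stored in
  both orientations.\<close>

definition both_orientations :: "(nat \<times> nat) set \<Rightarrow> nat list set" where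
  "both_orientations D = {[u, v] | u v. (u, v) \<in> D \<or> (v, u) \<in> D}"

definition graph_changes ::
  "(nat \<Rightarrow> real) \<Rightarrow> nat \<Rightarrow> graph_change \<Rightarrow> graph_sym struct \<Rightarrow> graph_sym struct \<Rightarrow> bool" where
  "graph_changes s n c I I' \<longleftrightarrow>
     (\<exists>D \<subseteq> {..<n} \<times> {..<n}. real (card D) \<le> s n \<and>
        I' Edge = (case c of InsertEdges \<Rightarrow> I Edge \<union> both_orientations D
                           | DeleteEdges \<Rightarrow> I Edge - both_orientations D))"

definition reachability_query :: "nat \<Rightarrow> graph_sym struct \<Rightarrow> nat list set" where
  "reachability_query n I =
     {[u, v] | u v. u < n \<and> v < n \<and> (u, v) \<in> {(x, y). [x, y] \<in> I Edge}\<^sup>*}"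

definition undirected_reachability ::
  "(nat \<Rightarrow> real) \<Rightarrow> (graph_sym, graph_change) dyn_problem" where
  "undirected_reachability s =
     \<lparr>input_arity = (\<lambda>_. 2), change = graph_changes s, query = reachability_query\<rparr>"


section \<open>Membership in regular languages\<close>

definition regular :: "'a::finite list set \<Rightarrow> bool" where
  "regular L \<longleftrightarrow>
     (\<exists>(Q :: nat set) \<delta> q\<^sub>0 F. finite Q \<and> q\<^sub>0 \<in> Q \<and> F \<subseteq> Q \<and> (\<forall>q \<in> Q. \<forall>a. \<delta> q a \<in> Q) \<and>
        L = {w. foldl \<delta> q\<^sub>0 w \<in> F})"

text \<open>A position carries at most one symbol; a position without symbol stands for the empty
  word. In particular, in the empty initial input no position carries a symbol.\<close>

definition word_struct :: "'a option list \<Rightarrow> 'a struct" where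
  "word_struct w = (\<lambda>a. {[i] | i. i < length w \<and> w ! i = Some a})"

definition word_of :: "'a option list \<Rightarrow> 'a list" where
  "word_of w = map the (filter (\<lambda>x. x \<noteq> None) w)"

text \<open>There is a single kind of change, represented by \<open>unit\<close>.\<close>

definition word_changes ::
  "(nat \<Rightarrow> real) \<Rightarrow> nat \<Rightarrow> unit \<Rightarrow> 'a struct \<Rightarrow> 'a struct \<Rightarrow> bool" where
  "word_changes s n c I I' \<longleftrightarrow>
     (\<exists>w w'. length w = n \<and> length w' = n \<and> I = word_struct w \<and> I' = word_struct w' \<and>
        real (card {i. i < n \<and> w ! i \<noteq> w' ! i}) \<le> s n)"

text \<open>The answer is Boolean, i.e. a nullary relation.\<close>

definition membership_query :: "'a list set \<Rightarrow> nat \<Rightarrow> 'a struct \<Rightarrow> nat list set" where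
  "membership_query L n I =
     (if \<exists>w. length w = n \<and> I = word_struct w \<and> word_of w \<in> L then {[]} else {})"

definition word_membership ::
  "'a::finite list set \<Rightarrow> (nat \<Rightarrow> real) \<Rightarrow> ('a, unit) dyn_problem" where
  "word_membership L s =
     \<lparr>input_arity = (\<lambda>_. 1), change = word_changes s, query = membership_query L\<rparr>"


section \<open>The size of changes\<close>

text \<open>The bound \<open>(log n)\<^bsup>e log log n\<^esup>\<close>. For \<open>n \<le> 1\<close>, where \<open>log log n\<close> is undefined, single
  changes are allowed.\<close>

definition batch_size :: "real \<Rightarrow> nat \<Rightarrow> real" where
  "batch_size e n =
     (if n \<le> 1 then 1 else log 2 (real n) powr (e * log 2 (log 2 (real n))))"

end

theory Submission
  imports Defs "HOL-Number_Theory.Cong" "HOL-Real_Asymp.Real_Asymp"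
begin

text \<open>Both parts rest on one primitive: the reflexive transitive closure of a first-order definable
  relation on a set \<open>V\<close> of \<open>(log n)\<^bsup>O(log log n)\<^esup>\<close> domain elements can be computed by \<open>O(log log n)\<close>
  first-order rounds. Some modulus \<open>p\<close> with only \<open>O((log log n)\<^sup>2)\<close> bits is injective on \<open>V\<close>. Therefore a
  path of \<open>K = (log n)\<^bsup>\<Omega>(1)\<^esup>\<close> nodes, reduced modulo \<open>p\<close>, can be coded by a single domain element,
  and a round that guesses such a code multiplies the length of the known paths by \<open>K\<close>.

  For reachability, a spanning forest is maintained by means of the connectivity in the forest without
  any one of its edges. A change breaks it into components, of which only those that contain
  endpoints of changed edges matter, and these are contracted to the endpoints. Kruskal's algorithm
  selects the edges that reconnect them: an edge is taken if the smaller edges do not connect its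
  endpoints. Another closure yields the connectivity in the new forest without any one of its edges.

  For a regular language, the runs of an automaton between all pairs of positions are maintained. A
  run on the new word is composed of old runs between changed positions and of steps at these
  positions, so it is a path on a small set of pairs of positions and states.\<close>

section \<open>First-order definable predicates\<close>

text \<open>Write \<open>l\<close> for \<open>log log n\<close>. The sets \<open>V\<close> have
  \<open>2 ^ O(l * l)\<close> elements, so relevant paths have length up to
  \<open>2 ^ O(l * l)\<close>. A residue takes \<open>O(l * l)\<close> bits, and a domain element
  offers about \<open>log n = 2 ^ l\<close> bits; hence a code has room for
  \<open>K = 2 ^ \<Omega>(l)\<close> residues, and \<open>O(l)\<close> rounds of factor
  \<open>K\<close> reach the length. A higher power of \<open>l\<close> in the exponent would cost
  more rounds.

  The obstacle shared by both programs is that an update sees the changed input but neither the old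
  input nor the set of changed tuples. Changes are recognized by comparing the auxiliary relations
  with the new input. Deleted edges outside the forest and inserted edges inside a component leave
  no trace, and the components of the forest absorb them.

  Removals of single edges are stored because paths in a forest are unique: two vertices stay
  connected after the removal of a set of edges iff they stay connected after the removal of each
  one. General graphs lack this property. The greedy test compares with all smaller edges instead of
  the chosen ones, so all edges are decided in parallel.\<close>

definition definable :: "('s \<Rightarrow> nat option) \<Rightarrow> nat \<Rightarrow> (nat \<Rightarrow> 's struct \<Rightarrow> (nat \<Rightarrow> nat) \<Rightarrow> bool) \<Rightarrow> bool" where
  "definable ar k P \<longleftrightarrow> (\<exists>\<phi>. wf_fo ar {..<k} \<phi> \<and>
     (\<forall>n S a. (\<forall>x<k. a x < n) \<longrightarrow> sat n S a \<phi> = P n S a))"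

text \<open>\<open>definable\<close> compares a formula with \<open>P\<close> only at assignments
  into the domain, and the side condition passes this restriction on. It matters because successor
  and remainder are expressed by quantifiers that range over the domain only.\<close>

lemma definable_cong:
  assumes "definable ar k P" "\<And>n S a. (\<And>x. x < k \<Longrightarrow> a x < n) \<Longrightarrow> P n S a = Q n S a"
  shows "definable ar k Q"
proof -
  obtain \<phi> where "wf_fo ar {..<k} \<phi>" "\<forall>n S a. (\<forall>x<k. a x < n) \<longrightarrow> sat n S a \<phi> = P n S a"
    using assms(1) unfolding definable_def by blast
  then show ?thesis unfolding definable_def using assms(2) by (intro exI[of _ \<phi>]) simp
qed

lemma definable_eq: "i < k \<Longrightarrow> j < k \<Longrightarrow> definable ar k (\<lambda>n S a. a i = a j)"
  unfolding definable_def by (rule exI[of _ "Eq i j"]) simp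

lemma definable_le: "i < k \<Longrightarrow> j < k \<Longrightarrow> definable ar k (\<lambda>n S a. a i \<le> a j)"
  unfolding definable_def by (rule exI[of _ "Leq i j"]) simp

lemma definable_add: "i < k \<Longrightarrow> j < k \<Longrightarrow> l < k \<Longrightarrow> definable ar k (\<lambda>n S a. a i + a j = a l)"
  unfolding definable_def by (rule exI[of _ "Add i j l"]) simp

lemma definable_mul: "i < k \<Longrightarrow> j < k \<Longrightarrow> l < k \<Longrightarrow> definable ar k (\<lambda>n S a. a i * a j = a l)"
  unfolding definable_def by (rule exI[of _ "Mul i j l"]) simp

lemma definable_rel:
  "ar r = Some (length xs) \<Longrightarrow> set xs \<subseteq> {..<k} \<Longrightarrow> definable ar k (\<lambda>n S a. map a xs \<in> S r)"
  unfolding definable_def by (rule exI[of _ "Rel r xs"]) simp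

lemma definable_rel1:
  assumes "ar r = Some 1" "i < k"
  shows "definable ar k (\<lambda>n S a. [a i] \<in> S r)"
proof -
  have "definable ar k (\<lambda>n S a. map a [i] \<in> S r)"
    by (rule definable_rel) (use assms in \<open>simp_all add: numeral_eq_Suc\<close>)
  then show ?thesis by (simp only: list.map)
qed

lemma definable_rel2:
  assumes "ar r = Some 2" "i < k" "j < k"
  shows "definable ar k (\<lambda>n S a. [a i, a j] \<in> S r)"
proof -
  have "definable ar k (\<lambda>n S a. map a [i, j] \<in> S r)"
    by (rule definable_rel) (use assms in \<open>simp_all add: numeral_eq_Suc\<close>)
  then show ?thesis by (simp only: list.map)
qed

lemma definable_rel4:
  assumes "ar r = Some 4" "i < k" "j < k" "l < k" "m < k"
  shows "definable ar k (\<lambda>n S a. [a i, a j, a l, a m] \<in> S r)"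
proof -
  have "definable ar k (\<lambda>n S a. map a [i, j, l, m] \<in> S r)"
    by (rule definable_rel) (use assms in \<open>simp_all add: numeral_eq_Suc\<close>)
  then show ?thesis by (simp only: list.map)
qed

lemma definable_rel6:
  assumes "ar r = Some 6" "i1 < k" "i2 < k" "i3 < k" "i4 < k" "i5 < k" "i6 < k"
  shows "definable ar k (\<lambda>n S a. [a i1, a i2, a i3, a i4, a i5, a i6] \<in> S r)"
proof -
  have "definable ar k (\<lambda>n S a. map a [i1, i2, i3, i4, i5, i6] \<in> S r)"
    by (rule definable_rel) (use assms in \<open>simp_all add: numeral_eq_Suc\<close>)
  then show ?thesis by (simp only: list.map)
qed

lemma definable_rel9:
  assumes "ar r = Some 9" "i1 < k" "i2 < k" "i3 < k" "i4 < k" "i5 < k" "i6 < k" "i7 < k" "i8 < k" "i9 < k"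
  shows "definable ar k (\<lambda>n S a. [a i1, a i2, a i3, a i4, a i5, a i6, a i7, a i8, a i9] \<in> S r)"
proof -
  have "definable ar k (\<lambda>n S a. map a [i1, i2, i3, i4, i5, i6, i7, i8, i9] \<in> S r)"
    by (rule definable_rel) (use assms in \<open>simp_all add: numeral_eq_Suc\<close>)
  then show ?thesis by (simp only: list.map)
qed

lemma definable_not:
  assumes "definable ar k P"
  shows "definable ar k (\<lambda>n S a. \<not> P n S a)"
proof -
  obtain \<phi> where "wf_fo ar {..<k} \<phi>" "\<forall>n S a. (\<forall>x<k. a x < n) \<longrightarrow> sat n S a \<phi> = P n S a"
    using assms unfolding definable_def by blast
  then show ?thesis unfolding definable_def by (intro exI[of _ "Neg \<phi>"]) simp
qed

lemma definable_conj:
  assumes "definable ar k P" "definable ar k Q"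
  shows "definable ar k (\<lambda>n S a. P n S a \<and> Q n S a)"
proof -
  obtain \<phi> \<psi> where "wf_fo ar {..<k} \<phi>" "\<forall>n S a. (\<forall>x<k. a x < n) \<longrightarrow> sat n S a \<phi> = P n S a"
    "wf_fo ar {..<k} \<psi>" "\<forall>n S a. (\<forall>x<k. a x < n) \<longrightarrow> sat n S a \<psi> = Q n S a"
    using assms unfolding definable_def by blast
  then show ?thesis unfolding definable_def by (intro exI[of _ "Conj \<phi> \<psi>"]) simp
qed

lemma definable_disj:
  assumes "definable ar k P" "definable ar k Q"
  shows "definable ar k (\<lambda>n S a. P n S a \<or> Q n S a)"
proof -
  have "definable ar k (\<lambda>n S a. \<not> (\<not> P n S a \<and> \<not> Q n S a))"
    by (intro definable_not definable_conj assms)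
  then show ?thesis by (simp only: de_Morgan_conj not_not)
qed

lemma definable_imp:
  assumes "definable ar k P" "definable ar k Q"
  shows "definable ar k (\<lambda>n S a. P n S a \<longrightarrow> Q n S a)"
proof -
  have "definable ar k (\<lambda>n S a. \<not> P n S a \<or> Q n S a)"
    by (intro definable_not definable_disj assms)
  then show ?thesis by (simp only: imp_conv_disj)
qed

text \<open>The quantified variable is \<open>k\<close>, the first one that is not in use; the second assumption of
  the quantifier rules says that \<open>P\<close> refers to the assignment only below \<open>k\<close>.\<close>

lemma definable_ex:
  assumes "definable ar (Suc k) (\<lambda>n S a. P n S (a k) a)"
    and "\<And>n S a d d'. P n S d (a(k := d')) = P n S d a"
  shows "definable ar k (\<lambda>n S a. \<exists>d<n. P n S d a)"
proof -
  obtain \<phi> where \<phi>: "wf_fo ar {..<Suc k} \<phi>"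
    "\<And>n S a. (\<forall>x<Suc k. a x < n) \<Longrightarrow> sat n S a \<phi> = P n S (a k) a"
    using assms(1) unfolding definable_def by blast
  have "sat n S (a(k := d)) \<phi> = P n S d a" if "\<forall>x<k. a x < n" "d < n" for n S a d
    using \<phi>(2)[of "a(k := d)" n S] that assms(2) by (simp add: less_Suc_eq)
  then have "sat n S a (Exists k \<phi>) = (\<exists>d<n. P n S d a)" if "\<forall>x<k. a x < n" for n S a
    using that by auto
  moreover have "wf_fo ar {..<k} (Exists k \<phi>)"
    using \<phi>(1) by (simp add: lessThan_Suc)
  ultimately show ?thesis unfolding definable_def by blast
qed

lemma definable_all:
  assumes "definable ar (Suc k) (\<lambda>n S a. P n S (a k) a)"
    and "\<And>n S a d d'. P n S d (a(k := d')) = P n S d a"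
  shows "definable ar k (\<lambda>n S a. \<forall>d<n. P n S d a)"
proof -
  have "definable ar k (\<lambda>n S a. \<exists>d<n. \<not> P n S d a)"
    by (rule definable_ex, rule definable_not, rule assms(1)) (simp add: assms(2))
  from definable_not[OF this] show ?thesis by simp
qed

text \<open>For \<open>k = 0\<close> there is no free variable to compare, hence a quantified
  contradiction; it is false on the empty domain as well.\<close>

lemma definable_False: "definable ar k (\<lambda>n S a. False)"
proof -
  have "definable ar k (\<lambda>n S a. \<exists>d<n. \<not> d = d)"
    by (rule definable_ex, rule definable_not, rule definable_eq) auto
  then show ?thesis by simp
qed

lemma definable_const: "definable ar k (\<lambda>n S a. b)"
proof (cases b)
  case True
  have "definable ar k (\<lambda>n S a. \<not> False)" by (rule definable_not, rule definable_False)
  then show ?thesis by (simp only: True not_False_eq_True)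
next
  case False
  then show ?thesis by (simp only: definable_False)
qed

lemma definable_bex_finite:
  assumes "finite C" "\<And>c. c \<in> C \<Longrightarrow> definable ar k (P c)"
  shows "definable ar k (\<lambda>n S a. \<exists>c\<in>C. P c n S a)"
  using assms
proof (induction C)
  case empty
  show ?case by (simp only: bex_empty definable_False)
next
  case (insert c C)
  then have "definable ar k (\<lambda>n S a. P c n S a \<or> (\<exists>c\<in>C. P c n S a))"
    by (intro definable_disj) auto
  then show ?case by simp
qed

lemma definable_ball_finite:
  assumes "finite C" "\<And>c. c \<in> C \<Longrightarrow> definable ar k (P c)"
  shows "definable ar k (\<lambda>n S a. \<forall>c\<in>C. P c n S a)"
proof -
  have "definable ar k (\<lambda>n S a. \<exists>c\<in>C. \<not> P c n S a)"
    by (rule definable_bex_finite[OF assms(1)]) (rule definable_not, rule assms(2))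
  from definable_not[OF this] show ?thesis by simp
qed

section \<open>Order, successor, constants and remainders\<close>

lemma definable_less:
  assumes "i < k" "j < k"
  shows "definable ar k (\<lambda>n S a. a i < a j)"
proof -
  have "definable ar k (\<lambda>n S a. \<not> a j \<le> a i)"
    by (intro definable_not definable_le assms)
  then show ?thesis by (simp only: not_le)
qed

lemmas definable_intros = definable_eq definable_le definable_less definable_add definable_mul
  definable_not definable_conj definable_disj definable_imp definable_ex definable_all

lemma definable_Suc:
  assumes "i < k" "j < k"
  shows "definable ar k (\<lambda>n S a. Suc (a i) = a j)"
proof -
  have "definable ar k (\<lambda>n S a. a i < a j \<and> (\<forall>d<n. a i < d \<longrightarrow> a j \<le> d))"
    using assms by - (rule definable_intros | (simp; fail))+
  then show ?thesis
  proof (rule definable_cong)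
    fix n and S :: "'a struct" and a :: "nat \<Rightarrow> nat"
    assume "\<And>x. x < k \<Longrightarrow> a x < n"
    then have "a j < n" using assms by blast
    then show "(a i < a j \<and> (\<forall>d<n. a i < d \<longrightarrow> a j \<le> d)) = (Suc (a i) = a j)"
      by (metis Suc_leI antisym_conv lessI order_le_less_trans)
  qed
qed

text \<open>Constants are not terms, so \<open>c\<close> is reached by successor steps from the only
  \<open>x\<close> with \<open>x + x = x\<close>. For a constant outside the domain both sides are
  false.\<close>

lemma definable_eq_const: "i < k \<Longrightarrow> definable ar k (\<lambda>n S a. a i = c)"
proof (induction c arbitrary: i k)
  case 0
  have "definable ar k (\<lambda>n S a. a i + a i = a i)"
    using 0 by - (rule definable_intros | (simp; fail))+
  then show ?case by (rule definable_cong) simp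
next
  case (Suc c)
  have "definable ar k (\<lambda>n S a. \<exists>d<n. d = c \<and> Suc d = a i)"
    using Suc.prems by - (rule definable_intros definable_Suc Suc.IH | (simp; fail))+
  then show ?case
  proof (rule definable_cong)
    fix n and S :: "'a struct" and a :: "nat \<Rightarrow> nat"
    assume "\<And>x. x < k \<Longrightarrow> a x < n"
    then have "a i < n" using Suc.prems by blast
    then show "(\<exists>d<n. d = c \<and> Suc d = a i) = (a i = Suc c)"
      by auto
  qed
qed

text \<open>The size \<open>n\<close> is not a domain element and is compared with a constant by
  asking whether the constant is one. This separates the finitely many small sizes.\<close>

lemma definable_size_gt: "definable ar k (\<lambda>n S a. c < n)"
proof -
  have "definable ar k (\<lambda>n S a. \<exists>d<n. d = c)"
    by (rule definable_intros definable_eq_const | (simp; fail))+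
  then show ?thesis by simp
qed

lemma definable_mod:
  assumes "i < k" "j < k" "l < k"
  shows "definable ar k (\<lambda>n S a. a i mod a j = a l)"
proof -
  \<comment> \<open>Atoms take only variables, so the product is named \<open>t\<close>. The case
    \<open>a j = 0\<close> accounts for \<open>x mod 0 = x\<close>.\<close>
  have "definable ar k (\<lambda>n S a. \<exists>q<n. \<exists>t<n. q * a j = t \<and> t + a l = a i \<and> (a l < a j \<or> a j = 0))"
    using assms by - (rule definable_intros definable_eq_const | (simp; fail))+
  then show ?thesis
  proof (rule definable_cong)
    fix n and S :: "'a struct" and a :: "nat \<Rightarrow> nat"
    assume *: "\<And>x. x < k \<Longrightarrow> a x < n"
    have i: "a i < n" using * assms by blast
    show "(\<exists>q<n. \<exists>t<n. q * a j = t \<and> t + a l = a i \<and> (a l < a j \<or> a j = 0)) = (a i mod a j = a l)"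
    proof
      assume "\<exists>q<n. \<exists>t<n. q * a j = t \<and> t + a l = a i \<and> (a l < a j \<or> a j = 0)"
      then show "a i mod a j = a l"
        by (metis add.commute add_0 mod_by_0 mod_less mod_mult_self2 mult_0_right mult.commute)
    next
      assume m: "a i mod a j = a l"
      have "a i div a j * a j + a l = a i" using m by (metis div_mult_mod_eq)
      moreover have "a i div a j < n" "a i div a j * a j < n"
        using i by (metis div_le_dividend order_le_less_trans, metis times_div_less_eq_dividend mult.commute order_le_less_trans)
      moreover have "a l < a j \<or> a j = 0" using m by (metis mod_less_divisor neq0_conv)
      ultimately show "\<exists>q<n. \<exists>t<n. q * a j = t \<and> t + a l = a i \<and> (a l < a j \<or> a j = 0)"
        by blast
    qed
  qed
qed

lemma definable_defined_rel:
  assumes "definable ar k P"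
  obtains \<phi> where "wf_fo ar {..<k} \<phi>"
    "\<And>n S. defined_rel n S k \<phi> =
       {t. length t = k \<and> set t \<subseteq> {..<n} \<and> P n S (\<lambda>x. if x < k then t ! x else 0)}"
proof -
  obtain \<phi> where \<phi>: "wf_fo ar {..<k} \<phi>"
    "\<And>n S a. (\<forall>x<k. a x < n) \<Longrightarrow> sat n S a \<phi> = P n S a"
    using assms unfolding definable_def by metis
  have sat: "sat n S (\<lambda>x. if x < k then t ! x else 0) \<phi> = P n S (\<lambda>x. if x < k then t ! x else 0)"
    if "length t = k" "set t \<subseteq> {..<n}" for n S and t :: "nat list"
  proof (intro \<phi>(2) allI impI)
    fix x assume "x < k"
    then have "t ! x \<in> set t" using that(1) by simp
    then show "(if x < k then t ! x else 0) < n" using that(2) \<open>x < k\<close> by auto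
  qed
  have "defined_rel n S k \<phi> =
      {t. length t = k \<and> set t \<subseteq> {..<n} \<and> P n S (\<lambda>x. if x < k then t ! x else 0)}" for n S
    unfolding defined_rel_def using sat by (intro Collect_cong conj_cong refl) simp
  with \<phi>(1) show thesis by (rule that)
qed

section \<open>Small moduli that are injective on a set\<close>

text \<open>Leibniz' harmonic triangle: \<open>1 / w = 1 / u - 1 / v\<close> for the entries
  \<open>u = (a - 1) (a - 2 choose j)\<close>, \<open>v = a (a - 1 choose j)\<close> and \<open>w = a (a - 1 choose (j + 1))\<close>. Hence
  common multiples of \<open>1, \<dots>, X\<close> are exponentially large, which replaces bounds on the density of
  the primes in the choice of a hash modulus.\<close>

lemma mult_binomial_dvd_common_multiple:
  fixes D :: nat
  assumes "\<And>a. 0 < a \<Longrightarrow> a \<le> X \<Longrightarrow> a dvd D"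
  shows "j < a \<Longrightarrow> a \<le> X \<Longrightarrow> a * ((a - 1) choose j) dvd D"
proof (induction j arbitrary: a)
  case 0
  then show ?case using assms by simp
next
  case (Suc j)
  define b where "b = a - 2"
  have a: "a = Suc (Suc b)" and jb: "j \<le> b" using Suc.prems by (auto simp: b_def)
  define q r where "q = Suc b choose Suc j" and "r = Suc b choose j"
  have u: "Suc b * (b choose j) = Suc j * q"
    unfolding q_def by (rule Suc_times_binomial[symmetric])
  have q: "Suc j * q = (Suc b - j) * r"
    unfolding q_def r_def using binomial_absorb_comp[of "Suc b" j] Suc_times_binomial[of j b]
    by (simp only: diff_Suc_1)
  have r: "r > 0" using jb by (simp add: r_def)
  have "Suc b * (b choose j) dvd D"
    using Suc.IH[of "Suc b"] Suc.prems jb a by simp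
  then obtain \<alpha> where \<alpha>: "D = Suc j * q * \<alpha>" unfolding u by (auto elim: dvdE)
  have "Suc (Suc b) * (Suc b choose j) dvd D"
    using Suc.IH[of "Suc (Suc b)"] Suc.prems jb a by simp
  then obtain \<beta> where \<beta>: "D = Suc (Suc b) * r * \<beta>" unfolding r_def by (auto elim: dvdE)
  \<comment> \<open>\<open>Z\<close> equals \<open>v - u\<close>, and \<open>u * v = w * Z\<close>.
    Multiplying \<open>D / w = \<alpha> - \<beta>\<close> by \<open>w * Z\<close> clears the
    denominators; the integers avoid truncated subtraction.\<close>
  define Z where "Z = int (Suc j) * int r"
  have Z: "Z \<noteq> 0" using r by (simp add: Z_def)
  have qi: "int (Suc j) * int q = (int (Suc b) - int j) * int r"
    using q jb by (metis of_nat_diff of_nat_mult le_SucI)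
  have d1: "int D = int (Suc j) * int q * int \<alpha>" using \<alpha> by (metis of_nat_mult)
  have d2: "int D = int (Suc (Suc b)) * int r * int \<beta>" using \<beta> by (metis of_nat_mult)
  have "int D * Z = int (Suc (Suc b)) * int r * int D - int (Suc j) * int q * int D"
    unfolding Z_def qi by (simp add: algebra_simps)
  also have "\<dots> = int (Suc (Suc b)) * int r * (int (Suc j) * int q * int \<alpha>)
      - int (Suc j) * int q * (int (Suc (Suc b)) * int r * int \<beta>)"
    using d1 d2 by simp
  also have "\<dots> = int (Suc (Suc b)) * int q * (int \<alpha> - int \<beta>) * Z"
    by (simp add: Z_def algebra_simps)
  finally have "int D = int (Suc (Suc b)) * int q * (int \<alpha> - int \<beta>)" using Z by simp
  then have "int (Suc (Suc b) * q) dvd int D" by (metis dvd_triv_left of_nat_mult)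
  then have "Suc (Suc b) * q dvd D" by presburger
  then show ?case by (simp add: a q_def)
qed

text \<open>The middle entry of row \<open>2 * k + 1\<close> exceeds \<open>4 ^ k\<close>: the
  factor \<open>2 * k + 1\<close> outweighs the divisor \<open>2 * k\<close> in the lower bound on
  the central binomial coefficient.\<close>

lemma common_multiple_gt_two_power:
  fixes D :: nat
  assumes "\<And>a. 0 < a \<Longrightarrow> a \<le> 2 * k + 1 \<Longrightarrow> a dvd D" "0 < D" "0 < k"
  shows "2 ^ k < D"
proof -
  have "(2 * k + 1) * ((2 * k) choose k) dvd D"
    using mult_binomial_dvd_common_multiple[of "2 * k + 1" D k "2 * k + 1"] assms(1) by simp
  then have le: "(2 * k + 1) * ((2 * k) choose k) \<le> D" using assms(2) by (rule dvd_imp_le)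
  have "4 ^ k / (2 * real k) \<le> real ((2 * k) choose k)"
    using central_binomial_lower_bound[OF assms(3)] .
  then have "4 ^ k \<le> real ((2 * k) choose k) * (2 * real k)"
    using assms(3) by (simp add: field_simps)
  also have "\<dots> < real ((2 * k) choose k) * (2 * real k + 1)"
    by (rule mult_strict_left_mono) (use zero_less_binomial[of k "2 * k"] in auto)
  also have "\<dots> = real ((2 * k + 1) * ((2 * k) choose k))" by (simp add: algebra_simps)
  also have "\<dots> \<le> real D" using le by (simp only: of_nat_le_iff)
  finally have "(4::real) ^ k < real D" .
  moreover have "(2::real) ^ k \<le> 4 ^ k" by (rule power_mono) auto
  ultimately have "real (2 ^ k) < real D" by (simp only: of_nat_power of_nat_numeral)
  then show ?thesis by (simp only: of_nat_less_iff)
qed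

text \<open>If every modulus up to the bound failed, each would divide a difference of two elements
  of \<open>V\<close>. The product of all differences would then be a common multiple, but it has at
  most \<open>M\<^sup>2\<close> factors below \<open>2 ^ b\<close>. The bound is
  \<open>2 * k + 1\<close> with \<open>k = b * M\<^sup>2\<close>.\<close>

lemma exists_injective_modulus:
  fixes V :: "nat set"
  assumes V: "V \<subseteq> {..<2 ^ b}" "card V \<le> M" "0 < M" "0 < b"
  shows "\<exists>p>0. p \<le> 2 * (b * M\<^sup>2) + 1 \<and> inj_on (\<lambda>s. s mod p) V"
proof (rule ccontr)
  assume neg: "\<not> ?thesis"
  have fin: "finite V" using V(1) finite_subset by blast
  define A where "A = {(s, t). s \<in> V \<and> t \<in> V \<and> s < t}"
  define D where "D = (\<Prod>(s, t)\<in>A. t - s)"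
  have sub: "A \<subseteq> V \<times> V" by (auto simp: A_def)
  then have finA: "finite A" using fin finite_subset by blast
  have "a dvd D" if "0 < a" "a \<le> 2 * (b * M\<^sup>2) + 1" for a
  proof -
    have "\<not> inj_on (\<lambda>s. s mod a) V" using neg that by blast
    then obtain s t where st: "s \<in> V" "t \<in> V" "s mod a = t mod a" "s < t"
      unfolding inj_on_def by (metis linorder_neqE_nat)
    have "a dvd t - s" using st(3,4) by (metis mod_eq_dvd_iff_nat less_imp_le)
    moreover have "(t - s) dvd D"
      unfolding D_def using dvd_prodI[OF finA, of "(s, t)" "\<lambda>(s, t). t - s"] st by (simp add: A_def)
    ultimately show ?thesis by (rule dvd_trans)
  qed
  moreover have "0 < D" unfolding D_def by (rule prod_pos) (auto simp: A_def)
  moreover have "0 < b * M\<^sup>2" using V by simp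
  ultimately have "2 ^ (b * M\<^sup>2) < D" using common_multiple_gt_two_power by blast
  moreover have "D \<le> 2 ^ (b * M\<^sup>2)"
  proof -
    have "D \<le> (\<Prod>x\<in>A. 2 ^ b)"
      unfolding D_def by (rule prod_mono) (use V(1) in \<open>auto simp: A_def intro: order.trans[OF diff_le_self] less_imp_le\<close>)
    also have "\<dots> = (2 ^ b) ^ card A" by simp
    also have "\<dots> \<le> (2 ^ b) ^ M\<^sup>2"
    proof (rule power_increasing)
      have "card A \<le> card (V \<times> V)" using sub fin by (intro card_mono) auto
      also have "\<dots> \<le> M\<^sup>2" using V(2) by (simp add: card_cartesian_product power2_eq_square mult_mono)
      finally show "card A \<le> M\<^sup>2" .
    qed simp
    finally show ?thesis by (simp add: power_mult)
  qed
  ultimately show False by simp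
qed

text \<open>Goedel's \<open>\<beta>\<close> function. A common divisor of two of the moduli is coprime to \<open>d = K! p\<close> and divides
  a difference \<open>(j - i) d\<close>, but \<open>j - i\<close> divides \<open>K!\<close>.\<close>

lemma beta_sequence:
  assumes "\<And>i. i \<le> K \<Longrightarrow> f i < p" "0 < p"
  shows "\<exists>c < ((K + 2) * (fact K * p)) ^ (K + 1). \<forall>i\<le>K. c mod Suc (Suc i * (fact K * p)) = f i"
proof -
  define d :: nat where "d = fact K * p"
  define m where "m = (\<lambda>i. Suc (Suc i * d))"
  have dpos: "0 < d" using assms by (simp add: d_def)
  have pd: "p \<le> d" by (simp add: d_def)
  have cop_less: "coprime (m i) (m j)" if "i < j" "j \<le> K" for i j
  proof (rule coprimeI)
    fix c assume c: "c dvd m i" "c dvd m j"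
    have "coprime c d"
      using c(1) unfolding m_def
      by (metis coprime_Suc_right_nat coprime_commute coprime_divisors coprime_mult_left_iff dvd_refl mult.commute)
    moreover have "m j - m i = (j - i) * d" by (simp add: m_def algebra_simps diff_mult_distrib)
    then have "c dvd (j - i) * d" using c by (metis dvd_diff_nat)
    ultimately have "c dvd j - i" by (simp add: coprime_dvd_mult_left_iff)
    moreover have "j - i dvd fact K" using that by (intro dvd_fact) auto
    then have "j - i dvd d" by (simp add: d_def)
    ultimately have "c dvd d" by (rule dvd_trans)
    with \<open>coprime c d\<close> show "is_unit c" by (metis coprime_absorb_left coprime_commute)
  qed
  have "\<exists>!x. x < (\<Prod>i\<in>{..K}. m i) \<and> (\<forall>i\<in>{..K}. [x = f i] (mod m i))"
  proof (rule chinese_remainder_unique_nat)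
    show "\<forall>i\<in>{..K}. \<forall>j\<in>{..K}. i \<noteq> j \<longrightarrow> coprime (m i) (m j)"
      using cop_less by (metis atMost_iff coprime_commute linorder_neqE_nat)
  qed (auto simp: m_def)
  then obtain x where x: "x < (\<Prod>i\<in>{..K}. m i)" "\<forall>i\<in>{..K}. [x = f i] (mod m i)" by blast
  have "(\<Prod>i\<in>{..K}. m i) \<le> (\<Prod>i\<in>{..K}. (K + 2) * d)"
  proof (rule prod_mono)
    fix i assume "i \<in> {..K}"
    then have "Suc i * d \<le> (K + 1) * d" by (intro mult_le_mono1) simp
    moreover have "(K + 2) * d = (K + 1) * d + d" by simp
    ultimately have "m i \<le> (K + 2) * d" using dpos unfolding m_def by linarith
    then show "0 \<le> m i \<and> m i \<le> (K + 2) * d" by simp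
  qed
  also have "\<dots> = ((K + 2) * d) ^ (K + 1)" by simp
  finally have "x < ((K + 2) * d) ^ (K + 1)" using x(1) by linarith
  moreover have "x mod m i = f i" if "i \<le> K" for i
  proof -
    have "f i < m i" using assms(1)[OF that] pd by (simp add: m_def)
    then show ?thesis using x(2) that by (simp add: unique_euclidean_semiring_class.cong_def)
  qed
  ultimately show ?thesis unfolding m_def d_def by blast
qed

section \<open>Paths coded by single domain elements\<close>

text \<open>\<open>c\<close> and \<open>d\<close> code a sequence whose \<open>i\<close>-th entry is the residue of \<open>s\<close> modulo \<open>p\<close>. All
  intermediate results are required to be domain elements. A \<open>chain\<close> guesses two such
  sequences, one for each component of the nodes of a path along \<open>R\<close>; it is sound for every choice of
  \<open>p\<close>, \<open>d\<close> and \<open>K\<close>, so none of them has to be definable.\<close>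

definition coded :: "nat \<Rightarrow> nat \<Rightarrow> nat \<Rightarrow> nat \<Rightarrow> nat \<Rightarrow> nat \<Rightarrow> bool" where
  "coded n d p c i s \<longleftrightarrow> (\<exists>j<n. \<exists>t<n. \<exists>m<n. \<exists>r<n.
     Suc i = j \<and> j * d = t \<and> Suc t = m \<and> c mod m = r \<and> s mod p = r)"

definition chain ::
  "nat \<Rightarrow> (nat \<Rightarrow> bool) \<Rightarrow> (nat \<Rightarrow> nat \<Rightarrow> nat \<Rightarrow> nat \<Rightarrow> bool) \<Rightarrow> nat \<Rightarrow> nat \<Rightarrow> nat \<Rightarrow> nat \<Rightarrow> bool" where
  "chain n V R x1 x2 y1 y2 \<longleftrightarrow> (\<exists>p<n. \<exists>d<n. \<exists>K<n. \<exists>c1<n. \<exists>c2<n.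
     (\<forall>s<n. \<forall>t<n. \<forall>r<n. V s \<and> V t \<and> s mod p = r \<and> t mod p = r \<longrightarrow> s = t) \<and>
     (\<exists>z<n. z = 0 \<and> coded n d p c1 z x1 \<and> coded n d p c2 z x2) \<and>
     coded n d p c1 K y1 \<and> coded n d p c2 K y2 \<and>
     (\<forall>i<n. i < K \<longrightarrow> (\<exists>j<n. \<exists>s1<n. \<exists>s2<n. \<exists>t1<n. \<exists>t2<n. Suc i = j \<and>
        V s1 \<and> V s2 \<and> V t1 \<and> V t2 \<and>
        coded n d p c1 i s1 \<and> coded n d p c2 i s2 \<and>
        coded n d p c1 j t1 \<and> coded n d p c2 j t2 \<and> R s1 s2 t1 t2)))"

lemma definable_coded:
  assumes "d < k" "p < k" "c < k" "i < k" "s < k"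
  shows "definable ar k (\<lambda>n S a. coded n (a d) (a p) (a c) (a i) (a s))"
  unfolding coded_def using assms
  apply -
  apply (rule definable_intros definable_Suc definable_mod | (simp; fail))+
  done

text \<open>\<open>V\<close> and \<open>R\<close> occur under the quantifiers of
  \<open>chain\<close>, hence their definability is asked for in every larger context
  \<open>k'\<close>, and \<open>dV\<close>, \<open>dR\<close> say that they ignore the variables
  bound there.\<close>

lemma definable_chain:
  assumes "x1 < k" "x2 < k" "y1 < k" "y2 < k"
    and V: "\<And>k' i. k \<le> k' \<Longrightarrow> i < k' \<Longrightarrow> definable ar k' (\<lambda>n S a. V n S a (a i))"
    and R: "\<And>k' s1 s2 t1 t2. k \<le> k' \<Longrightarrow> s1 < k' \<Longrightarrow> s2 < k' \<Longrightarrow> t1 < k' \<Longrightarrow> t2 < k' \<Longrightarrow>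
      definable ar k' (\<lambda>n S a. R n S a (a s1) (a s2) (a t1) (a t2))"
    and dV: "\<And>n S a k' d. k \<le> k' \<Longrightarrow> V n S (a(k' := d)) = V n S a"
    and dR: "\<And>n S a k' d. k \<le> k' \<Longrightarrow> R n S (a(k' := d)) = R n S a"
  shows "definable ar k (\<lambda>n S a. chain n (V n S a) (R n S a) (a x1) (a x2) (a y1) (a y2))"
  unfolding chain_def using assms(1-4)
  apply -
  apply (rule definable_intros definable_Suc definable_mod definable_coded definable_eq_const V R | (simp add: dV dR; fail))+
  done

lemma coded_unique:
  assumes "coded n d p c i s" "coded n d p c i s'" "V s" "V s'" "s < n" "s' < n"
    and "\<forall>s<n. \<forall>t<n. \<forall>r<n. V s \<and> V t \<and> s mod p = r \<and> t mod p = r \<longrightarrow> s = t"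
  shows "s = s'"
  using assms unfolding coded_def by metis

text \<open>Each step guesses its own endpoints. Consecutive steps fit together because the guard
  makes residues injective on \<open>V\<close>, so that the code determines the node at each
  index.\<close>

lemma chain_sound:
  assumes "chain n V R x1 x2 y1 y2" "V x1" "V x2" "V y1" "V y2" "x1 < n" "x2 < n" "y1 < n" "y2 < n"
  shows "((x1, x2), (y1, y2)) \<in> {((s1, s2), (t1, t2)). R s1 s2 t1 t2}\<^sup>*"
proof -
  obtain p d K c1 c2 where K: "K < n" and
    inj: "\<forall>s<n. \<forall>t<n. \<forall>r<n. V s \<and> V t \<and> s mod p = r \<and> t mod p = r \<longrightarrow> s = t"
    and x: "coded n d p c1 0 x1" "coded n d p c2 0 x2"
    and y: "coded n d p c1 K y1" "coded n d p c2 K y2"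
    and step: "\<forall>i<n. i < K \<longrightarrow> (\<exists>j<n. \<exists>s1<n. \<exists>s2<n. \<exists>t1<n. \<exists>t2<n. Suc i = j \<and>
        V s1 \<and> V s2 \<and> V t1 \<and> V t2 \<and>
        coded n d p c1 i s1 \<and> coded n d p c2 i s2 \<and>
        coded n d p c1 j t1 \<and> coded n d p c2 j t2 \<and> R s1 s2 t1 t2)"
    using assms(1) unfolding chain_def by (elim exE conjE, hypsubst) (rule that; assumption)
  have uniq: "s = s'" if "coded n d p c i s" "coded n d p c i s'" "V s" "V s'" "s < n" "s' < n" for c i s s'
    using coded_unique[OF that inj] .
  have "((x1, x2), (s1, s2)) \<in> {((s1, s2), (t1, t2)). R s1 s2 t1 t2}\<^sup>*"
    if "i \<le> K" "coded n d p c1 i s1" "coded n d p c2 i s2" "V s1" "V s2" "s1 < n" "s2 < n" for i s1 s2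
    using that
  proof (induction i arbitrary: s1 s2)
    case 0
    then have "s1 = x1" "s2 = x2"
      using uniq[of c1 0 s1 x1] uniq[of c2 0 s2 x2] x assms by simp_all
    then show ?case by simp
  next
    case (Suc i)
    have "i < n" "i < K" using Suc.prems(1) K by auto
    with step obtain j u1 u2 t1 t2 where u: "u1 < n" "u2 < n" "t1 < n" "t2 < n" "Suc i = j"
        "V u1" "V u2" "V t1" "V t2"
        "coded n d p c1 i u1" "coded n d p c2 i u2"
        "coded n d p c1 j t1" "coded n d p c2 j t2" "R u1 u2 t1 t2"
      by blast
    have "t1 = s1" "t2 = s2"
      using uniq[of c1 j t1 s1] uniq[of c2 j t2 s2] u Suc.prems by simp_all
    with u have "((u1, u2), (s1, s2)) \<in> {((s1, s2), (t1, t2)). R s1 s2 t1 t2}" by simp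
    moreover have "((x1, x2), (u1, u2)) \<in> {((s1, s2), (t1, t2)). R s1 s2 t1 t2}\<^sup>*"
      using Suc.IH[of u1 u2] u Suc.prems(1) by simp
    ultimately show ?case by (rule rtrancl_into_rtrancl[rotated])
  qed
  from this[of K y1 y2] show ?thesis using y assms by simp
qed

text \<open>\<open>large\<close> bounds the codes supplied by \<open>beta_sequence\<close>. Since
  moduli and indices lie below the base of that power, it also keeps all intermediate values of
  \<open>coded\<close> inside the domain.\<close>

lemma chain_complete:
  assumes "0 < p" and inj: "inj_on (\<lambda>s. s mod p) {s. s < n \<and> V s}"
    and large: "((K + 2) * (fact K * p)) ^ (K + 1) < n"
    and f: "\<And>i. i \<le> K \<Longrightarrow> fst (f i) < n \<and> snd (f i) < n \<and> V (fst (f i)) \<and> V (snd (f i))"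
    and R: "\<And>i. i < K \<Longrightarrow> R (fst (f i)) (snd (f i)) (fst (f (Suc i))) (snd (f (Suc i)))"
  shows "chain n V R (fst (f 0)) (snd (f 0)) (fst (f K)) (snd (f K))"
proof -
  define d :: nat where "d = fact K * p"
  have dpos: "0 < d" using assms(1) by (simp add: d_def)
  have pd: "p \<le> d" by (simp add: d_def)
  have base: "(K + 2) * d < n"
  proof -
    have "((K + 2) * d) ^ 1 \<le> ((K + 2) * d) ^ (K + 1)"
      by (rule power_increasing) (use dpos in auto)
    from this large show ?thesis unfolding d_def power_one_right by (rule order_le_less_trans)
  qed
  have dn: "d < n" using base by (metis add_2_eq_Suc' le_add1 mult_Suc order_le_less_trans)
  have pn: "p < n" using dn pd by simp
  have Kn: "Suc K < n"
  proof -
    have "(K + 2) * 1 \<le> (K + 2) * d" by (rule mult_le_mono2) (use dpos in simp)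
    from order_le_less_trans[OF this base] show ?thesis by simp
  qed
  have modn: "Suc (Suc i * d) < n" if "i \<le> K" for i
  proof -
    have "Suc i * d \<le> (K + 1) * d" using that by (intro mult_le_mono1) simp
    moreover have "(K + 2) * d = (K + 1) * d + d" by simp
    ultimately show ?thesis using base dpos by linarith
  qed
  have code: "\<exists>c<n. \<forall>i\<le>K. coded n d p c i (g i)" if "\<And>i. i \<le> K \<Longrightarrow> g i < n" for g
  proof -
    have "\<exists>c < ((K + 2) * (fact K * p)) ^ (K + 1). \<forall>i\<le>K. c mod Suc (Suc i * (fact K * p)) = g i mod p"
      by (rule beta_sequence) (use assms(1) in auto)
    then obtain c where c: "c < n" "\<And>i. i \<le> K \<Longrightarrow> c mod Suc (Suc i * d) = g i mod p"
      using large unfolding d_def by (metis order.strict_trans)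
    have "coded n d p c i (g i)" if "i \<le> K" for i
    proof -
      have "g i mod p < n" using pn assms(1) by (meson mod_less_divisor order.strict_trans)
      moreover have "Suc i < n" using that Kn by simp
      moreover have "Suc i * d < n" using modn[OF that] by simp
      ultimately show ?thesis unfolding coded_def using modn[OF that] c(2)[OF that] by blast
    qed
    with c(1) show ?thesis by blast
  qed
  obtain c1 where c1: "c1 < n" "\<And>i. i \<le> K \<Longrightarrow> coded n d p c1 i (fst (f i))"
    using code[of "\<lambda>i. fst (f i)"] f by blast
  obtain c2 where c2: "c2 < n" "\<And>i. i \<le> K \<Longrightarrow> coded n d p c2 i (snd (f i))"
    using code[of "\<lambda>i. snd (f i)"] f by blast
  have i: "\<forall>s<n. \<forall>t<n. \<forall>r<n. V s \<and> V t \<and> s mod p = r \<and> t mod p = r \<longrightarrow> s = t"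
    using inj unfolding inj_on_def by auto
  have st: "\<forall>i<n. i < K \<longrightarrow> (\<exists>j<n. \<exists>s1<n. \<exists>s2<n. \<exists>t1<n. \<exists>t2<n. Suc i = j \<and>
        V s1 \<and> V s2 \<and> V t1 \<and> V t2 \<and>
        coded n d p c1 i s1 \<and> coded n d p c2 i s2 \<and>
        coded n d p c1 j t1 \<and> coded n d p c2 j t2 \<and> R s1 s2 t1 t2)"
  proof (intro allI impI)
    fix i assume iK: "i < K"
    have "Suc i < n" using iK Kn by simp
    moreover have "i \<le> K" "Suc i \<le> K" using iK by auto
    ultimately show "\<exists>j<n. \<exists>s1<n. \<exists>s2<n. \<exists>t1<n. \<exists>t2<n. Suc i = j \<and>
        V s1 \<and> V s2 \<and> V t1 \<and> V t2 \<and>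
        coded n d p c1 i s1 \<and> coded n d p c2 i s2 \<and>
        coded n d p c1 j t1 \<and> coded n d p c2 j t2 \<and> R s1 s2 t1 t2"
      using f[of i] f[of "Suc i"] c1(2)[of i] c2(2)[of i] c1(2)[of "Suc i"] c2(2)[of "Suc i"] R[OF iK]
      by blast
  qed
  have z: "\<exists>z<n. z = 0 \<and> coded n d p c1 z (fst (f 0)) \<and> coded n d p c2 z (snd (f 0))"
    using c1(2)[of 0] c2(2)[of 0] Kn by auto
  have "K < n" using Kn by simp
  then show ?thesis
    unfolding chain_def using pn dn c1(1) c2(1) i st z c1(2)[of K] c2(2)[of K] by blast
qed

section \<open>The parameters of the coding\<close>

text \<open>Rounding up places \<open>n\<close> between two consecutive double powers of 2. The
  upper one bounds the bits of the elements of \<open>V\<close>, the lower one is what the size of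
  the codes is compared with.\<close>

lemma loglog_bounds:
  assumes "2 ^ 2 ^ j \<le> n" "0 < j"
  shows "j \<le> loglog n" "n \<le> 2 ^ 2 ^ loglog n" "2 ^ 2 ^ (loglog n - 1) < n"
    "0 \<le> log 2 (log 2 (real n))" "log 2 (log 2 (real n)) \<le> real (loglog n)"
proof -
  define L where "L = log 2 (real n)"
  have "(2::nat) ^ 1 \<le> 2 ^ 2 ^ j" by (rule power_increasing) auto
  then have n2: "2 \<le> n" using assms(1) by simp
  then have n: "real n = 2 powr L" by (simp add: L_def)
  have "real (2 ^ 2 ^ j) \<le> real n" using assms(1) by (simp only: of_nat_le_iff)
  then have "2 powr (2 ^ j) \<le> 2 powr L" unfolding n[symmetric] by (simp add: powr_realpow[symmetric])
  then have L: "2 ^ j \<le> L" by simp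
  moreover have "(1::real) \<le> 2 ^ j" by simp
  ultimately have Lpos: "1 \<le> L" by linarith
  define l where "l = log 2 L"
  have Ll: "L = 2 powr l" using Lpos by (simp add: l_def)
  have "2 powr real j \<le> 2 powr l" using L Ll by (simp add: powr_realpow)
  then have jl: "real j \<le> l" by simp
  have ll: "loglog n = nat \<lceil>l\<rceil>" by (simp add: loglog_def l_def L_def)
  show "j \<le> loglog n" unfolding ll using jl by linarith
  show l: "0 \<le> log 2 (log 2 (real n))" using jl unfolding l_def L_def by linarith
  show ub: "log 2 (log 2 (real n)) \<le> real (loglog n)"
    unfolding ll using l unfolding l_def L_def by linarith
  have "L \<le> 2 ^ loglog n"
    using ub unfolding L_def[symmetric] l_def[symmetric] Ll by (simp add: powr_realpow[symmetric])
  then have "real n \<le> 2 powr (2 ^ loglog n)" unfolding n by simp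
  also have "\<dots> = real (2 ^ 2 ^ loglog n)" by (simp add: powr_realpow[symmetric])
  finally show "n \<le> 2 ^ 2 ^ loglog n" by (simp only: of_nat_le_iff)
  have "real (loglog n - 1) < l" unfolding ll using jl assms(2) by linarith
  then have "2 ^ (loglog n - 1) < L" unfolding Ll by (simp add: powr_realpow[symmetric])
  then have "2 powr (2 ^ (loglog n - 1)) < real n" unfolding n by simp
  moreover have "2 powr (2 ^ (loglog n - 1)) = real (2 ^ 2 ^ (loglog n - 1))"
    by (simp add: powr_realpow[symmetric])
  ultimately show "2 ^ 2 ^ (loglog n - 1) < n" by (simp only: of_nat_less_iff)
qed

text \<open>\<open>log n\<close> is \<open>2\<close> to the power \<open>log log n\<close>, so the
  exponent \<open>e * log log n\<close> makes the square of \<open>log log n\<close> appear.\<close>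

lemma batch_size_le:
  assumes "2 ^ 2 ^ j \<le> n" "0 < j" "e \<le> real E"
  shows "batch_size e n \<le> 2 ^ (E * (loglog n)\<^sup>2)"
proof -
  define l where "l = log 2 (log 2 (real n))"
  have "(2::nat) ^ 1 \<le> 2 ^ 2 ^ j" by (rule power_increasing) auto
  then have n2: "2 \<le> n" using assms(1) by simp
  have l: "0 \<le> l" "l \<le> real (loglog n)" using loglog_bounds[OF assms(1,2)] by (auto simp: l_def)
  have "0 < log 2 (real n)" using n2 by simp
  then have "log 2 (real n) = 2 powr l" by (simp add: l_def)
  then have "batch_size e n = (2 powr l) powr (e * l)" using n2 by (simp add: batch_size_def l_def)
  also have "\<dots> = 2 powr (l * (e * l))" by (simp add: powr_powr)
  also have "\<dots> \<le> 2 powr (real (E * (loglog n)\<^sup>2))"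
  proof -
    have "l * (e * l) = e * l\<^sup>2" by (simp add: power2_eq_square)
    also have "\<dots> \<le> real E * l\<^sup>2" using assms(3) by (rule mult_right_mono) simp
    also have "\<dots> \<le> real E * (real (loglog n))\<^sup>2"
      using l by (intro mult_left_mono power_mono) auto
    finally show ?thesis by simp
  qed
  also have "\<dots> = 2 ^ (E * (loglog n)\<^sup>2)" by (rule powr_realpow) simp
  finally show ?thesis .
qed

text \<open>\<open>V\<close> can be hashed such that \<open>r\<close> rounds, each of which multiplies the length of paths by \<open>K\<close>,
  reach the number of pairs of nodes in \<open>V \<times> V\<close>, which bounds the length of shortest paths.\<close>

definition codable :: "nat \<Rightarrow> nat set \<Rightarrow> nat \<Rightarrow> bool" where
  "codable n V r \<longleftrightarrow> (\<exists>p K. 0 < p \<and> 0 < K \<and> inj_on (\<lambda>s. s mod p) V \<and>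
     ((K + 2) * (fact K * p)) ^ (K + 1) < n \<and> card V ^ 4 \<le> K ^ r)"

text \<open>The left side is the bit length of a code for \<open>K = 2 ^ k\<close>:
  \<open>k + 1\<close> bits for \<open>K + 2\<close>, \<open>k * 2 ^ k\<close> for
  \<open>K!\<close>, the remaining summand for the modulus \<open>p\<close>, all raised to the power
  \<open>K + 1\<close>. It grows like \<open>k * 4 ^ k\<close>, which leaves ample room below
  \<open>2 ^ (4 * k - 1)\<close>.\<close>

lemma code_length_bound:
  "\<exists>k0. \<forall>k\<ge>k0. (k + 1 + k * 2 ^ k + ((4 * k + 3) + 2 * (E * (4 * k + 3)\<^sup>2 + c) + 2)) * (2 ^ k + 1)
      \<le> (2::nat) ^ (4 * k - 1)"
proof -
  have "\<forall>\<^sub>F k in sequentially. (real k + 1 + real k * 2 powr (real k) +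
      ((4 * real k + 3) + 2 * (real E * (4 * real k + 3)\<^sup>2 + real c) + 2)) * (2 powr (real k) + 1)
      \<le> 2 powr (4 * real k - 1)"
    by real_asymp
  then obtain k0 where k0: "\<And>k. k \<ge> k0 \<Longrightarrow> (real k + 1 + real k * 2 powr (real k) +
      ((4 * real k + 3) + 2 * (real E * (4 * real k + 3)\<^sup>2 + real c) + 2)) * (2 powr (real k) + 1)
      \<le> 2 powr (4 * real k - 1)"
    unfolding eventually_sequentially by blast
  have "(k + 1 + k * 2 ^ k + ((4 * k + 3) + 2 * (E * (4 * k + 3)\<^sup>2 + c) + 2)) * (2 ^ k + 1)
      \<le> (2::nat) ^ (4 * k - 1)" if "k \<ge> Suc k0" for k
  proof -
    have "4 * real k - 1 = real (4 * k - 1)" using that by (simp add: of_nat_diff)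
    then have "2 powr (4 * real k - 1) = 2 ^ (4 * k - 1)" by (simp only: powr_realpow zero_less_numeral)
    then have rhs: "2 powr (4 * real k - 1) = real (2 ^ (4 * k - 1))" by simp
    have lhs: "(real k + 1 + real k * 2 powr (real k) +
        ((4 * real k + 3) + 2 * (real E * (4 * real k + 3)\<^sup>2 + real c) + 2)) * (2 powr (real k) + 1)
      = real ((k + 1 + k * 2 ^ k + ((4 * k + 3) + 2 * (E * (4 * k + 3)\<^sup>2 + c) + 2)) * (2 ^ k + 1))"
      by (simp only: of_nat_mult of_nat_add of_nat_power of_nat_numeral of_nat_1 powr_realpow
          zero_less_numeral)
    have "k0 \<le> k" using that by simp
    from k0[OF this] have "real ((k + 1 + k * 2 ^ k + ((4 * k + 3) + 2 * (E * (4 * k + 3)\<^sup>2 + c) + 2)) * (2 ^ k + 1))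
      \<le> real (2 ^ (4 * k - 1))"
      unfolding lhs rhs .
    then show ?thesis by (simp only: of_nat_le_iff)
  qed
  then show ?thesis by blast
qed

lemma fact_le_two_power: "fact (2 ^ k) \<le> (2::nat) ^ (k * 2 ^ k)"
proof -
  have "fact (2 ^ k) \<le> ((2::nat) ^ k) ^ (2 ^ k)" using fact_le_power[of "2 ^ k"] by simp
  then show ?thesis by (simp add: power_mult)
qed

text \<open>The factor \<open>c0\<close> makes room for several endpoints per change and for
  parameters. One round is subtracted because the first one only enters single steps;
  \<open>1 \<le> c * loglog n\<close> keeps this subtraction exact.\<close>

lemma codable_eventually:
  "\<exists>c n0. \<forall>n\<ge>n0. 1 \<le> c * loglog n \<and>
     (\<forall>V \<subseteq> {..<n}. real (card V) \<le> real c0 * (1 + batch_size e n) \<longrightarrow> codable n V (c * loglog n - 1))"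
proof -
  define E where "E = nat \<lceil>e\<rceil>"
  have eE: "e \<le> real E" unfolding E_def by linarith
  define c1 where "c1 = Suc (2 * c0)"
  obtain k0 where k0: "\<And>k. k \<ge> k0 \<Longrightarrow>
      (k + 1 + k * 2 ^ k + ((4 * k + 3) + 2 * (E * (4 * k + 3)\<^sup>2 + c1) + 2)) * (2 ^ k + 1)
      \<le> (2::nat) ^ (4 * k - 1)"
    using code_length_bound[of E c1] by blast
  \<comment> \<open>\<open>j\<close> makes \<open>l\<close> large enough for
    \<open>k0 \<le> k\<close> and \<open>3 * c1 \<le> l\<close>. The constant \<open>c\<close> comes
    from the final estimate \<open>4 * m \<le> k * (c * l - 1)\<close>: with
    \<open>l \<le> 8 * k\<close> the quadratic part of \<open>m\<close> demands
    \<open>32 * E\<close>, and 16 absorbs \<open>c1\<close> and the subtracted round.\<close>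
  define j where "j = 4 * k0 + 3 * c1 + 8"
  define c where "c = 32 * E + 16"
  have main: "codable n V (c * loglog n - 1)"
    if n: "2 ^ 2 ^ j \<le> n" and V: "V \<subseteq> {..<n}" "real (card V) \<le> real c0 * (1 + batch_size e n)" for n V
  proof -
    define l where "l = loglog n"
    have j0: "0 < j" by (simp add: j_def)
    note b = loglog_bounds[OF n j0, folded l_def]
    define k where "k = l div 4"
    have kl: "4 * k \<le> l" "l \<le> 4 * k + 3" by (auto simp: k_def)
    have kk: "k0 \<le> k" "1 \<le> k" "l \<le> 8 * k" using b(1) kl by (auto simp: j_def)
    have lc: "3 * c1 \<le> l" "1 \<le> l" using b(1) by (auto simp: j_def)
    define m where "m = E * l\<^sup>2 + c1"
    have "real (card V) \<le> real (2 ^ m)"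
    proof -
      have bs: "batch_size e n \<le> 2 ^ (E * l\<^sup>2)" using batch_size_le[OF n j0 eE] by (simp add: l_def)
      have "real (card V) \<le> real c0 * (1 + 2 ^ (E * l\<^sup>2))"
        by (rule order.trans[OF V(2)]) (intro mult_left_mono add_left_mono bs, simp)
      also have "\<dots> \<le> real c0 * (2 * 2 ^ (E * l\<^sup>2))" by (intro mult_left_mono) auto
      also have "\<dots> = real (2 * c0) * 2 ^ (E * l\<^sup>2)" by simp
      also have "\<dots> \<le> real (2 ^ c1) * 2 ^ (E * l\<^sup>2)"
      proof (intro mult_right_mono)
        have "2 * c0 \<le> 2 ^ c1" unfolding c1_def
          by (metis less_exp less_imp_le order.trans lessI)
        then show "real (2 * c0) \<le> real (2 ^ c1)" by (simp only: of_nat_le_iff)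
      qed simp
      also have "\<dots> = real (2 ^ m)" by (simp add: m_def power_add)
      finally show ?thesis .
    qed
    then have card: "card V \<le> 2 ^ m" by (simp only: of_nat_le_iff)
    have "V \<subseteq> {..<2 ^ (2 ^ l)}" using V(1) b(2) by auto
    then obtain p where p: "0 < p" "p \<le> 2 * (2 ^ l * (2 ^ m)\<^sup>2) + 1" "inj_on (\<lambda>s. s mod p) V"
      using exists_injective_modulus[OF _ card, of "2 ^ l"] by auto
    define B where "B = l + 2 * m + 2"
    have "p \<le> 2 ^ B"
    proof -
      have "2 * (2 ^ l * (2 ^ m)\<^sup>2) = (2::nat) ^ (l + 2 * m + 1)"
        by (simp add: power_add power_mult power2_eq_square mult_ac)
      moreover have "(2::nat) ^ B = 2 * 2 ^ (l + 2 * m + 1)" by (simp add: B_def)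
      moreover have "(1::nat) \<le> 2 ^ (l + 2 * m + 1)" by simp
      ultimately show ?thesis using p(2) by linarith
    qed
    have "(2::nat) ^ k + 2 \<le> 2 ^ (k + 1)"
    proof -
      have "(2::nat) ^ 1 \<le> 2 ^ k" using kk(2) by (intro power_increasing) auto
      then show ?thesis by simp
    qed
    then have "(2 ^ k + 2) * (fact (2 ^ k) * p) \<le> 2 ^ (k + 1) * (2 ^ (k * 2 ^ k) * 2 ^ B)"
      using fact_le_two_power[of k] \<open>p \<le> 2 ^ B\<close> by (intro mult_le_mono)
    also have "\<dots> = 2 ^ (k + 1 + k * 2 ^ k + B)" by (simp add: power_add)
    finally have "((2 ^ k + 2) * (fact (2 ^ k) * p)) ^ (2 ^ k + 1)
        \<le> (2 ^ (k + 1 + k * 2 ^ k + B)) ^ (2 ^ k + 1)"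
      by (rule power_mono) simp
    also have "\<dots> = 2 ^ ((k + 1 + k * 2 ^ k + B) * (2 ^ k + 1))" by (simp only: power_mult)
    also have "\<dots> \<le> 2 ^ (2 ^ (l - 1))"
    proof (rule power_increasing)
      have "B \<le> (4 * k + 3) + 2 * (E * (4 * k + 3)\<^sup>2 + c1) + 2"
        unfolding B_def m_def using kl(2) by (intro add_mono mult_le_mono power_mono) auto
      then have "(k + 1 + k * 2 ^ k + B) * (2 ^ k + 1) \<le>
          (k + 1 + k * 2 ^ k + ((4 * k + 3) + 2 * (E * (4 * k + 3)\<^sup>2 + c1) + 2)) * (2 ^ k + 1)"
        by (intro mult_le_mono1 add_left_mono)
      also have "\<dots> \<le> 2 ^ (4 * k - 1)" using k0[OF kk(1)] .
      also have "\<dots> \<le> 2 ^ (l - 1)" using kl(1) by (intro power_increasing) auto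
      finally show "(k + 1 + k * 2 ^ k + B) * (2 ^ k + 1) \<le> 2 ^ (l - 1)" .
    qed simp
    also have "\<dots> < n" by (rule b(3))
    finally have large: "((2 ^ k + 2) * (fact (2 ^ k) * p)) ^ (2 ^ k + 1) < n" .
    have "card V ^ 4 \<le> (2 ^ m) ^ 4" by (rule power_mono[OF card]) simp
    also have "\<dots> = 2 ^ (4 * m)" by (simp add: power_mult[symmetric] mult.commute)
    also have "\<dots> \<le> 2 ^ (k * (c * l - 1))"
    proof (rule power_increasing)
      have "l + 8 * (4 * m) \<le> l * (c * l)"
      proof -
        have "8 * (4 * m) = 32 * E * l\<^sup>2 + 32 * c1" by (simp add: m_def)
        moreover have "l * (c * l) = 32 * E * l\<^sup>2 + 16 * l\<^sup>2"
          by (simp add: c_def power2_eq_square algebra_simps)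
        moreover have "l \<le> l\<^sup>2" using lc(2) by (simp add: power2_eq_square)
        ultimately show ?thesis using lc(1) by linarith
      qed
      then have "8 * (4 * m) \<le> l * (c * l - 1)" by (simp add: diff_mult_distrib2)
      also have "\<dots> \<le> 8 * k * (c * l - 1)" using kk(3) by (rule mult_le_mono1)
      finally show "4 * m \<le> k * (c * l - 1)" by simp
    qed simp
    also have "\<dots> = (2 ^ k) ^ (c * l - 1)" by (simp only: power_mult)
    finally have "codable n V (c * l - 1)"
      unfolding codable_def using p large by (intro exI[of _ p] exI[of _ "2 ^ k"]) simp
    then show ?thesis by (simp add: l_def)
  qed
  have "1 \<le> c * loglog n" if "2 ^ 2 ^ j \<le> n" for n
    using loglog_bounds(1)[OF that] by (simp add: c_def j_def)
  then show ?thesis using main by (intro exI[of _ c] exI[of _ "2 ^ 2 ^ j"] allI impI conjI)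
qed

section \<open>Closure of relations on small sets\<close>

definition closure_step ::
  "nat \<Rightarrow> nat set \<Rightarrow> ((nat \<times> nat) \<times> (nat \<times> nat)) set \<Rightarrow> ((nat \<times> nat) \<times> (nat \<times> nat)) set \<Rightarrow>
    ((nat \<times> nat) \<times> (nat \<times> nat)) set" where
  "closure_step n V T R = {((x1, x2), (y1, y2)). x1 \<in> V \<and> x2 \<in> V \<and> y1 \<in> V \<and> y2 \<in> V \<and>
     ((x1 = y1 \<and> x2 = y2) \<or> ((x1, x2), (y1, y2)) \<in> T \<or>
      chain n (\<lambda>s. s \<in> V) (\<lambda>s1 s2 t1 t2. ((s1, s2), (t1, t2)) \<in> R) x1 x2 y1 y2)}"

definition restrict_nodes :: "nat set \<Rightarrow> ((nat \<times> nat) \<times> (nat \<times> nat)) set \<Rightarrow> ((nat \<times> nat) \<times> (nat \<times> nat)) set" where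
  "restrict_nodes V T = T \<inter> (V \<times> V) \<times> (V \<times> V)"

definition node_closure :: "nat set \<Rightarrow> ((nat \<times> nat) \<times> (nat \<times> nat)) set \<Rightarrow> ((nat \<times> nat) \<times> (nat \<times> nat)) set" where
  "node_closure V T = restrict_nodes V ((restrict_nodes V T)\<^sup>*)"

lemma closure_step_sound:
  assumes "V \<subseteq> {..<n}" "R \<subseteq> node_closure V T"
  shows "closure_step n V T R \<subseteq> node_closure V T"
proof
  fix z assume "z \<in> closure_step n V T R"
  then obtain x1 x2 y1 y2 where z: "z = ((x1, x2), (y1, y2))"
    and V: "x1 \<in> V" "x2 \<in> V" "y1 \<in> V" "y2 \<in> V"
    and c: "(x1 = y1 \<and> x2 = y2) \<or> ((x1, x2), (y1, y2)) \<in> T \<or>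
      chain n (\<lambda>s. s \<in> V) (\<lambda>s1 s2 t1 t2. ((s1, s2), (t1, t2)) \<in> R) x1 x2 y1 y2"
    unfolding closure_step_def by auto
  have "((x1, x2), (y1, y2)) \<in> (restrict_nodes V T)\<^sup>*"
    using c
  proof (elim disjE)
    assume "x1 = y1 \<and> x2 = y2" then show ?thesis by simp
  next
    assume "((x1, x2), (y1, y2)) \<in> T"
    then have "((x1, x2), (y1, y2)) \<in> restrict_nodes V T" using V by (simp add: restrict_nodes_def)
    then show ?thesis by (rule r_into_rtrancl)
  next
    assume "chain n (\<lambda>s. s \<in> V) (\<lambda>s1 s2 t1 t2. ((s1, s2), (t1, t2)) \<in> R) x1 x2 y1 y2"
    from chain_sound[OF this V] have "((x1, x2), (y1, y2)) \<in> R\<^sup>*"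
      using V assms(1) by auto
    moreover have "R \<subseteq> (restrict_nodes V T)\<^sup>*" using assms(2) unfolding node_closure_def restrict_nodes_def by blast
    ultimately show ?thesis by (metis rtrancl_mono rtrancl_idemp subset_iff)
  qed
  then show "z \<in> node_closure V T" using V by (simp add: node_closure_def restrict_nodes_def z)
qed

text \<open>Sampling a path of length \<open>L * K\<close> at the multiples of \<open>L\<close>
  leaves \<open>K\<close> steps along \<open>R\<close>, which a single chain codes.\<close>

lemma closure_step_relpow:
  assumes V: "V \<subseteq> {..<n}" and p: "0 < p" "inj_on (\<lambda>s. s mod p) V"
    and large: "((K + 2) * (fact K * p)) ^ (K + 1) < n"
    and pos: "0 < L" "0 < K"
    and U: "U \<subseteq> (V \<times> V) \<times> (V \<times> V)" "U ^^ L \<subseteq> R"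
  shows "U ^^ (L * K) \<subseteq> closure_step n V T R"
proof
  fix z assume "z \<in> U ^^ (L * K)"
  then obtain x y where z: "z = (x, y)" and xy: "(x, y) \<in> U ^^ (L * K)" by (cases z) auto
  obtain f where f: "f 0 = x" "f (L * K) = y" "\<forall>i<L * K. (f i, f (Suc i)) \<in> U"
    using xy unfolding relpow_fun_conv by blast
  have fV: "f i \<in> V \<times> V" if "i \<le> L * K" for i
  proof (cases "i < L * K")
    case True
    then show ?thesis using f(3) U(1) by blast
  next
    case False
    then have "i = Suc (L * K - 1)" "L * K - 1 < L * K" using that pos by auto
    then show ?thesis using f(3) U(1) by (metis (no_types, lifting) SigmaD2 subsetD)
  qed
  define g where "g = (\<lambda>i. f (L * i))"
  have graph_value: "g i \<in> V \<times> V" if "i \<le> K" for i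
    unfolding g_def using that by (intro fV) simp
  have gR: "(g i, g (Suc i)) \<in> R" if "i < K" for i
  proof -
    have "(f (L * i + j), f (L * i + Suc j)) \<in> U" if "j < L" for j
    proof -
      have "L * i + j < L * Suc i" using that by simp
      also have "\<dots> \<le> L * K" using \<open>i < K\<close> by (intro mult_le_mono2) simp
      finally show ?thesis using f(3) by simp
    qed
    then have "(f (L * i + 0), f (L * i + L)) \<in> U ^^ L"
      unfolding relpow_fun_conv by (intro exI[of _ "\<lambda>j. f (L * i + j)"]) simp
    then show ?thesis using U(2) unfolding g_def by (auto simp: add.commute)
  qed
  have inj: "inj_on (\<lambda>s. s mod p) {s. s < n \<and> s \<in> V}"
    by (rule inj_on_subset[OF p(2)]) auto
  have "chain n (\<lambda>s. s \<in> V) (\<lambda>s1 s2 t1 t2. ((s1, s2), (t1, t2)) \<in> R)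
      (fst (g 0)) (snd (g 0)) (fst (g K)) (snd (g K))"
  proof (rule chain_complete[OF p(1) inj large])
    show "fst (g i) < n \<and> snd (g i) < n \<and> fst (g i) \<in> V \<and> snd (g i) \<in> V" if "i \<le> K" for i
      using graph_value[OF that] V by (auto simp: mem_Times_iff)
    show "((fst (g i), snd (g i)), fst (g (Suc i)), snd (g (Suc i))) \<in> R" if "i < K" for i
      using gR[OF that] by simp
  qed
  moreover have "g 0 = x" "g K = y" using f by (auto simp: g_def)
  moreover have "x \<in> V \<times> V" "y \<in> V \<times> V" using graph_value[of 0] graph_value[of K] calculation by auto
  ultimately show "z \<in> closure_step n V T R" unfolding closure_step_def z by (cases x; cases y) simp
qed

lemma relpow_refl_mono:
  assumes "(x, y) \<in> T ^^ j" "j \<le> N" "T \<subseteq> U" "(y, y) \<in> U"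
  shows "(x, y) \<in> U ^^ N"
proof -
  have "(x, y) \<in> U ^^ j"
    using assms(1,3) unfolding relpow_fun_conv by blast
  moreover have "(y, y) \<in> U ^^ m" for m
    by (induction m) (use assms(4) in auto)
  ultimately have "(x, y) \<in> U ^^ (j + (N - j))" unfolding relpow_add by blast
  then show ?thesis using assms(2) by simp
qed

text \<open>Round \<open>i + 1\<close> contains all paths of length \<open>K ^ i\<close>, whence
  \<open>r < i\<close>. The start may be any sound relation, because stage 2 of the graph program is
  analyzed from the middle of the iteration.\<close>

lemma rounds_eq_node_closure:
  assumes V: "V \<subseteq> {..<n}" and cod: "codable n V r"
    and R: "R 0 \<subseteq> node_closure V T" "\<And>i. R (Suc i) = closure_step n V T (R i)"
  shows "r < i \<Longrightarrow> R i = node_closure V T"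
proof -
  have sound: "R i \<subseteq> node_closure V T" for i
    by (induction i) (use R closure_step_sound[OF V] in auto)
  obtain p K where p: "0 < p" "inj_on (\<lambda>s. s mod p) V" and K: "0 < K"
    and large: "((K + 2) * (fact K * p)) ^ (K + 1) < n" and card: "card V ^ 4 \<le> K ^ r"
    using cod unfolding codable_def by blast
  \<comment> \<open>The added loops pad shorter paths to the exact length
    \<open>K ^ j\<close>.\<close>
  define U where "U = Id_on (V \<times> V) \<union> restrict_nodes V T"
  have U: "U \<subseteq> (V \<times> V) \<times> (V \<times> V)" unfolding U_def restrict_nodes_def by blast
  have pow: "U ^^ (K ^ i) \<subseteq> R (Suc i)" for i
  proof (induction i)
    case 0
    have "U \<subseteq> closure_step n V T (R 0)" unfolding U_def restrict_nodes_def closure_step_def by blast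
    then show ?case using R by simp
  next
    case (Suc i)
    have "U ^^ (K ^ i * K) \<subseteq> closure_step n V T (R (Suc i))"
      by (rule closure_step_relpow[OF V p large _ K U Suc]) (use K in simp)
    then show ?case using R(2)[of "Suc i"] by (simp add: mult.commute)
  qed
  assume ri: "r < i"
  then obtain j where j: "i = Suc j" "r \<le> j" by (metis less_imp_Suc_add le_add1)
  have finV: "finite V" using V finite_subset by blast
  have rsub: "restrict_nodes V T \<subseteq> (V \<times> V) \<times> (V \<times> V)" unfolding restrict_nodes_def by blast
  then have fin: "finite (restrict_nodes V T)" using finV by (meson finite_SigmaI finite_subset)
  have "card (restrict_nodes V T) \<le> card ((V \<times> V) \<times> (V \<times> V))" using finV rsub by (intro card_mono) auto
  also have "\<dots> = card V ^ 4" by (simp add: card_cartesian_product eval_nat_numeral mult.assoc)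
  also have "\<dots> \<le> K ^ r" by (rule card)
  also have "\<dots> \<le> K ^ j" using K j(2) by (intro power_increasing) auto
  finally have cle: "card (restrict_nodes V T) \<le> K ^ j" .
  have "node_closure V T \<subseteq> U ^^ (K ^ j)"
  proof
    fix z assume "z \<in> node_closure V T"
    then obtain x y where z: "z = (x, y)" and xy: "(x, y) \<in> (restrict_nodes V T)\<^sup>*" "y \<in> V \<times> V"
      unfolding node_closure_def restrict_nodes_def by (cases z) auto
    obtain m where m: "m \<le> card (restrict_nodes V T)" "(x, y) \<in> (restrict_nodes V T) ^^ m"
      using xy(1) unfolding rtrancl_finite_eq_relpow[OF fin] by blast
    have "(x, y) \<in> U ^^ (K ^ j)"
      by (rule relpow_refl_mono[OF m(2)]) (use m(1) cle xy(2) in \<open>auto simp: U_def\<close>)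
    then show "z \<in> U ^^ (K ^ j)" by (simp add: z)
  qed
  also have "\<dots> \<subseteq> R (Suc j)" by (rule pow)
  finally show ?thesis using sound[of i] j(1) by blast
qed

section \<open>Forests\<close>

definition both :: "'a \<Rightarrow> 'a \<Rightarrow> ('a \<times> 'a) set" where
  "both a b = {(a, b), (b, a)}"

lemma sym_Diff_both: "sym F \<Longrightarrow> sym (F - both a b)"
  by (auto simp: sym_def both_def)

lemma sym_Un_both: "sym F \<Longrightarrow> sym (F \<union> both a b)"
  by (auto simp: sym_def both_def)

lemma rtrancl_sym: "sym F \<Longrightarrow> (x, y) \<in> F\<^sup>* \<Longrightarrow> (y, x) \<in> F\<^sup>*"
  by (metis sym_rtrancl symD)

text \<open>By symmetry of \<open>G\<close>, a second crossing of the new edge cancels the first, so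
  at most one crossing is needed.\<close>

lemma rtrancl_add_edge:
  assumes "sym G" "(x, y) \<in> (G \<union> both a b)\<^sup>*"
  shows "(x, y) \<in> G\<^sup>* \<or> (x, a) \<in> G\<^sup>* \<and> (b, y) \<in> G\<^sup>* \<or> (x, b) \<in> G\<^sup>* \<and> (a, y) \<in> G\<^sup>*"
  using assms(2)
proof (induction rule: rtrancl_induct)
  case base
  then show ?case by simp
next
  case (step y z)
  from step(2) consider "(y, z) \<in> G" | "y = a" "z = b" | "y = b" "z = a"
    unfolding both_def by blast
  then show ?case
  proof cases
    case 1
    then show ?thesis using step.IH by (meson rtrancl.rtrancl_into_rtrancl)
  next
    case 2
    then show ?thesis using step.IH rtrancl_sym[OF assms(1)] by blast
  next
    case 3
    then show ?thesis using step.IH rtrancl_sym[OF assms(1)] by blast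
  qed
qed

text \<open>Acyclicity in the form "every edge is a bridge", which matches the stored relation.
  Loops are excluded because \<open>(a, a)\<close> is always in the closure.\<close>

definition forest :: "('a \<times> 'a) set \<Rightarrow> bool" where
  "forest F \<longleftrightarrow> sym F \<and> (\<forall>(a, b)\<in>F. (a, b) \<notin> (F - both a b)\<^sup>*)"

lemma forest_subset:
  assumes "forest F" "G \<subseteq> F" "sym G"
  shows "forest G"
  unfolding forest_def
proof (intro conjI ballI, rule assms(3), clarify)
  fix a b assume "(a, b) \<in> G" "(a, b) \<in> (G - both a b)\<^sup>*"
  moreover have "(G - both a b)\<^sup>* \<subseteq> (F - both a b)\<^sup>*" using assms(2) by (intro rtrancl_mono) blast
  ultimately show False using assms(1,2) unfolding forest_def by blast
qed

text \<open>A detour around an old edge \<open>cd\<close> would have to cross \<open>ab\<close>;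
  together with \<open>cd\<close> it would connect \<open>a\<close> and \<open>b\<close> inside
  \<open>F\<close>.\<close>

lemma forest_Un_both:
  assumes F: "forest F" and ab: "(a, b) \<notin> F\<^sup>*"
  shows "forest (F \<union> both a b)"
proof -
  have s: "sym F" using F by (simp add: forest_def)
  have "(c, d) \<notin> (F \<union> both a b - both c d)\<^sup>*" if cd: "(c, d) \<in> F \<union> both a b" for c d
  proof (cases "(c, d) \<in> both a b")
    case True
    then have eq: "both c d = both a b" by (auto simp: both_def)
    have "(F \<union> both a b - both a b)\<^sup>* \<subseteq> F\<^sup>*" by (intro rtrancl_mono) blast
    moreover have "(c, d) \<notin> F\<^sup>*" using True ab rtrancl_sym[OF s] unfolding both_def by blast
    ultimately show ?thesis unfolding eq by blast
  next
    case False
    with cd have cdF: "(c, d) \<in> F" by blast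
    show ?thesis
    proof
      assume "(c, d) \<in> (F \<union> both a b - both c d)\<^sup>*"
      moreover have "F \<union> both a b - both c d \<subseteq> (F - both c d) \<union> both a b" by blast
      ultimately have "(c, d) \<in> ((F - both c d) \<union> both a b)\<^sup>*" by (meson rtrancl_mono subsetD)
      from rtrancl_add_edge[OF sym_Diff_both[OF s] this]
      have "(c, a) \<in> (F - both c d)\<^sup>* \<and> (b, d) \<in> (F - both c d)\<^sup>* \<or>
          (c, b) \<in> (F - both c d)\<^sup>* \<and> (a, d) \<in> (F - both c d)\<^sup>*"
        using F cdF unfolding forest_def by blast
      moreover have "(F - both c d)\<^sup>* \<subseteq> F\<^sup>*" by (intro rtrancl_mono) blast
      ultimately have "(c, a) \<in> F\<^sup>* \<and> (b, d) \<in> F\<^sup>* \<or> (c, b) \<in> F\<^sup>* \<and> (a, d) \<in> F\<^sup>*" by blast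
      moreover have "(c, d) \<in> F\<^sup>*" using cdF by blast
      ultimately have "(a, b) \<in> F\<^sup>*" using rtrancl_sym[OF s] by (meson rtrancl_trans)
      then show False using ab by blast
    qed
  qed
  then show ?thesis using sym_Un_both[OF s] unfolding forest_def by blast
qed

text \<open>Uniqueness of paths: if the connection in \<open>G\<close> had to cross
  \<open>ab\<close>, its two halves and the connection avoiding \<open>ab\<close> in
  \<open>F\<close> would join \<open>a\<close> and \<open>b\<close> without the bridge
  \<open>ab\<close>.\<close>

lemma forest_rtrancl_Diff_step:
  assumes F: "forest F" and G: "G \<subseteq> F" "sym G"
    and "(x, y) \<in> G\<^sup>*" "(x, y) \<in> (F - both a b)\<^sup>*"
  shows "(x, y) \<in> (G - both a b)\<^sup>*"
proof (cases "(a, b) \<in> F")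
  case False
  then have "(b, a) \<notin> F" using F unfolding forest_def by (meson symD)
  with False G(1) have "G - both a b = G" unfolding both_def by blast
  then show ?thesis using assms(4) by simp
next
  case True
  have s: "sym F" using F by (simp add: forest_def)
  have "G \<subseteq> (G - both a b) \<union> both a b" by blast
  then have "(x, y) \<in> ((G - both a b) \<union> both a b)\<^sup>*" using assms(4) by (meson rtrancl_mono subsetD)
  from rtrancl_add_edge[OF sym_Diff_both[OF G(2)] this]
  show ?thesis
  proof (elim disjE conjE)
    have sub: "(G - both a b)\<^sup>* \<subseteq> (F - both a b)\<^sup>*" using G(1) by (intro rtrancl_mono) blast
    note sF = rtrancl_sym[OF sym_Diff_both[OF s], of _ _ a b]
    have nab: "(a, b) \<notin> (F - both a b)\<^sup>*" using F True unfolding forest_def by blast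
    {
      assume "(x, a) \<in> (G - both a b)\<^sup>*" "(b, y) \<in> (G - both a b)\<^sup>*"
      then have "(a, b) \<in> (F - both a b)\<^sup>*" using sub sF assms(5) by (meson rtrancl_trans subsetD)
      with nab show ?thesis by blast
    next
      assume "(x, b) \<in> (G - both a b)\<^sup>*" "(a, y) \<in> (G - both a b)\<^sup>*"
      then have "(a, b) \<in> (F - both a b)\<^sup>*" using sub sF assms(5) by (meson rtrancl_trans subsetD)
      with nab show ?thesis by blast
    }
  qed
qed

text \<open>This turns the removal of many edges into a first-order condition on removals of single
  edges. On a cycle it fails: each edge alone is dispensable, two together are not.\<close>

lemma forest_rtrancl_Diff:
  assumes F: "forest F" and "finite D" "sym D" "(x, y) \<in> F\<^sup>*"
    and D: "\<And>a b. (a, b) \<in> D \<Longrightarrow> (x, y) \<in> (F - both a b)\<^sup>*"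
  shows "(x, y) \<in> (F - D)\<^sup>*"
proof -
  have s: "sym F" using F by (simp add: forest_def)
  have "(x, y) \<in> (F - (\<Union>(a, b)\<in>D'. both a b))\<^sup>*" if "D' \<subseteq> D" for D'
    using finite_subset[OF that \<open>finite D\<close>] that
  proof (induction D')
    case empty
    then show ?case using assms(4) by simp
  next
    case (insert e D')
    obtain a b where e: "e = (a, b)" by (cases e)
    have sy: "sym (F - (\<Union>(a, b)\<in>D'. both a b))"
      using s unfolding sym_def both_def by blast
    have "(x, y) \<in> (F - (\<Union>(a, b)\<in>D'. both a b) - both a b)\<^sup>*"
      by (rule forest_rtrancl_Diff_step[OF F _ sy]) (use insert e D in auto)
    moreover have "F - (\<Union>(a, b)\<in>D'. both a b) - both a b = F - (\<Union>(a, b)\<in>insert e D'. both a b)"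
      using e by auto
    ultimately show ?case by simp
  qed
  from this[OF subset_refl] have "(x, y) \<in> (F - (\<Union>(a, b)\<in>D. both a b))\<^sup>*" .
  moreover have "F - (\<Union>(a, b)\<in>D. both a b) \<subseteq> F - D" unfolding both_def by blast
  ultimately show ?thesis by (meson rtrancl_mono subsetD)
qed

text \<open>Kruskal's greedy choice, relative to a forest \<open>F\<close> that is kept.\<close>

definition greedy_edges :: "('a \<Rightarrow> 'a \<Rightarrow> nat) \<Rightarrow> ('a \<times> 'a) set \<Rightarrow> ('a \<times> 'a) set \<Rightarrow> ('a \<times> 'a) set" where
  "greedy_edges w F E = {(a, b)\<in>E. (a, b) \<notin> (F \<union> {(u, v)\<in>E. w u v < w a b})\<^sup>*}"

text \<open>The chosen lighter edges connect no more than all lighter edges, so adding a chosen edge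
  closes no cycle; by induction on the weight they also connect no less. Injectivity up to
  orientation makes every weight level add at most one undirected edge.\<close>

lemma greedy_forest:
  assumes F: "forest F" and E: "sym E" and w: "\<And>a b. w a b = w b a"
    and inj: "\<And>a b c d. (a, b) \<in> E \<Longrightarrow> (c, d) \<in> E \<Longrightarrow> w a b = w c d \<Longrightarrow> both a b = both c d"
  shows "forest (F \<union> greedy_edges w F E)"
    and "E \<subseteq> (F \<union> greedy_edges w F E)\<^sup>*"
proof -
  define N where "N = greedy_edges w F E"
  have s: "sym F" using F by (simp add: forest_def)
  have sw: "sym (F \<union> {(u, v)\<in>E. w u v < k})" for k
    using s E w unfolding sym_def by auto
  have sN: "sym N"
    using E rtrancl_sym[OF sw] w unfolding sym_def N_def greedy_edges_def by fastforce
  have step: "forest (F \<union> {(u, v)\<in>N. w u v < k})" for k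
  proof (induction k)
    case 0
    then show ?case using F by simp
  next
    case (Suc k)
    show ?case
    proof (cases "\<exists>a b. (a, b) \<in> N \<and> w a b = k")
      case False
      then have "{(u, v)\<in>N. w u v < Suc k} = {(u, v)\<in>N. w u v < k}" by (auto simp: less_Suc_eq)
      then show ?thesis using Suc by simp
    next
      case True
      then obtain a b where ab: "(a, b) \<in> N" "w a b = k" by blast
      have NE: "N \<subseteq> E" unfolding N_def greedy_edges_def by blast
      have "(F \<union> {(u, v)\<in>N. w u v < k})\<^sup>* \<subseteq> (F \<union> {(u, v)\<in>E. w u v < k})\<^sup>*"
        using NE by (intro rtrancl_mono) auto
      moreover have "(a, b) \<notin> (F \<union> {(u, v)\<in>E. w u v < k})\<^sup>*"
        using ab unfolding N_def greedy_edges_def by auto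
      ultimately have "forest (F \<union> {(u, v)\<in>N. w u v < k} \<union> both a b)"
        by (intro forest_Un_both Suc) blast
      moreover have "{(u, v)\<in>N. w u v < Suc k} = {(u, v)\<in>N. w u v < k} \<union> both a b"
      proof (intro set_eqI iffI)
        fix z assume "z \<in> {(u, v)\<in>N. w u v < Suc k}"
        then obtain u v where z: "z = (u, v)" "(u, v) \<in> N" "w u v < k \<or> w u v = k"
          by (auto simp: less_Suc_eq)
        then show "z \<in> {(u, v)\<in>N. w u v < k} \<union> both a b"
          using inj[of u v a b] NE ab by (auto simp: both_def)
      next
        fix z assume "z \<in> {(u, v)\<in>N. w u v < k} \<union> both a b"
        then show "z \<in> {(u, v)\<in>N. w u v < Suc k}"
          using ab w[of a b] symD[OF sN ab(1)] by (auto simp: both_def)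
      qed
      ultimately show ?thesis by (simp add: Un_assoc)
    qed
  qed
  have sFN: "sym (F \<union> N)" using s sN by (rule sym_Un)
  show "forest (F \<union> greedy_edges w F E)"
    unfolding forest_def N_def[symmetric]
  proof (intro conjI ballI, rule sFN, clarify)
    fix a b assume ab: "(a, b) \<in> F \<union> N" "(a, b) \<in> (F \<union> N - both a b)\<^sup>*"
    define Z where "Z = both a b"
    have "(a, b) \<in> (F \<union> N - Z)\<^sup>*" using ab(2) by (simp add: Z_def)
    \<comment> \<open>\<open>E\<close> may be infinite, but a path has finitely many edges and thus
      lies in a part of bounded weight, to which \<open>step\<close> applies.\<close>
    then have "\<exists>k. (a, b) \<in> (F \<union> {(u, v)\<in>N. w u v < k} - Z)\<^sup>*"
    proof (induction rule: rtrancl_induct)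
      case base
      then show ?case by blast
    next
      case (step y z)
      then obtain k where k: "(a, y) \<in> (F \<union> {(u, v)\<in>N. w u v < k} - Z)\<^sup>*" by blast
      define m where "m = max k (Suc (w y z))"
      have "(F \<union> {(u, v)\<in>N. w u v < k} - Z)\<^sup>* \<subseteq> (F \<union> {(u, v)\<in>N. w u v < m} - Z)\<^sup>*"
        by (intro rtrancl_mono) (auto simp: m_def)
      moreover have "(y, z) \<in> F \<union> {(u, v)\<in>N. w u v < m} - Z"
        using step(2) by (auto simp: m_def)
      ultimately show ?case using k by (meson rtrancl.rtrancl_into_rtrancl subsetD)
    qed
    then obtain k where k: "(a, b) \<in> (F \<union> {(u, v)\<in>N. w u v < k} - both a b)\<^sup>*"
      unfolding Z_def by blast
    define m where "m = max k (Suc (w a b))"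
    have "(F \<union> {(u, v)\<in>N. w u v < k} - both a b)\<^sup>* \<subseteq> (F \<union> {(u, v)\<in>N. w u v < m} - both a b)\<^sup>*"
      by (intro rtrancl_mono) (auto simp: m_def)
    moreover have "(a, b) \<in> F \<union> {(u, v)\<in>N. w u v < m}" using ab(1) by (auto simp: m_def)
    ultimately show False using k step[of m] unfolding forest_def by blast
  qed
  have "(a, b) \<in> (F \<union> N)\<^sup>*" if "(a, b) \<in> E" for a b
    using that
  proof (induction "w a b" arbitrary: a b rule: less_induct)
    case less
    show ?case
    proof (cases "(a, b) \<in> N")
      case True
      then show ?thesis by blast
    next
      case False
      then have "(a, b) \<in> (F \<union> {(u, v)\<in>E. w u v < w a b})\<^sup>*"
        using less.prems unfolding N_def greedy_edges_def by blast
      moreover have "F \<union> {(u, v)\<in>E. w u v < w a b} \<subseteq> (F \<union> N)\<^sup>*"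
        using less.hyps by auto
      ultimately show ?thesis using rtrancl_subset_rtrancl by blast
    qed
  qed
  then show "E \<subseteq> (F \<union> greedy_edges w F E)\<^sup>*" unfolding N_def by (intro subrelI)
qed

text \<open>Contraction of the components of \<open>B\<close> to the terminals in \<open>S\<close>.\<close>

definition contract :: "'a set \<Rightarrow> ('a \<times> 'a) set \<Rightarrow> ('a \<times> 'a) set \<Rightarrow> ('a \<times> 'a) set" where
  "contract S B X = {(x, y). x \<in> S \<and> y \<in> S \<and>
     ((x, y) \<in> B\<^sup>* \<or> (\<exists>u v. (x, u) \<in> B\<^sup>* \<and> (u, v) \<in> X \<and> (v, y) \<in> B\<^sup>*))}"

text \<open>A walk is followed by a terminal in the \<open>B\<close>-component of its current
  vertex. The hypothesis on \<open>X\<close> provides the next terminal whenever an edge of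
  \<open>X\<close> leaves the component.\<close>

lemma rtrancl_contract:
  assumes B: "sym B" and xy: "x \<in> S" "y \<in> S"
    and X: "\<And>u v. (u, v) \<in> X \<Longrightarrow> (u, v) \<in> B\<^sup>* \<or> (\<exists>s\<in>S. (u, s) \<in> B\<^sup>*) \<and> (\<exists>s\<in>S. (v, s) \<in> B\<^sup>*)"
  shows "(x, y) \<in> (contract S B X)\<^sup>* \<longleftrightarrow> (x, y) \<in> (B \<union> X)\<^sup>*"
proof
  have "contract S B X \<subseteq> (B \<union> X)\<^sup>*"
  proof
    fix z assume "z \<in> contract S B X"
    then obtain x y where z: "z = (x, y)" and
      c: "(x, y) \<in> B\<^sup>* \<or> (\<exists>u v. (x, u) \<in> B\<^sup>* \<and> (u, v) \<in> X \<and> (v, y) \<in> B\<^sup>*)"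
      unfolding contract_def by blast
    have "B\<^sup>* \<subseteq> (B \<union> X)\<^sup>*" "X \<subseteq> (B \<union> X)\<^sup>*" by (auto intro: rtrancl_mono[THEN subsetD])
    with c show "z \<in> (B \<union> X)\<^sup>*" unfolding z by (meson rtrancl_trans subsetD)
  qed
  then show "(x, y) \<in> (contract S B X)\<^sup>* \<Longrightarrow> (x, y) \<in> (B \<union> X)\<^sup>*"
    using rtrancl_subset_rtrancl by blast
next
  assume "(x, y) \<in> (B \<union> X)\<^sup>*"
  then have "\<exists>s\<in>S. (x, s) \<in> (contract S B X)\<^sup>* \<and> (s, y) \<in> B\<^sup>*"
  proof (induction rule: rtrancl_induct)
    case base
    then show ?case using xy by blast
  next
    case (step z z')
    then obtain s where s: "s \<in> S" "(x, s) \<in> (contract S B X)\<^sup>*" "(s, z) \<in> B\<^sup>*" by blast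
    show ?case
    proof (cases "(z, z') \<in> B\<^sup>*")
      case True
      then show ?thesis using s by (meson rtrancl_trans)
    next
      case False
      then have zX: "(z, z') \<in> X" using step(2) by blast
      then obtain s' where s': "s' \<in> S" "(z', s') \<in> B\<^sup>*" using X False by blast
      have "(s, s') \<in> contract S B X" unfolding contract_def using s s' zX by blast
      with s s' show ?thesis using rtrancl_sym[OF B] by (meson rtrancl.rtrancl_into_rtrancl)
    qed
  qed
  then obtain s where s: "s \<in> S" "(x, s) \<in> (contract S B X)\<^sup>*" "(s, y) \<in> B\<^sup>*" by blast
  then have "(s, y) \<in> contract S B X" unfolding contract_def using xy by blast
  with s(2) show "(x, y) \<in> (contract S B X)\<^sup>*" by (rule rtrancl_into_rtrancl)
qed

section \<open>Maintaining a spanning forest\<close>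

definition edge_less :: "nat \<Rightarrow> nat \<Rightarrow> nat \<Rightarrow> nat \<Rightarrow> bool" where
  "edge_less u v a b \<longleftrightarrow> min u v < min a b \<or> (min u v = min a b \<and> max u v < max a b)"

lemma definable_edge_less:
  assumes "u < k" "v < k" "x < k" "y < k"
  shows "definable ar k (\<lambda>n S a. edge_less (a u) (a v) (a x) (a y))"
proof -
  have "definable ar k (\<lambda>n S a.
      ((a u < a x \<and> a u < a y) \<or> (a v < a x \<and> a v < a y)) \<or>
      (\<not> ((a x < a u \<and> a x < a v) \<or> (a y < a u \<and> a y < a v)) \<and>
       ((a u < a x \<and> a v < a x) \<or> (a u < a y \<and> a v < a y))))"
    using assms apply -
    apply (rule definable_intros | (simp; fail))+
    done
  then show ?thesis
    by (rule definable_cong) (auto simp: edge_less_def min_def max_def)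
qed

text \<open>The auxiliary relation \<open>Aux 1\<close> contains \<open>[x, y, a, b]\<close> if \<open>x\<close> and \<open>y\<close> are connected in the
  maintained forest \<open>F\<close> without its edge \<open>ab\<close>. It determines \<open>F\<close>, as only the removal of a forest
  edge separates connected endpoints; and a loop \<open>aa\<close> is never a forest edge.\<close>

definition new_edge :: "graph_sym sym struct \<Rightarrow> nat \<Rightarrow> nat \<Rightarrow> bool" where
  "new_edge S u v \<longleftrightarrow> [u, v] \<in> S (Inp Edge)"

definition conn_avoiding :: "graph_sym sym struct \<Rightarrow> nat \<Rightarrow> nat \<Rightarrow> nat \<Rightarrow> nat \<Rightarrow> bool" where
  "conn_avoiding S x y a b \<longleftrightarrow> [x, y, a, b] \<in> S (Aux 1)"

definition forest_edge :: "graph_sym sym struct \<Rightarrow> nat \<Rightarrow> nat \<Rightarrow> bool" where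
  "forest_edge S a b \<longleftrightarrow> conn_avoiding S a b a a \<and> \<not> conn_avoiding S a b a b"

text \<open>Connectivity by surviving forest edges, expressed through
  \<open>forest_rtrancl_Diff\<close>. The case \<open>a = b\<close> removes nothing and demands
  connectivity in the old forest itself.\<close>

definition kept_conn :: "nat \<Rightarrow> graph_sym sym struct \<Rightarrow> nat \<Rightarrow> nat \<Rightarrow> bool" where
  "kept_conn n S x y \<longleftrightarrow> (\<forall>a<n. \<forall>b<n. a = b \<or> (forest_edge S a b \<and> \<not> new_edge S a b) \<longrightarrow> conn_avoiding S x y a b)"

text \<open>Endpoints of deleted forest edges and of inserted edges between different components. Their
  number is bounded by the size of the change.\<close>

definition terminal :: "nat \<Rightarrow> graph_sym sym struct \<Rightarrow> nat \<Rightarrow> bool" where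
  "terminal n S v \<longleftrightarrow> (\<exists>u<n. (forest_edge S u v \<and> \<not> new_edge S u v) \<or> (new_edge S u v \<and> \<not> conn_avoiding S u v u u))"

definition graph_value :: "nat \<Rightarrow> graph_sym sym struct \<Rightarrow> nat \<Rightarrow> nat \<Rightarrow> nat \<Rightarrow> nat \<Rightarrow> nat \<Rightarrow> bool" where
  "graph_value n S e1 e2 e3 e4 v \<longleftrightarrow> terminal n S v \<or> v = e1 \<or> v = e2 \<or> v = e3 \<or> v = e4"

text \<open>Stage 1 (tag 0) of the iteration: connectivity by kept forest edges and by edges smaller
  than \<open>e1 e2\<close>. An edge is added to the forest if it is not redundant in this sense.\<close>

definition select_step :: "nat \<Rightarrow> graph_sym sym struct \<Rightarrow> nat \<Rightarrow> nat \<Rightarrow> nat \<Rightarrow> nat \<Rightarrow> bool" where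
  "select_step n S e1 e2 x y \<longleftrightarrow> kept_conn n S x y \<or>
     (\<exists>u<n. \<exists>v<n. kept_conn n S x u \<and> new_edge S u v \<and> edge_less u v e1 e2 \<and> kept_conn n S v y)"

definition selected_edge :: "nat \<Rightarrow> graph_sym sym struct \<Rightarrow> nat \<Rightarrow> nat \<Rightarrow> bool" where
  "selected_edge n S u v \<longleftrightarrow> new_edge S u v \<and> (\<exists>z<n. z = 0 \<and> [z, u, v, u, v, u, u, v, v] \<notin> S Iter)"

text \<open>The conjunction gives connectivity by kept edges other than \<open>e1 e2\<close>, by
  \<open>forest_rtrancl_Diff_step\<close> for the subforest of kept edges.\<close>

definition kept_conn_avoiding :: "nat \<Rightarrow> graph_sym sym struct \<Rightarrow> nat \<Rightarrow> nat \<Rightarrow> nat \<Rightarrow> nat \<Rightarrow> bool" where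
  "kept_conn_avoiding n S e1 e2 x y \<longleftrightarrow> kept_conn n S x y \<and> conn_avoiding S x y e1 e2"

definition avoid_step :: "nat \<Rightarrow> graph_sym sym struct \<Rightarrow> nat \<Rightarrow> nat \<Rightarrow> nat \<Rightarrow> nat \<Rightarrow> bool" where
  "avoid_step n S e1 e2 x y \<longleftrightarrow> kept_conn_avoiding n S e1 e2 x y \<or>
     (\<exists>u<n. \<exists>v<n. kept_conn_avoiding n S e1 e2 x u \<and> selected_edge n S u v \<and>
       \<not> ((u = e1 \<and> v = e2) \<or> (u = e2 \<and> v = e1)) \<and> kept_conn_avoiding n S e1 e2 v y)"

text \<open>Stage 2 (tag 1), the connectivity in the new forest without the edge \<open>e1 e2\<close>, may use the
  result of stage 1 only negatively and hence not before that result is complete. Since stage 1 is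
  sound, its completeness can be recognized by closure properties.\<close>

definition selection_closed :: "nat \<Rightarrow> graph_sym sym struct \<Rightarrow> nat \<Rightarrow> nat \<Rightarrow> nat \<Rightarrow> bool" where
  "selection_closed n S z e1 e2 \<longleftrightarrow>
     (\<forall>x<n. \<forall>y<n. graph_value n S e1 e2 e1 e2 x \<and> graph_value n S e1 e2 e1 e2 y \<and> (x = y \<or> select_step n S e1 e2 x y) \<longrightarrow>
        [z, e1, e2, e1, e2, x, x, y, y] \<in> S Iter) \<and>
     (\<forall>x<n. \<forall>y<n. \<forall>w<n. [z, e1, e2, e1, e2, x, x, y, y] \<in> S Iter \<and>
        [z, e1, e2, e1, e2, y, y, w, w] \<in> S Iter \<longrightarrow> [z, e1, e2, e1, e2, x, x, w, w] \<in> S Iter)"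

definition selection_done :: "nat \<Rightarrow> graph_sym sym struct \<Rightarrow> bool" where
  "selection_done n S \<longleftrightarrow> (\<forall>e1<n. \<forall>e2<n. \<exists>z<n. z = 0 \<and> selection_closed n S z e1 e2)"

text \<open>The iterated relation contains \<open>[g, e1, e2, e3, e4, x1, x2, y1, y2]\<close> with tag \<open>g\<close>, parameters
  \<open>e1, \<dots>, e4\<close> and a pair of nodes. Vertices \<open>x\<close> are represented by nodes \<open>(x, x)\<close>, and the parameters
  belong to the set on which the closure is computed. Stage 2 uses \<open>e3\<close> and \<open>e4\<close> for the queried
  pair of vertices.\<close>

definition graph_round :: "nat \<Rightarrow> graph_sym sym struct \<Rightarrow> nat \<Rightarrow> nat \<Rightarrow> nat \<Rightarrow> nat \<Rightarrow> nat \<Rightarrow>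
    nat \<Rightarrow> nat \<Rightarrow> nat \<Rightarrow> nat \<Rightarrow> bool" where
  "graph_round n S g e1 e2 e3 e4 x1 x2 y1 y2 \<longleftrightarrow>
     (g = 0 \<or> (g = 1 \<and> selection_done n S)) \<and>
     graph_value n S e1 e2 e3 e4 x1 \<and> graph_value n S e1 e2 e3 e4 x2 \<and> graph_value n S e1 e2 e3 e4 y1 \<and> graph_value n S e1 e2 e3 e4 y2 \<and>
     ((x1 = y1 \<and> x2 = y2) \<or>
      (x1 = x2 \<and> y1 = y2 \<and> ((g = 0 \<and> select_step n S e1 e2 x1 y1) \<or> (g = 1 \<and> avoid_step n S e1 e2 x1 y1))) \<or>
      chain n (graph_value n S e1 e2 e3 e4) (\<lambda>s1 s2 t1 t2. [g, e1, e2, e3, e4, s1, s2, t1, t2] \<in> S Iter) x1 x2 y1 y2)"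

section \<open>Definability of the graph rounds\<close>

abbreviation "graph_arity \<equiv> sym_arity (\<lambda>_::graph_sym. 2) [2, 4] 9"

lemma graph_arity:
  "graph_arity (Inp Edge) = Some 2" "graph_arity (Aux 1) = Some 4" "graph_arity Iter = Some 9"
  by (simp_all add: sym_arity_def)

lemma definable_new_edge: "i < k \<Longrightarrow> j < k \<Longrightarrow> definable graph_arity k (\<lambda>n S a. new_edge S (a i) (a j))"
  unfolding new_edge_def by (rule definable_rel2) (simp_all add: graph_arity)

lemma definable_conn_avoiding: "i < k \<Longrightarrow> j < k \<Longrightarrow> l < k \<Longrightarrow> m < k \<Longrightarrow>
    definable graph_arity k (\<lambda>n S a. conn_avoiding S (a i) (a j) (a l) (a m))"
  unfolding conn_avoiding_def by (rule definable_rel4) (simp_all add: graph_arity[unfolded One_nat_def])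

lemmas definable_Iter = definable_rel9[where ar = graph_arity and r = Iter, OF graph_arity(3)]

lemma definable_forest_edge: "i < k \<Longrightarrow> j < k \<Longrightarrow> definable graph_arity k (\<lambda>n S a. forest_edge S (a i) (a j))"
  unfolding forest_edge_def
  apply (rule definable_intros definable_conn_avoiding | (simp; fail))+
  done

lemma definable_kept_conn: "i < k \<Longrightarrow> j < k \<Longrightarrow> definable graph_arity k (\<lambda>n S a. kept_conn n S (a i) (a j))"
  unfolding kept_conn_def
  apply (rule definable_intros definable_conn_avoiding definable_new_edge definable_forest_edge | (simp; fail))+
  done

lemma definable_terminal: "i < k \<Longrightarrow> definable graph_arity k (\<lambda>n S a. terminal n S (a i))"
  unfolding terminal_def
  apply (rule definable_intros definable_conn_avoiding definable_new_edge definable_forest_edge | (simp; fail))+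
  done

lemma definable_graph_value: "e1 < k \<Longrightarrow> e2 < k \<Longrightarrow> e3 < k \<Longrightarrow> e4 < k \<Longrightarrow> i < k \<Longrightarrow>
    definable graph_arity k (\<lambda>n S a. graph_value n S (a e1) (a e2) (a e3) (a e4) (a i))"
  unfolding graph_value_def
  apply (rule definable_intros definable_terminal | (simp; fail))+
  done

lemma definable_select_step: "e1 < k \<Longrightarrow> e2 < k \<Longrightarrow> i < k \<Longrightarrow> j < k \<Longrightarrow>
    definable graph_arity k (\<lambda>n S a. select_step n S (a e1) (a e2) (a i) (a j))"
  unfolding select_step_def
  apply (rule definable_intros definable_kept_conn definable_new_edge definable_edge_less | (simp; fail))+
  done

lemma definable_selected_edge: "i < k \<Longrightarrow> j < k \<Longrightarrow> definable graph_arity k (\<lambda>n S a. selected_edge n S (a i) (a j))"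
  unfolding selected_edge_def
  apply (rule definable_intros definable_new_edge definable_Iter definable_eq_const | (simp; fail))+
  done

lemma definable_kept_conn_avoiding: "e1 < k \<Longrightarrow> e2 < k \<Longrightarrow> i < k \<Longrightarrow> j < k \<Longrightarrow>
    definable graph_arity k (\<lambda>n S a. kept_conn_avoiding n S (a e1) (a e2) (a i) (a j))"
  unfolding kept_conn_avoiding_def
  apply (rule definable_intros definable_kept_conn definable_conn_avoiding | (simp; fail))+
  done

lemma definable_avoid_step: "e1 < k \<Longrightarrow> e2 < k \<Longrightarrow> i < k \<Longrightarrow> j < k \<Longrightarrow>
    definable graph_arity k (\<lambda>n S a. avoid_step n S (a e1) (a e2) (a i) (a j))"
  unfolding avoid_step_def
  apply (rule definable_intros definable_kept_conn_avoiding definable_selected_edge | (simp; fail))+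
  done

lemma definable_selection_closed: "z < k \<Longrightarrow> e1 < k \<Longrightarrow> e2 < k \<Longrightarrow>
    definable graph_arity k (\<lambda>n S a. selection_closed n S (a z) (a e1) (a e2))"
  unfolding selection_closed_def
  apply (rule definable_intros definable_graph_value definable_select_step definable_Iter | (simp; fail))+
  done

lemma definable_selection_done: "definable graph_arity k (\<lambda>n S a. selection_done n S)"
  unfolding selection_done_def
  apply (rule definable_intros definable_selection_closed definable_eq_const | (simp; fail))+
  done

lemma definable_graph_round: "definable graph_arity 9
    (\<lambda>n S a. graph_round n S (a 0) (a 1) (a 2) (a 3) (a 4) (a 5) (a 6) (a 7) (a 8))"
proof -
  have chain: "definable graph_arity 9 (\<lambda>n S a. chain n (graph_value n S (a 1) (a 2) (a 3) (a 4))
      (\<lambda>s1 s2 t1 t2. [a 0, a 1, a 2, a 3, a 4, s1, s2, t1, t2] \<in> S Iter) (a 5) (a 6) (a 7) (a 8))"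
    apply (rule definable_chain[where V = "\<lambda>n S a. graph_value n S (a 1) (a 2) (a 3) (a 4)" and
          R = "\<lambda>n S a s1 s2 t1 t2. [a 0, a 1, a 2, a 3, a 4, s1, s2, t1, t2] \<in> S Iter"])
           apply (rule definable_graph_value definable_Iter | (simp; fail))+
    done
  show ?thesis
    unfolding graph_round_def
    apply (rule definable_intros definable_graph_value definable_select_step definable_avoid_step definable_selection_done definable_eq_const chain | (simp; fail))+
    done
qed

section \<open>Meaning of the graph predicates for one change\<close>

definition diag :: "('a \<times> 'a) set \<Rightarrow> (('a \<times> 'a) \<times> ('a \<times> 'a)) set" where
  "diag T = {((x1, x2), (y1, y2)). x1 = x2 \<and> y1 = y2 \<and> (x1, y1) \<in> T}"

lemma rtrancl_diag: "((x, x), (y, y)) \<in> (diag T)\<^sup>* \<longleftrightarrow> (x, y) \<in> T\<^sup>*"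
proof
  have "z = (x, x) \<or> (\<exists>y. z = (y, y) \<and> (x, y) \<in> T\<^sup>*)" if "((x, x), z) \<in> (diag T)\<^sup>*" for z
    using that
  proof (induction rule: rtrancl_induct)
    case base
    then show ?case by simp
  next
    case (step z z')
    then show ?case by (auto simp: diag_def intro: rtrancl_into_rtrancl)
  qed
  then show "((x, x), (y, y)) \<in> (diag T)\<^sup>* \<Longrightarrow> (x, y) \<in> T\<^sup>*" by blast
next
  assume "(x, y) \<in> T\<^sup>*"
  then show "((x, x), (y, y)) \<in> (diag T)\<^sup>*"
  proof (induction rule: rtrancl_induct)
    case (step y z)
    then have "((y, y), (z, z)) \<in> diag T" by (simp add: diag_def)
    with step.IH show ?case by (rule rtrancl_into_rtrancl)
  qed simp
qed

lemma node_closure_diag: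
  assumes "T \<subseteq> V \<times> V" "x \<in> V" "y \<in> V"
  shows "((x, x), (y, y)) \<in> node_closure V (diag T) \<longleftrightarrow> (x, y) \<in> T\<^sup>*"
proof -
  have "restrict_nodes V (diag T) = diag T" using assms(1) unfolding restrict_nodes_def diag_def by blast
  then show ?thesis using assms(2,3) rtrancl_diag[of x y T] by (simp add: node_closure_def restrict_nodes_def)
qed

text \<open>\<open>I\<close> and \<open>E'\<close> belong to the changed graph, whereas
  \<open>A\<close> still describes a spanning forest \<open>F\<close> of the old graph
  \<open>E\<close>. \<open>E\<close> itself is invisible to the program and enters only through the
  bound on the number of terminals.\<close>

locale graph_update =
  fixes n r :: nat and I :: "graph_sym struct" and A :: "nat \<Rightarrow> nat list set"
    and F E E' :: "(nat \<times> nat) set"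
  assumes E'_eq: "E' = {(u, v). [u, v] \<in> I Edge}"
    and E': "E' \<subseteq> {..<n} \<times> {..<n}" "sym E'"
    and E: "E \<subseteq> {..<n} \<times> {..<n}"
    and F: "forest F" "F \<subseteq> E" "E \<subseteq> F\<^sup>*"
    and aux: "A 1 = {[x, y, a, b] | x y a b. x < n \<and> y < n \<and> a < n \<and> b < n \<and> (x, y) \<in> (F - both a b)\<^sup>*}"
    and n1: "1 < n"
    and cod: "\<And>e1 e2 e3 e4 W. W \<subseteq> {..<n} \<Longrightarrow>
      W \<subseteq> {v. \<exists>u. (u, v) \<in> (E - E') \<union> (E' - E)} \<union> {e1, e2, e3, e4} \<Longrightarrow> codable n W r"
begin

abbreviation St :: "nat list set \<Rightarrow> graph_sym sym struct" where
  "St X \<equiv> combine I A X"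

definition B :: "(nat \<times> nat) set" where "B = F \<inter> E'"

text \<open>The order \<open>edge_less\<close> as a numeric weight for \<open>greedy_edges\<close>.
  Its values may exceed the domain, hence formulas use \<open>edge_less\<close>.\<close>

definition w :: "nat \<Rightarrow> nat \<Rightarrow> nat" where "w u v = min u v * n + max u v"

lemma symF: "sym F" using F(1) by (simp add: forest_def)

lemma symB: "sym B" unfolding B_def using symF E'(2) by (rule sym_Int)

lemma forestB: "forest B" using F(1) symB
  by (intro forest_subset[of F B]) (auto simp: B_def)

lemma new_edge: "new_edge (St X) u v \<longleftrightarrow> (u, v) \<in> E'"
  by (simp add: new_edge_def combine_def E'_eq)

lemma conn_avoiding: "x < n \<Longrightarrow> y < n \<Longrightarrow> a < n \<Longrightarrow> b < n \<Longrightarrow> conn_avoiding (St X) x y a b \<longleftrightarrow> (x, y) \<in> (F - both a b)\<^sup>*"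
  by (simp add: conn_avoiding_def combine_def aux[unfolded One_nat_def])

lemma F_irrefl: "F - both a a = F"
  using F(1) unfolding forest_def both_def by auto

lemma forest_edge: "a < n \<Longrightarrow> b < n \<Longrightarrow> forest_edge (St X) a b \<longleftrightarrow> (a, b) \<in> F"
proof -
  assume ab: "a < n" "b < n"
  have "(a, b) \<in> F" if "(a, b) \<in> F\<^sup>*" "(a, b) \<notin> (F - both a b)\<^sup>*"
  proof (rule ccontr)
    assume "(a, b) \<notin> F"
    then have "F - both a b = F" using symF unfolding both_def sym_def by blast
    with that show False by simp
  qed
  moreover have "(a, b) \<notin> (F - both a b)\<^sup>*" if "(a, b) \<in> F"
    using F(1) that unfolding forest_def by blast
  ultimately show ?thesis using ab by (auto simp: forest_edge_def conn_avoiding F_irrefl)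
qed

lemma kept_conn: "x < n \<Longrightarrow> y < n \<Longrightarrow> kept_conn n (St X) x y \<longleftrightarrow> (x, y) \<in> B\<^sup>*"
proof
  assume xy: "x < n" "y < n" and g: "kept_conn n (St X) x y"
  have "(x, y) \<in> (F - (F - E'))\<^sup>*"
  proof (rule forest_rtrancl_Diff[OF F(1)])
    show "finite (F - E')" using E F(2) by (meson finite_Diff finite_SigmaI finite_lessThan finite_subset)
    show "sym (F - E')" using symF E'(2) unfolding sym_def by blast
    have "conn_avoiding (St X) x y x x" using g xy unfolding kept_conn_def by blast
    then show "(x, y) \<in> F\<^sup>*" using xy by (simp add: conn_avoiding F_irrefl)
    fix a b assume ab: "(a, b) \<in> F - E'"
    then have "a < n" "b < n" using E F(2) by auto
    moreover have "conn_avoiding (St X) x y a b"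
      using g ab calculation unfolding kept_conn_def by (auto simp: forest_edge new_edge)
    ultimately show "(x, y) \<in> (F - both a b)\<^sup>*" using xy by (simp add: conn_avoiding)
  qed
  moreover have "F - (F - E') = B" by (auto simp: B_def)
  ultimately show "(x, y) \<in> B\<^sup>*" by simp
next
  assume xy: "x < n" "y < n" "(x, y) \<in> B\<^sup>*"
  show "kept_conn n (St X) x y" unfolding kept_conn_def
  proof (intro allI impI)
    fix a b assume ab: "a < n" "b < n" "a = b \<or> (forest_edge (St X) a b \<and> \<not> new_edge (St X) a b)"
    then have "B \<subseteq> F - both a b"
      using F_irrefl E'(2) unfolding B_def both_def by (auto simp: forest_edge new_edge dest: symD)
    then have "(x, y) \<in> (F - both a b)\<^sup>*" using xy(3) by (meson rtrancl_mono subsetD)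
    then show "conn_avoiding (St X) x y a b" using xy ab by (simp add: conn_avoiding)
  qed
qed

definition terminals :: "nat set" where
  "terminals = {v. \<exists>u. (u, v) \<in> F - E' \<or> ((u, v) \<in> E' \<and> (u, v) \<notin> F\<^sup>*)}"

lemma F_less: "(u, v) \<in> F \<Longrightarrow> u < n \<and> v < n"
  using E F(2) by blast

lemma E'_less: "(u, v) \<in> E' \<Longrightarrow> u < n \<and> v < n"
  using E'(1) by blast

lemma terminals_less: "terminals \<subseteq> {..<n}"
  unfolding terminals_def using F_less E'_less by blast

lemma terminal_less:
  assumes "terminal n (St X) v"
  shows "v < n"
proof -
  obtain u where "forest_edge (St X) u v \<or> (u, v) \<in> E'"
    using assms unfolding terminal_def new_edge by blast
  then show ?thesis
  proof
    assume "forest_edge (St X) u v"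
    then have "[u, v, u, u] \<in> A 1" unfolding forest_edge_def conn_avoiding_def combine_def by simp
    then show ?thesis unfolding aux by simp
  next
    assume "(u, v) \<in> E'"
    then show ?thesis using E'(1) by blast
  qed
qed

lemma terminal: "terminal n (St X) v \<longleftrightarrow> v \<in> terminals"
proof (cases "v < n")
  case True
  have "(u < n \<and> ((forest_edge (St X) u v \<and> \<not> new_edge (St X) u v) \<or> (new_edge (St X) u v \<and> \<not> conn_avoiding (St X) u v u u))) \<longleftrightarrow>
      ((u, v) \<in> F - E' \<or> ((u, v) \<in> E' \<and> (u, v) \<notin> F\<^sup>*))" for u
  proof (cases "u < n")
    case ul: True
    show ?thesis using ul True by (simp add: forest_edge new_edge conn_avoiding F_irrefl)
  next
    case False
    then show ?thesis using F_less[of u v] E'_less[of u v] by blast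
  qed
  then show ?thesis unfolding terminal_def terminals_def by blast
next
  case False
  then show ?thesis using terminal_less terminals_less by blast
qed

definition V :: "nat \<Rightarrow> nat \<Rightarrow> nat \<Rightarrow> nat \<Rightarrow> nat set" where
  "V e1 e2 e3 e4 = terminals \<union> {e1, e2, e3, e4}"

lemma graph_value: "graph_value n (St X) e1 e2 e3 e4 = (\<lambda>v. v \<in> V e1 e2 e3 e4)"
  by (auto simp: fun_eq_iff graph_value_def terminal V_def)

lemma V_less: "e1 < n \<Longrightarrow> e2 < n \<Longrightarrow> e3 < n \<Longrightarrow> e4 < n \<Longrightarrow> V e1 e2 e3 e4 \<subseteq> {..<n}"
  using terminals_less by (auto simp: V_def)

lemma V_codable:
  assumes "e1 < n" "e2 < n" "e3 < n" "e4 < n"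
  shows "codable n (V e1 e2 e3 e4) r"
proof (rule cod[OF V_less[OF assms]])
  \<comment> \<open>Deleted forest edges lie in \<open>E - E'\<close> by
    \<open>F \<subseteq> E\<close>; an edge of \<open>E'\<close> that joins different components of
    \<open>F\<close> is not in \<open>E\<close>, as \<open>E \<subseteq> F\<^sup>*\<close>.\<close>
  have "terminals \<subseteq> {v. \<exists>u. (u, v) \<in> (E - E') \<union> (E' - E)}"
    unfolding terminals_def using F(2,3) by blast
  then show "V e1 e2 e3 e4 \<subseteq> {v. \<exists>u. (u, v) \<in> (E - E') \<union> (E' - E)} \<union> {e1, e2, e3, e4}"
    unfolding V_def by blast
qed

text \<open>The first deleted edge on the way from \<open>x\<close> has a terminal as its near
  endpoint.\<close>

lemma exit_F: "(x, y) \<in> F\<^sup>* \<Longrightarrow> (x, y) \<in> B\<^sup>* \<or> (\<exists>s\<in>terminals. (x, s) \<in> B\<^sup>*)"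
proof (induction rule: converse_rtrancl_induct)
  case (step x z)
  show ?case
  proof (cases "(x, z) \<in> E'")
    case True
    then have "(x, z) \<in> B" using step(1) by (simp add: B_def)
    then show ?thesis using step.IH by (meson converse_rtrancl_into_rtrancl)
  next
    case False
    then have "(z, x) \<in> F - E'" using step(1) symF E'(2) by (meson Diff_iff symD)
    then have "x \<in> terminals" unfolding terminals_def by blast
    then show ?thesis by blast
  qed
qed simp

text \<open>This is the hypothesis of \<open>rtrancl_contract\<close>. If the old forest connects
  \<open>u\<close> and \<open>v\<close>, either the connection survived or both ends reach a
  terminal; otherwise \<open>u\<close> and \<open>v\<close> are terminals themselves.\<close>

lemma touch:
  assumes "(u, v) \<in> E'"
  shows "(u, v) \<in> B\<^sup>* \<or> (\<exists>s\<in>terminals. (u, s) \<in> B\<^sup>*) \<and> (\<exists>s\<in>terminals. (v, s) \<in> B\<^sup>*)"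
proof (cases "(u, v) \<in> F\<^sup>*")
  case True
  then have "(v, u) \<in> F\<^sup>*" by (rule rtrancl_sym[OF symF])
  then show ?thesis using exit_F[OF True] exit_F[of v u] rtrancl_sym[OF symB] by blast
next
  case False
  have "(v, u) \<notin> F\<^sup>*" using False rtrancl_sym[OF symF] by blast
  moreover have "(v, u) \<in> E'" using assms E'(2) by (meson symD)
  ultimately have "u \<in> terminals" "v \<in> terminals" using assms False unfolding terminals_def by blast+
  then show ?thesis by blast
qed

definition T1 :: "nat \<Rightarrow> nat \<Rightarrow> nat \<Rightarrow> nat \<Rightarrow> (nat \<times> nat) set" where
  "T1 e1 e2 e3 e4 = contract (V e1 e2 e3 e4) B {(u, v)\<in>E'. w u v < w e1 e2}"

definition N :: "(nat \<times> nat) set" where "N = greedy_edges w B E'"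

definition T2 :: "nat \<Rightarrow> nat \<Rightarrow> nat \<Rightarrow> nat \<Rightarrow> (nat \<times> nat) set" where
  "T2 e1 e2 e3 e4 = contract (V e1 e2 e3 e4) (B - both e1 e2) (N - both e1 e2)"

lemma T1_sub: "T1 e1 e2 e3 e4 \<subseteq> V e1 e2 e3 e4 \<times> V e1 e2 e3 e4"
  by (auto simp: T1_def contract_def)

lemma T2_sub: "T2 e1 e2 e3 e4 \<subseteq> V e1 e2 e3 e4 \<times> V e1 e2 e3 e4"
  by (auto simp: T2_def contract_def)

lemma w_commute: "w a b = w b a"
  by (simp add: w_def min.commute max.commute)

lemma lex_less:
  assumes "q < n" "s < n"
  shows "p * n + q < t * n + s \<longleftrightarrow> p < t \<or> (p = t \<and> q < s)"
proof -
  have less: "p * n + q < t * n + s" if "p < t" "q < n" for p t q s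
  proof -
    have "Suc p * n \<le> t * n" using that by (intro mult_le_mono1) simp
    then show ?thesis using \<open>q < n\<close> by simp
  qed
  consider "p < t" | "p = t" | "t < p" by linarith
  then show ?thesis
    by cases (use less[of p t q s] less[of t p s q] assms in auto)
qed

lemma edge_less:
  "u < n \<Longrightarrow> v < n \<Longrightarrow> a < n \<Longrightarrow> b < n \<Longrightarrow> edge_less u v a b \<longleftrightarrow> w u v < w a b"
  unfolding edge_less_def w_def by (subst lex_less) (auto simp: max_def)

lemma w_inj: "u < n \<Longrightarrow> v < n \<Longrightarrow> a < n \<Longrightarrow> b < n \<Longrightarrow> w u v = w a b \<Longrightarrow> both u v = both a b"
proof -
  assume *: "u < n" "v < n" "a < n" "b < n" "w u v = w a b"
  then have "\<not> edge_less u v a b" "\<not> edge_less a b u v" by (simp_all add: edge_less)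
  then have "min u v = min a b" "max u v = max a b" unfolding edge_less_def by linarith+
  then show ?thesis unfolding both_def by (auto simp: min_def max_def split: if_splits)
qed

lemma select_step:
  assumes "e1 < n" "e2 < n" "e3 < n" "e4 < n" "x \<in> V e1 e2 e3 e4" "y \<in> V e1 e2 e3 e4"
  shows "select_step n (St X) e1 e2 x y \<longleftrightarrow> (x, y) \<in> T1 e1 e2 e3 e4"
proof -
  have xy: "x < n" "y < n" using assms V_less[of e1 e2 e3 e4] by auto
  have "(u < n \<and> v < n \<and> kept_conn n (St X) x u \<and> new_edge (St X) u v \<and> edge_less u v e1 e2 \<and> kept_conn n (St X) v y) \<longleftrightarrow>
      (x, u) \<in> B\<^sup>* \<and> (u, v) \<in> {(u, v)\<in>E'. w u v < w e1 e2} \<and> (v, y) \<in> B\<^sup>*" for u v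
  proof (cases "u < n \<and> v < n")
    case True
    then show ?thesis using xy assms(1,2) by (simp add: kept_conn new_edge edge_less)
  next
    case False
    then show ?thesis using E'_less[of u v] by auto
  qed
  then have "(\<exists>u<n. \<exists>v<n. kept_conn n (St X) x u \<and> new_edge (St X) u v \<and> edge_less u v e1 e2 \<and> kept_conn n (St X) v y) \<longleftrightarrow>
      (\<exists>u v. (x, u) \<in> B\<^sup>* \<and> (u, v) \<in> {(u, v)\<in>E'. w u v < w e1 e2} \<and> (v, y) \<in> B\<^sup>*)"
    by blast
  then show ?thesis unfolding select_step_def T1_def contract_def using assms(5,6) kept_conn[OF xy, of X] by simp
qed

lemma kept_conn_avoiding:
  assumes "e1 < n" "e2 < n" "x < n" "y < n"
  shows "kept_conn_avoiding n (St X) e1 e2 x y \<longleftrightarrow> (x, y) \<in> (B - both e1 e2)\<^sup>*"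
proof -
  have "(x, y) \<in> (B - both e1 e2)\<^sup>*" if "(x, y) \<in> B\<^sup>*" "(x, y) \<in> (F - both e1 e2)\<^sup>*"
    using forest_rtrancl_Diff_step[OF F(1) _ symB that] by (simp add: B_def)
  moreover have "(B - both e1 e2)\<^sup>* \<subseteq> B\<^sup>*" "(B - both e1 e2)\<^sup>* \<subseteq> (F - both e1 e2)\<^sup>*"
    by (intro rtrancl_mono; auto simp: B_def)+
  ultimately show ?thesis unfolding kept_conn_avoiding_def using assms by (auto simp: kept_conn conn_avoiding)
qed

lemma forest_N: "forest (B \<union> N)" "E' \<subseteq> (B \<union> N)\<^sup>*" "N \<subseteq> E'" "B \<subseteq> E'"
proof -
  have inj: "both a b = both c d" if "(a, b) \<in> E'" "(c, d) \<in> E'" "w a b = w c d" for a b c d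
    using that E'_less by (intro w_inj) blast+
  show "forest (B \<union> N)" "E' \<subseteq> (B \<union> N)\<^sup>*"
    unfolding N_def by (rule greedy_forest[OF forestB E'(2) w_commute inj]; assumption)+
qed (auto simp: N_def greedy_edges_def B_def)

lemma rtrancl_T1:
  assumes "x \<in> V e1 e2 e3 e4" "y \<in> V e1 e2 e3 e4"
  shows "(x, y) \<in> (T1 e1 e2 e3 e4)\<^sup>* \<longleftrightarrow> (x, y) \<in> (B \<union> {(u, v)\<in>E'. w u v < w e1 e2})\<^sup>*"
  unfolding T1_def
proof (rule rtrancl_contract[OF symB assms])
  fix u v assume "(u, v) \<in> {(u, v)\<in>E'. w u v < w e1 e2}"
  then show "(u, v) \<in> B\<^sup>* \<or> (\<exists>s\<in>V e1 e2 e3 e4. (u, s) \<in> B\<^sup>*) \<and> (\<exists>s\<in>V e1 e2 e3 e4. (v, s) \<in> B\<^sup>*)"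
    using touch[of u v] unfolding V_def by blast
qed

text \<open>Removing \<open>e1 e2\<close> can split a component of \<open>B\<close> and cut a vertex
  off from its terminal. The vertex is then still connected with \<open>e1\<close> or
  \<open>e2\<close>, which therefore belong to \<open>V\<close>.\<close>

lemma rtrancl_T2:
  assumes "x \<in> V e1 e2 e3 e4" "y \<in> V e1 e2 e3 e4"
  shows "(x, y) \<in> (T2 e1 e2 e3 e4)\<^sup>* \<longleftrightarrow> (x, y) \<in> (B \<union> N - both e1 e2)\<^sup>*"
proof -
  let ?G = "B - both e1 e2"
  have G: "sym ?G" by (rule sym_Diff_both[OF symB])
  have B: "(u, s) \<in> ?G\<^sup>* \<or> (u, e1) \<in> ?G\<^sup>* \<or> (u, e2) \<in> ?G\<^sup>*" if "(u, s) \<in> B\<^sup>*" for u s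
  proof -
    have "B \<subseteq> ?G \<union> both e1 e2" by blast
    then have "(u, s) \<in> (?G \<union> both e1 e2)\<^sup>*" using that by (meson rtrancl_mono subsetD)
    from rtrancl_add_edge[OF G this] show ?thesis by blast
  qed
  have *: "\<exists>s\<in>V e1 e2 e3 e4. (u, s) \<in> ?G\<^sup>*" if "s \<in> terminals" "(u, s) \<in> B\<^sup>*" for u s
    using B[OF that(2)] that(1) unfolding V_def by blast
  have "(x, y) \<in> (T2 e1 e2 e3 e4)\<^sup>* \<longleftrightarrow> (x, y) \<in> (?G \<union> (N - both e1 e2))\<^sup>*"
    unfolding T2_def
  proof (rule rtrancl_contract[OF G assms])
    fix u v assume uv: "(u, v) \<in> N - both e1 e2"
    have "B\<^sup>* \<subseteq> (B \<union> {(u', v')\<in>E'. w u' v' < w u v})\<^sup>*" by (intro rtrancl_mono) blast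
    then have "(u, v) \<notin> B\<^sup>*" using uv unfolding N_def greedy_edges_def by blast
    then show "(u, v) \<in> ?G\<^sup>* \<or> (\<exists>s\<in>V e1 e2 e3 e4. (u, s) \<in> ?G\<^sup>*) \<and> (\<exists>s\<in>V e1 e2 e3 e4. (v, s) \<in> ?G\<^sup>*)"
      using touch[of u v] uv forest_N(3) * by blast
  qed
  moreover have "?G \<union> (N - both e1 e2) = B \<union> N - both e1 e2" by blast
  ultimately show ?thesis by simp
qed

end

section \<open>The two stages of the iteration reach their closures\<close>

context graph_update
begin

definition step :: "nat list set \<Rightarrow> nat list set" where
  "step X = {t. length t = 9 \<and> set t \<subseteq> {..<n} \<and>
     graph_round n (St X) (t ! 0) (t ! 1) (t ! 2) (t ! 3) (t ! 4) (t ! 5) (t ! 6) (t ! 7) (t ! 8)}"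

definition rel :: "nat list set \<Rightarrow> nat \<Rightarrow> nat \<Rightarrow> nat \<Rightarrow> nat \<Rightarrow> nat \<Rightarrow> ((nat \<times> nat) \<times> (nat \<times> nat)) set" where
  "rel X g e1 e2 e3 e4 = {((x1, x2), (y1, y2)). [g, e1, e2, e3, e4, x1, x2, y1, y2] \<in> X}"

definition iterates :: "nat \<Rightarrow> nat list set" where "iterates i = (step ^^ i) {}"

lemma iterates_Suc: "iterates (Suc i) = step (iterates i)" by (simp add: iterates_def)

lemma step_iff:
  assumes "g < n" "e1 < n" "e2 < n" "e3 < n" "e4 < n"
  shows "((x1, x2), (y1, y2)) \<in> rel (step X) g e1 e2 e3 e4 \<longleftrightarrow> graph_round n (St X) g e1 e2 e3 e4 x1 x2 y1 y2"
proof -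
  have "x1 < n \<and> x2 < n \<and> y1 < n \<and> y2 < n" if "graph_round n (St X) g e1 e2 e3 e4 x1 x2 y1 y2"
    using that V_less[OF assms(2-5)] unfolding graph_round_def graph_value by blast
  then show ?thesis using assms by (auto simp: rel_def step_def)
qed

lemma Iter_rel: "[g, e1, e2, e3, e4, x1, x2, y1, y2] \<in> St X Iter \<longleftrightarrow> ((x1, x2), (y1, y2)) \<in> rel X g e1 e2 e3 e4"
  by (simp add: rel_def combine_def)

lemma chain_rel: "chain n (graph_value n (St X) e1 e2 e3 e4)
    (\<lambda>s1 s2 t1 t2. [g, e1, e2, e3, e4, s1, s2, t1, t2] \<in> St X Iter) x1 x2 y1 y2 \<longleftrightarrow>
    chain n (\<lambda>s. s \<in> V e1 e2 e3 e4)
      (\<lambda>s1 s2 t1 t2. ((s1, s2), (t1, t2)) \<in> rel X g e1 e2 e3 e4) x1 x2 y1 y2"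
  by (simp only: graph_value Iter_rel)

lemma round1:
  assumes "e1 < n" "e2 < n" "e3 < n" "e4 < n"
  shows "rel (step X) 0 e1 e2 e3 e4 = closure_step n (V e1 e2 e3 e4) (diag (T1 e1 e2 e3 e4)) (rel X 0 e1 e2 e3 e4)"
proof (intro set_eqI)
  fix z :: "(nat \<times> nat) \<times> nat \<times> nat"
  obtain x1 x2 y1 y2 where z: "z = ((x1, x2), (y1, y2))" by (cases z) auto
  have n0: "0 < n" using n1 by simp
  show "z \<in> rel (step X) 0 e1 e2 e3 e4 \<longleftrightarrow>
      z \<in> closure_step n (V e1 e2 e3 e4) (diag (T1 e1 e2 e3 e4)) (rel X 0 e1 e2 e3 e4)"
    unfolding z step_iff[OF n0 assms] graph_round_def closure_step_def chain_rel
    using select_step[OF assms, of x1 y1 X] by (auto simp: graph_value diag_def)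
qed

lemma rel1_sound:
  assumes "e1 < n" "e2 < n" "e3 < n" "e4 < n"
  shows "rel (iterates i) 0 e1 e2 e3 e4 \<subseteq> node_closure (V e1 e2 e3 e4) (diag (T1 e1 e2 e3 e4))"
proof (induction i)
  case 0
  show ?case by (auto simp: iterates_def rel_def)
next
  case (Suc i)
  then show ?case unfolding iterates_Suc round1[OF assms] by (rule closure_step_sound[OF V_less[OF assms]])
qed

lemma rel1_complete:
  assumes "e1 < n" "e2 < n" "e3 < n" "e4 < n" "r < i"
  shows "rel (iterates i) 0 e1 e2 e3 e4 = node_closure (V e1 e2 e3 e4) (diag (T1 e1 e2 e3 e4))"
proof (rule rounds_eq_node_closure[OF V_less[OF assms(1-4)] V_codable[OF assms(1-4)] _ _ assms(5)])
  show "rel (iterates 0) 0 e1 e2 e3 e4 \<subseteq> node_closure (V e1 e2 e3 e4) (diag (T1 e1 e2 e3 e4))"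
    by (rule rel1_sound[OF assms(1-4)])
  show "rel (iterates (Suc i)) 0 e1 e2 e3 e4 =
      closure_step n (V e1 e2 e3 e4) (diag (T1 e1 e2 e3 e4)) (rel (iterates i) 0 e1 e2 e3 e4)" for i
    unfolding iterates_Suc by (rule round1[OF assms(1-4)])
qed

lemma selection_done_late:
  assumes "r < i"
  shows "selection_done n (St (iterates i))"
proof -
  have "selection_closed n (St (iterates i)) 0 e1 e2" if e: "e1 < n" "e2 < n" for e1 e2
  proof -
    let ?V = "V e1 e2 e1 e2" and ?T = "T1 e1 e2 e1 e2"
    note * = rel1_complete[OF e e assms]
    have mem: "((x, x), (y, y)) \<in> rel (iterates i) 0 e1 e2 e1 e2 \<longleftrightarrow> x \<in> ?V \<and> y \<in> ?V \<and> (x, y) \<in> ?T\<^sup>*" for x y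
      using node_closure_diag[OF T1_sub, of x e1 e2 e1 e2 y] unfolding * by (auto simp: node_closure_def restrict_nodes_def)
    have "(\<forall>x<n. \<forall>y<n. graph_value n (St (iterates i)) e1 e2 e1 e2 x \<and> graph_value n (St (iterates i)) e1 e2 e1 e2 y \<and>
          (x = y \<or> select_step n (St (iterates i)) e1 e2 x y) \<longrightarrow> [0, e1, e2, e1, e2, x, x, y, y] \<in> St (iterates i) Iter)"
      unfolding Iter_rel mem graph_value using select_step[OF e e] by blast
    moreover have "(\<forall>x<n. \<forall>y<n. \<forall>w<n. [0, e1, e2, e1, e2, x, x, y, y] \<in> St (iterates i) Iter \<and>
          [0, e1, e2, e1, e2, y, y, w, w] \<in> St (iterates i) Iter \<longrightarrow> [0, e1, e2, e1, e2, x, x, w, w] \<in> St (iterates i) Iter)"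
      unfolding Iter_rel mem by (meson rtrancl_trans)
    ultimately show ?thesis unfolding selection_closed_def by (rule conjI)
  qed
  then show ?thesis unfolding selection_done_def using n1 by auto
qed

text \<open>Soundness bounds the relation from above; the test makes it reflexive on
  \<open>V\<close>, transitive and a superset of \<open>T1\<close>. This holds in every round, so
  the test may succeed early without harm.\<close>

lemma selection_done_rel:
  assumes d: "selection_done n (St (iterates i))" and e: "e1 < n" "e2 < n"
    and xy: "x \<in> V e1 e2 e1 e2" "y \<in> V e1 e2 e1 e2"
  shows "((x, x), (y, y)) \<in> rel (iterates i) 0 e1 e2 e1 e2 \<longleftrightarrow> (x, y) \<in> (T1 e1 e2 e1 e2)\<^sup>*"
proof
  assume "((x, x), (y, y)) \<in> rel (iterates i) 0 e1 e2 e1 e2"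
  then have "((x, x), (y, y)) \<in> node_closure (V e1 e2 e1 e2) (diag (T1 e1 e2 e1 e2))"
    using rel1_sound[OF e e] by blast
  then show "(x, y) \<in> (T1 e1 e2 e1 e2)\<^sup>*" using node_closure_diag[OF T1_sub xy] by simp
next
  have Vn: "v < n" if "v \<in> V e1 e2 e1 e2" for v using that V_less[OF e e] by blast
  have cl: "selection_closed n (St (iterates i)) 0 e1 e2" using d e unfolding selection_done_def by auto
  have D1: "((x, x), (y, y)) \<in> rel (iterates i) 0 e1 e2 e1 e2"
    if "x \<in> V e1 e2 e1 e2" "y \<in> V e1 e2 e1 e2" "x = y \<or> (x, y) \<in> T1 e1 e2 e1 e2" for x y
    using cl that Vn[OF that(1)] Vn[OF that(2)] select_step[OF e e that(1,2), of "iterates i"]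
    unfolding selection_closed_def Iter_rel graph_value by blast
  have D2: "((x, x), (w, w)) \<in> rel (iterates i) 0 e1 e2 e1 e2"
    if "x < n" "y < n" "w < n" "((x, x), (y, y)) \<in> rel (iterates i) 0 e1 e2 e1 e2"
      "((y, y), (w, w)) \<in> rel (iterates i) 0 e1 e2 e1 e2" for x y w
    using cl that unfolding selection_closed_def Iter_rel by blast
  assume "(x, y) \<in> (T1 e1 e2 e1 e2)\<^sup>*"
  then have "y \<in> V e1 e2 e1 e2 \<and> ((x, x), (y, y)) \<in> rel (iterates i) 0 e1 e2 e1 e2"
  proof (induction rule: rtrancl_induct)
    case base
    then show ?case using D1 xy by blast
  next
    case (step y z)
    then have z: "z \<in> V e1 e2 e1 e2" using T1_sub by blast
    then have "((y, y), (z, z)) \<in> rel (iterates i) 0 e1 e2 e1 e2" using D1 step by blast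
    then show ?case using D2[of x y z] step.IH z Vn xy by blast
  qed
  then show "((x, x), (y, y)) \<in> rel (iterates i) 0 e1 e2 e1 e2" by blast
qed

lemma selected_edge:
  assumes "selection_done n (St (iterates i))" "u < n" "v < n"
  shows "selected_edge n (St (iterates i)) u v \<longleftrightarrow> (u, v) \<in> N"
proof -
  have uv: "u \<in> V u v u v" "v \<in> V u v u v" by (auto simp: V_def)
  have "[0, u, v, u, v, u, u, v, v] \<in> St (iterates i) Iter \<longleftrightarrow>
      (u, v) \<in> (B \<union> {(u', v')\<in>E'. w u' v' < w u v})\<^sup>*"
    unfolding Iter_rel selection_done_rel[OF assms uv] rtrancl_T1[OF uv] ..
  then show ?thesis using n1 unfolding selected_edge_def new_edge N_def greedy_edges_def by auto
qed

lemma avoid_step: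
  assumes d: "selection_done n (St (iterates i))"
    and e: "e1 < n" "e2 < n" "e3 < n" "e4 < n" and xy: "x \<in> V e1 e2 e3 e4" "y \<in> V e1 e2 e3 e4"
  shows "avoid_step n (St (iterates i)) e1 e2 x y \<longleftrightarrow> (x, y) \<in> T2 e1 e2 e3 e4"
proof -
  have xyn: "x < n" "y < n" using xy V_less[OF e] by auto
  have "(u < n \<and> v < n \<and> kept_conn_avoiding n (St (iterates i)) e1 e2 x u \<and> selected_edge n (St (iterates i)) u v \<and>
        \<not> ((u = e1 \<and> v = e2) \<or> (u = e2 \<and> v = e1)) \<and> kept_conn_avoiding n (St (iterates i)) e1 e2 v y) \<longleftrightarrow>
      (x, u) \<in> (B - both e1 e2)\<^sup>* \<and> (u, v) \<in> N - both e1 e2 \<and> (v, y) \<in> (B - both e1 e2)\<^sup>*" for u v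
  proof (cases "u < n \<and> v < n")
    case True
    then show ?thesis using xyn e by (auto simp: kept_conn_avoiding selected_edge[OF d] both_def)
  next
    case False
    then show ?thesis using E'_less[of u v] forest_N(3) by blast
  qed
  then have "(\<exists>u<n. \<exists>v<n. kept_conn_avoiding n (St (iterates i)) e1 e2 x u \<and> selected_edge n (St (iterates i)) u v \<and>
        \<not> ((u = e1 \<and> v = e2) \<or> (u = e2 \<and> v = e1)) \<and> kept_conn_avoiding n (St (iterates i)) e1 e2 v y) \<longleftrightarrow>
      (\<exists>u v. (x, u) \<in> (B - both e1 e2)\<^sup>* \<and> (u, v) \<in> N - both e1 e2 \<and> (v, y) \<in> (B - both e1 e2)\<^sup>*)"
    by blast
  then show ?thesis unfolding avoid_step_def T2_def contract_def using xy kept_conn_avoiding[OF e(1,2) xyn] by simp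
qed

lemma round2:
  assumes "selection_done n (St (iterates i))" "e1 < n" "e2 < n" "e3 < n" "e4 < n"
  shows "rel (iterates (Suc i)) 1 e1 e2 e3 e4 =
    closure_step n (V e1 e2 e3 e4) (diag (T2 e1 e2 e3 e4)) (rel (iterates i) 1 e1 e2 e3 e4)"
proof (intro set_eqI)
  fix z :: "(nat \<times> nat) \<times> nat \<times> nat"
  obtain x1 x2 y1 y2 where z: "z = ((x1, x2), (y1, y2))" by (cases z) auto
  show "z \<in> rel (iterates (Suc i)) 1 e1 e2 e3 e4 \<longleftrightarrow>
      z \<in> closure_step n (V e1 e2 e3 e4) (diag (T2 e1 e2 e3 e4)) (rel (iterates i) 1 e1 e2 e3 e4)"
    unfolding z iterates_Suc step_iff[OF n1 assms(2-5)] graph_round_def closure_step_def chain_rel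
    using avoid_step[OF assms, of x1 y1] assms(1) by (auto simp: graph_value diag_def)
qed

text \<open>A round in which the test fails leaves stage 2 empty; in any other round
  \<open>selected_edge\<close> has its final meaning.\<close>

lemma rel2_sound:
  assumes e: "e1 < n" "e2 < n" "e3 < n" "e4 < n"
  shows "rel (iterates i) 1 e1 e2 e3 e4 \<subseteq> node_closure (V e1 e2 e3 e4) (diag (T2 e1 e2 e3 e4))"
proof (induction i)
  case 0
  show ?case by (auto simp: iterates_def rel_def)
next
  case (Suc i)
  show ?case
  proof (cases "selection_done n (St (iterates i))")
    case True
    show ?thesis unfolding round2[OF True e] by (rule closure_step_sound[OF V_less[OF e] Suc])
  next
    case False
    have "z \<notin> rel (iterates (Suc i)) 1 e1 e2 e3 e4" for z
    proof -
      obtain x1 x2 y1 y2 where z: "z = ((x1, x2), (y1, y2))" by (cases z) auto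
      show ?thesis unfolding z iterates_Suc step_iff[OF n1 e] graph_round_def using False by simp
    qed
    then show ?thesis by blast
  qed
qed

text \<open>Stage 1 is complete after \<open>r + 1\<close> rounds, and stage 2 then needs
  \<open>r + 1\<close> more.\<close>

lemma rel2_complete:
  assumes e: "e1 < n" "e2 < n" "e3 < n" "e4 < n" and i: "2 * r + 1 < i"
  shows "rel (iterates i) 1 e1 e2 e3 e4 = node_closure (V e1 e2 e3 e4) (diag (T2 e1 e2 e3 e4))"
proof -
  have "r < i - Suc r" using i by simp
  then have "rel (iterates (Suc r + (i - Suc r))) 1 e1 e2 e3 e4 = node_closure (V e1 e2 e3 e4) (diag (T2 e1 e2 e3 e4))"
  proof (rule rounds_eq_node_closure[OF V_less[OF e] V_codable[OF e],
        where R = "\<lambda>j. rel (iterates (Suc r + j)) 1 e1 e2 e3 e4", rotated -1])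
    show "rel (iterates (Suc r + 0)) 1 e1 e2 e3 e4 \<subseteq> node_closure (V e1 e2 e3 e4) (diag (T2 e1 e2 e3 e4))"
      by (rule rel2_sound[OF e])
    fix j
    have "selection_done n (St (iterates (Suc r + j)))" by (rule selection_done_late) simp
    from round2[OF this e]
    show "rel (iterates (Suc r + Suc j)) 1 e1 e2 e3 e4 =
      closure_step n (V e1 e2 e3 e4) (diag (T2 e1 e2 e3 e4)) (rel (iterates (Suc r + j)) 1 e1 e2 e3 e4)"
      by simp
  qed
  then show ?thesis using i by simp
qed

lemma result:
  assumes "a < n" "b < n" "x < n" "y < n" "2 * r + 1 < i"
  shows "[1, a, b, x, y, x, x, y, y] \<in> iterates i \<longleftrightarrow> (x, y) \<in> (B \<union> N - both a b)\<^sup>*"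
proof -
  have xy: "x \<in> V a b x y" "y \<in> V a b x y" by (auto simp: V_def)
  have "[1, a, b, x, y, x, x, y, y] \<in> iterates i \<longleftrightarrow> ((x, x), (y, y)) \<in> rel (iterates i) 1 a b x y"
    by (simp add: rel_def)
  also have "\<dots> \<longleftrightarrow> (x, y) \<in> (T2 a b x y)\<^sup>*"
    unfolding rel2_complete[OF assms] by (rule node_closure_diag[OF T2_sub xy])
  also have "\<dots> \<longleftrightarrow> (x, y) \<in> (B \<union> N - both a b)\<^sup>*" by (rule rtrancl_T2[OF xy])
  finally show ?thesis .
qed

end

lemma (in graph_update) new_forest:
  assumes "2 * r + 1 < i"
  obtains F' where "forest F'" "F' \<subseteq> E'" "E' \<subseteq> F'\<^sup>*"
    "\<And>a b x y. a < n \<Longrightarrow> b < n \<Longrightarrow> x < n \<Longrightarrow> y < n \<Longrightarrow>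
      [1, a, b, x, y, x, x, y, y] \<in> (step ^^ i) {} \<longleftrightarrow> (x, y) \<in> (F' - both a b)\<^sup>*"
proof (rule that[of "B \<union> N"])
  show "forest (B \<union> N)" "B \<union> N \<subseteq> E'" "E' \<subseteq> (B \<union> N)\<^sup>*" using forest_N by auto
  show "[1, a, b, x, y, x, x, y, y] \<in> (step ^^ i) {} \<longleftrightarrow> (x, y) \<in> (B \<union> N - both a b)\<^sup>*"
    if "a < n" "b < n" "x < n" "y < n" for a b x y
    using result[OF that assms] unfolding iterates_def .
qed

text \<open>For the finitely many small \<open>n\<close> that the asymptotic estimates do not cover, the answer is
  computed directly.\<close>

primrec bounded_reach :: "nat \<Rightarrow> nat \<Rightarrow> graph_sym sym struct \<Rightarrow> nat \<Rightarrow> nat \<Rightarrow> bool" where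
  "bounded_reach 0 n S x y \<longleftrightarrow> x = y"
| "bounded_reach (Suc j) n S x y \<longleftrightarrow> (\<exists>z<n. bounded_reach j n S x z \<and> (z = y \<or> new_edge S z y))"

lemma definable_bounded_reach: "x < k \<Longrightarrow> y < k \<Longrightarrow> definable graph_arity k (\<lambda>n S a. bounded_reach j n S (a x) (a y))"
proof (induction j arbitrary: k x y)
  case 0
  then show ?case unfolding bounded_reach.simps by (rule definable_eq)
next
  case (Suc j)
  show ?case
    using Suc.prems unfolding bounded_reach.simps apply -
    apply (rule definable_intros definable_new_edge Suc.IH | (simp; fail))+
    done
qed

text \<open>The number of edges bounds the length of the paths needed, and a constant bound
  \<open>m\<close> on the domain size makes the nesting depth \<open>m * m\<close> independent of
  \<open>n\<close>.\<close>

lemma bounded_reach_iff: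
  assumes sub: "{(u, v). new_edge S u v} \<subseteq> {..<n} \<times> {..<n}" and "x < n" "y < n" "n \<le> m"
  shows "bounded_reach (m * m) n S x y \<longleftrightarrow> (x, y) \<in> {(u, v). new_edge S u v}\<^sup>*"
proof
  let ?E = "{(u, v). new_edge S u v}"
  show "bounded_reach j n S x y \<Longrightarrow> (x, y) \<in> ?E\<^sup>*" for j
  proof (induction j arbitrary: y)
    case (Suc j)
    then obtain z where z: "bounded_reach j n S x z" "z = y \<or> (z, y) \<in> ?E" by auto
    then show ?case using Suc.IH[of z] by (auto intro: rtrancl_into_rtrancl)
  qed simp
  have rev: "bounded_reach j n S x y" if "(x, y) \<in> (Id \<union> ?E) ^^ j" "y < n" for j y
    using that
  proof (induction j arbitrary: y)
    case (Suc j)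
    from Suc.prems(1) obtain z where z: "(x, z) \<in> (Id \<union> ?E) ^^ j" "(z, y) \<in> Id \<union> ?E" by auto
    then have "z < n" using Suc.prems(2) sub by auto
    then show ?case using Suc.IH[OF z(1)] z(2) by auto
  qed simp
  have fin: "finite ?E" using sub by (meson finite_SigmaI finite_lessThan finite_subset)
  assume "(x, y) \<in> ?E\<^sup>*"
  then obtain j where j: "(x, y) \<in> ?E ^^ j" "j \<le> card ?E"
    unfolding rtrancl_finite_eq_relpow[OF fin] by blast
  have "card ?E \<le> card ({..<n} \<times> {..<n})" using sub by (intro card_mono) auto
  also have "\<dots> \<le> m * m" using assms(4) by (simp add: card_cartesian_product mult_le_mono)
  finally have "(x, y) \<in> (Id \<union> ?E) ^^ (m * m)"
    using j by (intro relpow_refl_mono[OF j(1)]) auto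
  then show "bounded_reach (m * m) n S x y" using rev assms(3) by blast
qed

lemma length_2_iff: "length t = 2 \<longleftrightarrow> (\<exists>x y. t = [x, y])"
  by (auto simp: numeral_eq_Suc length_Suc_conv)

lemma length_4_iff: "length t = 4 \<longleftrightarrow> (\<exists>x y a b. t = [x, y, a, b])"
  by (auto simp: numeral_eq_Suc length_Suc_conv)

section \<open>Invariant and dynamic program for reachability\<close>

definition edges :: "graph_sym struct \<Rightarrow> (nat \<times> nat) set" where
  "edges I = {(u, v). [u, v] \<in> I Edge}"

text \<open>The domain size is fixed during a run, so on small domains the invariant can do without
  a forest.\<close>

definition graph_inv :: "nat \<Rightarrow> nat \<Rightarrow> graph_sym struct \<Rightarrow> (nat \<Rightarrow> nat list set) \<Rightarrow> bool" where
  "graph_inv n0 n I A \<longleftrightarrow> edges I \<subseteq> {..<n} \<times> {..<n} \<and> sym (edges I) \<and> A 0 = reachability_query n I \<and>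
     (n0 < n \<longrightarrow> (\<exists>F. forest F \<and> F \<subseteq> edges I \<and> edges I \<subseteq> F\<^sup>* \<and>
       A 1 = {[x, y, a, b] | x y a b. x < n \<and> y < n \<and> a < n \<and> b < n \<and> (x, y) \<in> (F - both a b)\<^sup>*}))"

lemma reachability_query_edges:
  "reachability_query n I = {[u, v] | u v. u < n \<and> v < n \<and> (u, v) \<in> (edges I)\<^sup>*}"
  by (simp add: reachability_query_def edges_def)

lemma edges_change:
  assumes "graph_changes s n c I I'" "edges I \<subseteq> {..<n} \<times> {..<n}" "sym (edges I)"
  shows "edges I' \<subseteq> {..<n} \<times> {..<n}" "sym (edges I')"
    and "\<exists>D. finite D \<and> real (card D) \<le> s n \<and>
      {v. \<exists>u. (u, v) \<in> (edges I - edges I') \<union> (edges I' - edges I)} \<subseteq> fst ` D \<union> snd ` D"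
proof -
  obtain D where D: "D \<subseteq> {..<n} \<times> {..<n}" "real (card D) \<le> s n"
    "I' Edge = (case c of InsertEdges \<Rightarrow> I Edge \<union> both_orientations D
                           | DeleteEdges \<Rightarrow> I Edge - both_orientations D)"
    using assms(1) unfolding graph_changes_def by blast
  have e: "edges I' = (case c of InsertEdges \<Rightarrow> edges I \<union> (D \<union> D\<inverse>) | DeleteEdges \<Rightarrow> edges I - (D \<union> D\<inverse>))"
    using D(3) by (cases c) (auto simp: edges_def both_orientations_def)
  show "edges I' \<subseteq> {..<n} \<times> {..<n}" using e D(1) assms(2) by (cases c) auto
  show "sym (edges I')" using e assms(3) by (cases c) (auto simp: sym_def)
  have "finite D" using D(1) by (meson finite_SigmaI finite_lessThan finite_subset)
  have "(edges I - edges I') \<union> (edges I' - edges I) \<subseteq> D \<union> D\<inverse>"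
    using e by (cases c) auto
  moreover have "v \<in> fst ` D \<union> snd ` D" if "(u, v) \<in> D \<union> D\<inverse>" for u v
    using that by (auto intro: rev_image_eqI)
  ultimately have "{v. \<exists>u. (u, v) \<in> (edges I - edges I') \<union> (edges I' - edges I)} \<subseteq> fst ` D \<union> snd ` D"
    by blast
  with \<open>finite D\<close> show "\<exists>D. finite D \<and> real (card D) \<le> s n \<and>
      {v. \<exists>u. (u, v) \<in> (edges I - edges I') \<union> (edges I' - edges I)} \<subseteq> fst ` D \<union> snd ` D"
    using D(2) by blast
qed

text \<open>The hypotheses on \<open>X\<close> and \<open>A'\<close> are the semantics of the update
  formulas, which keeps syntax out of the argument.\<close>

lemma graph_inv_step:
  assumes inv: "graph_inv n0 n I A" and ch: "graph_changes s n c I I'" and n0: "1 \<le> n0"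
    and cod: "\<And>W. n0 < n \<Longrightarrow> W \<subseteq> {..<n} \<Longrightarrow> real (card W) \<le> 4 * (1 + s n) \<Longrightarrow> codable n W r"
    and X: "X = ((\<lambda>X. {t. length t = 9 \<and> set t \<subseteq> {..<n} \<and>
      graph_round n (combine I' A X) (t ! 0) (t ! 1) (t ! 2) (t ! 3) (t ! 4) (t ! 5) (t ! 6) (t ! 7) (t ! 8)}) ^^ i) {}"
    and i: "n0 < n \<Longrightarrow> 2 * r + 1 < i"
    and A0: "A' 0 = {t. length t = 2 \<and> set t \<subseteq> {..<n} \<and>
      ((n0 < n \<and> (\<exists>d<n. d = 1 \<and> [d, t ! 0, t ! 0, t ! 0, t ! 1, t ! 0, t ! 0, t ! 1, t ! 1] \<in> X)) \<or>
       (\<not> n0 < n \<and> bounded_reach (n0 * n0) n (combine I' A X) (t ! 0) (t ! 1)))}"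
    and A1: "A' 1 = {t. length t = 4 \<and> set t \<subseteq> {..<n} \<and>
      (\<exists>d<n. d = 1 \<and> [d, t ! 2, t ! 3, t ! 0, t ! 1, t ! 0, t ! 0, t ! 1, t ! 1] \<in> X)}"
  shows "graph_inv n0 n I' A'"
proof -
  have E: "edges I \<subseteq> {..<n} \<times> {..<n}" "sym (edges I)" using inv by (auto simp: graph_inv_def)
  note E' = edges_change[OF ch E]
  show ?thesis
  proof (cases "n0 < n")
    case False
    have e: "{(u, v). new_edge (combine I' A X) u v} = edges I'"
      by (simp add: new_edge_def combine_def edges_def)
    have "A' 0 = reachability_query n I'"
      unfolding A0 reachability_query_edges
      using False bounded_reach_iff[of "combine I' A X" n _ _ n0, unfolded e, OF E'(1)]
      by (auto simp: length_2_iff)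
    then show ?thesis using E' False by (simp add: graph_inv_def)
  next
    case True
    obtain F where F: "forest F" "F \<subseteq> edges I" "edges I \<subseteq> F\<^sup>*"
      "A 1 = {[x, y, a, b] | x y a b. x < n \<and> y < n \<and> a < n \<and> b < n \<and> (x, y) \<in> (F - both a b)\<^sup>*}"
      using inv True unfolding graph_inv_def by blast
    obtain D where D: "finite D" "real (card D) \<le> s n"
      "{v. \<exists>u. (u, v) \<in> (edges I - edges I') \<union> (edges I' - edges I)} \<subseteq> fst ` D \<union> snd ` D"
      using E'(3) by blast
    interpret graph_update n r I' A F "edges I" "edges I'"
    proof
      show "codable n W r" if "W \<subseteq> {..<n}"
        "W \<subseteq> {v. \<exists>u. (u, v) \<in> (edges I - edges I') \<union> (edges I' - edges I)} \<union> {e1, e2, e3, e4}"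
        for W e1 e2 e3 e4
      proof (rule cod[OF True that(1)])
        have "card W \<le> card ((fst ` D \<union> snd ` D) \<union> {e1, e2, e3, e4})"
          using that(2) D(1,3) by (intro card_mono) auto
        also have "\<dots> \<le> card (fst ` D \<union> snd ` D) + card {e1, e2, e3, e4}" by (rule card_Un_le)
        also have "\<dots> \<le> (card (fst ` D) + card (snd ` D)) + 4"
          by (intro add_mono card_Un_le) (simp add: card_insert_if)
        also have "\<dots> \<le> (card D + card D) + 4"
          by (intro add_mono card_image_le D(1)) simp
        finally have "real (card W) \<le> 2 * real (card D) + 4" by linarith
        moreover have "0 \<le> real (card D)" by simp
        \<comment> \<open>Two endpoints per changed edge and four parameters.\<close>
        ultimately show "real (card W) \<le> 4 * (1 + s n)" using D(2) unfolding distrib_left by linarith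
      qed
    qed (use E E' F True n0 in \<open>auto simp: edges_def\<close>)
    have X_eq: "X = (step ^^ i) {}"
      unfolding X by (rule arg_cong[where f = "\<lambda>f. (f ^^ i) {}"]) (simp add: fun_eq_iff step_def)
    obtain F' where F': "forest F'" "F' \<subseteq> edges I'" "edges I' \<subseteq> F'\<^sup>*"
      "\<And>a b x y. a < n \<Longrightarrow> b < n \<Longrightarrow> x < n \<Longrightarrow> y < n \<Longrightarrow>
        [1, a, b, x, y, x, x, y, y] \<in> X \<longleftrightarrow> (x, y) \<in> (F' - both a b)\<^sup>*"
      by (rule new_forest[OF i[OF True]]) (simp add: X_eq)
    have "1 < n" using True n0 by simp
    then have "A' 1 = {[x, y, a, b] | x y a b. x < n \<and> y < n \<and> a < n \<and> b < n \<and> (x, y) \<in> (F' - both a b)\<^sup>*}"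
      unfolding A1 using F'(4) by (auto simp: length_4_iff)
    moreover have "A' 0 = reachability_query n I'"
    proof -
      have irr: "F' - both x x = F'" for x using F'(1) unfolding forest_def both_def by auto
      have "(edges I')\<^sup>* = F'\<^sup>*"
        using F'(2,3) by (meson rtrancl_mono rtrancl_subset_rtrancl subset_antisym)
      then show ?thesis
        unfolding A0 reachability_query_edges using True \<open>1 < n\<close> F'(4) by (auto simp: length_2_iff irr)
    qed
    ultimately show ?thesis using E' F' unfolding graph_inv_def by blast
  qed
qed

theorem undirected_reachability_in_DynFOLL: "in_DynFOLL (undirected_reachability (batch_size e))"
proof -
  obtain c n1 where cn: "\<And>n. n \<ge> n1 \<Longrightarrow> 1 \<le> c * loglog n"
     "\<And>n V. n \<ge> n1 \<Longrightarrow> V \<subseteq> {..<n} \<Longrightarrow> real (card V) \<le> real 4 * (1 + batch_size e n) \<Longrightarrow>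
        codable n V (c * loglog n - 1)"
    using codable_eventually[of 4 e] by blast
  \<comment> \<open>The successor ensures \<open>1 < n\<close> whenever \<open>n0 < n\<close>, so
    that both tags are domain elements.\<close>
  define n0 where "n0 = Suc n1"
  obtain \<phi> where \<phi>: "wf_fo graph_arity {..<9} \<phi>"
    "\<And>n S. defined_rel n S 9 \<phi> = {t. length t = 9 \<and> set t \<subseteq> {..<n} \<and>
      graph_round n S (t ! 0) (t ! 1) (t ! 2) (t ! 3) (t ! 4) (t ! 5) (t ! 6) (t ! 7) (t ! 8)}"
    by (rule definable_defined_rel[OF definable_graph_round]) simp
  have fo0: "definable graph_arity 2 (\<lambda>n S a.
      (n0 < n \<and> (\<exists>d<n. d = 1 \<and> [d, a 0, a 0, a 0, a 1, a 0, a 0, a 1, a 1] \<in> S Iter)) \<or>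
      (\<not> n0 < n \<and> bounded_reach (n0 * n0) n S (a 0) (a 1)))"
    apply (rule definable_size_gt definable_intros definable_eq_const definable_Iter definable_bounded_reach | (simp; fail))+
    done
  obtain \<psi>0 where \<psi>0: "wf_fo graph_arity {..<2} \<psi>0"
    "\<And>n S. defined_rel n S 2 \<psi>0 = {t. length t = 2 \<and> set t \<subseteq> {..<n} \<and>
      ((n0 < n \<and> (\<exists>d<n. d = 1 \<and> [d, t ! 0, t ! 0, t ! 0, t ! 1, t ! 0, t ! 0, t ! 1, t ! 1] \<in> S Iter)) \<or>
       (\<not> n0 < n \<and> bounded_reach (n0 * n0) n S (t ! 0) (t ! 1)))}"
    by (rule definable_defined_rel[OF fo0]) simp
  have fo1: "definable graph_arity 4 (\<lambda>n S a.
      \<exists>d<n. d = 1 \<and> [d, a 2, a 3, a 0, a 1, a 0, a 0, a 1, a 1] \<in> S Iter)"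
    apply (rule definable_intros definable_eq_const definable_Iter | (simp; fail))+
    done
  obtain \<psi>1 where \<psi>1: "wf_fo graph_arity {..<4} \<psi>1"
    "\<And>n S. defined_rel n S 4 \<psi>1 = {t. length t = 4 \<and> set t \<subseteq> {..<n} \<and>
      (\<exists>d<n. d = 1 \<and> [d, t ! 2, t ! 3, t ! 0, t ! 1, t ! 0, t ! 0, t ! 1, t ! 1] \<in> S Iter)}"
    by (rule definable_defined_rel[OF fo1]) simp
  \<comment> \<open>The initial forest is empty, so both auxiliary relations start as equality of
    the first two components. The factor \<open>2 * c\<close> pays for the two stages.\<close>
  define P :: "(graph_sym, graph_change) dyn_prog" where
    "P = \<lparr>aux_arities = [2, 4], init_formula = (\<lambda>_. Eq 0 1),
      update = (\<lambda>_ i. \<lparr>iter_arity = 9, iter_formula = \<phi>, iter_factor = 2 * c,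
        result_formula = (if i = 0 then \<psi>0 else \<psi>1)\<rparr>), answer = 0\<rparr>"
  have less2: "i < Suc (Suc 0) \<longleftrightarrow> i = 0 \<or> i = Suc 0" for i by auto
  have "wf_prog (\<lambda>_. 2) P"
    unfolding wf_prog_def P_def using \<phi>(1) \<psi>0(1) \<psi>1(1) by (auto simp: less2)
  moreover have "maintains P (undirected_reachability (batch_size e))"
  proof -
    have "graph_inv n0 n I A" if "reaches (undirected_reachability (batch_size e)) P n I A" for n I A
      using that
    proof induction
      case start
      have "edges empty_input = {}" by (simp add: edges_def empty_input_def)
      moreover have "init_aux n P 0 = {[u, v] | u v. u < n \<and> v < n \<and> u = v}"
        by (auto simp: init_aux_def P_def defined_rel_def length_2_iff)
      moreover have "init_aux n P 1 = {[x, y, a, b] | x y a b. x < n \<and> y < n \<and> a < n \<and> b < n \<and> x = y}"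
        by (auto simp: init_aux_def P_def defined_rel_def length_4_iff)
      ultimately show ?case
        unfolding graph_inv_def reachability_query_edges by (auto simp: forest_def sym_def)
    next
      case (change I A c' I')
      define X where "X = ((\<lambda>X. defined_rel n (combine I' A X) 9 \<phi>) ^^ (2 * c * loglog n)) {}"
      have it: "combine I' A X Iter = X" by (simp add: combine_def)
      show ?case
      proof (rule graph_inv_step[OF change.IH, where r = "c * loglog n - 1"])
        show "graph_changes (batch_size e) n c' I I'"
          using change.hyps(2) by (simp add: undirected_reachability_def)
        show "1 \<le> n0" by (simp add: n0_def)
        show "codable n W (c * loglog n - 1)"
          if "n0 < n" "W \<subseteq> {..<n}" "real (card W) \<le> 4 * (1 + batch_size e n)" for W
          using cn(2)[of n W] that by (simp add: n0_def)
        show "2 * (c * loglog n - 1) + 1 < 2 * c * loglog n" if "n0 < n"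
        proof -
          have "1 \<le> c * loglog n" by (rule cn(1)) (use that in \<open>simp add: n0_def\<close>)
          moreover have "2 * c * loglog n = 2 * (c * loglog n)" by simp
          ultimately show ?thesis by linarith
        qed
        have "update_aux n P c' I' A 0 = defined_rel n (combine I' A X) 2 \<psi>0"
          by (simp add: update_aux_def run_update_def Let_def P_def X_def)
        then        show "update_aux n P c' I' A 0 = {t. length t = 2 \<and> set t \<subseteq> {..<n} \<and>
            ((n0 < n \<and> (\<exists>d<n. d = 1 \<and> [d, t ! 0, t ! 0, t ! 0, t ! 1, t ! 0, t ! 0, t ! 1, t ! 1] \<in> X)) \<or>
             (\<not> n0 < n \<and> bounded_reach (n0 * n0) n (combine I' A X) (t ! 0) (t ! 1)))}"
          by (simp only: \<psi>0(2) it)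
        have "update_aux n P c' I' A 1 = defined_rel n (combine I' A X) 4 \<psi>1"
          by (simp add: update_aux_def run_update_def Let_def P_def X_def)
        then        show "update_aux n P c' I' A 1 = {t. length t = 4 \<and> set t \<subseteq> {..<n} \<and>
            (\<exists>d<n. d = 1 \<and> [d, t ! 2, t ! 3, t ! 0, t ! 1, t ! 0, t ! 0, t ! 1, t ! 1] \<in> X)}"
          by (simp only: \<psi>1(2) it)
      qed (simp only: X_def \<phi>(2))
    qed
    then show ?thesis
      unfolding maintains_def by (auto simp: undirected_reachability_def graph_inv_def P_def)
  qed
  ultimately show ?thesis
    unfolding in_DynFOLL_def by (intro exI[of _ P]) (simp add: undirected_reachability_def)
qed

section \<open>Maintaining runs of an automaton\<close>

abbreviation "word_arity \<equiv> sym_arity (\<lambda>_. 1) [0, 4] 6"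

lemma word_arity:
  "word_arity (Inp a) = Some 1" "word_arity (Aux 1) = Some 4" "word_arity Iter = Some 6"
  by (simp_all add: sym_arity_def)

lemma definable_letter: "i < k \<Longrightarrow> definable word_arity k (\<lambda>n S a. [a i] \<in> S (Inp c))"
  by (rule definable_rel1) (simp_all add: word_arity[unfolded One_nat_def])

lemmas definable_word_Iter = definable_rel6[where ar = word_arity and r = Iter, OF word_arity(3)]

locale automaton =
  fixes Q :: "nat set" and \<delta> :: "nat \<Rightarrow> 'a::finite \<Rightarrow> nat" and q0 :: nat and F :: "nat set"
  assumes Q: "finite Q" "q0 \<in> Q" "F \<subseteq> Q" and \<delta>: "\<And>q a. q \<in> Q \<Longrightarrow> \<delta> q a \<in> Q"
begin

text \<open>\<open>Aux 1\<close> contains \<open>[i, q, j, q']\<close> if the automaton gets from \<open>q\<close> to \<open>q'\<close> on the positions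
  \<open>i, \<dots>, j - 1\<close>. Since \<open>n\<close> is not a domain element, the last letter is never covered and
  is treated separately in the acceptance condition. The old word is not stored: a position counts as
  changed if the action of its letter on the states has changed.\<close>

definition letter_step :: "'a sym struct \<Rightarrow> nat \<Rightarrow> nat \<Rightarrow> nat \<Rightarrow> bool" where
  "letter_step S i q q' \<longleftrightarrow> (\<exists>c\<in>Q. \<exists>c'\<in>Q. q = c \<and> q' = c' \<and>
     ((\<exists>a\<in>UNIV. \<delta> c a = c' \<and> [i] \<in> S (Inp a)) \<or> (c = c' \<and> \<not> (\<exists>a\<in>UNIV. [i] \<in> S (Inp a)))))"

definition old_run :: "'a sym struct \<Rightarrow> nat \<Rightarrow> nat \<Rightarrow> nat \<Rightarrow> nat \<Rightarrow> bool" where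
  "old_run S i q j q' \<longleftrightarrow> [i, q, j, q'] \<in> S (Aux 1)"

definition changed :: "nat \<Rightarrow> 'a sym struct \<Rightarrow> nat \<Rightarrow> bool" where
  "changed n S i \<longleftrightarrow> (\<exists>j<n. Suc i = j \<and> (\<exists>q<n. \<exists>q'<n.
     (old_run S i q j q' \<and> \<not> letter_step S i q q') \<or> (\<not> old_run S i q j q' \<and> letter_step S i q q')))"

text \<open>Positions and states form one set, as both components of a node are hashed by the same
  modulus. States that also serve as positions merely add breakpoints.\<close>

definition word_value :: "nat \<Rightarrow> 'a sym struct \<Rightarrow> nat \<Rightarrow> nat \<Rightarrow> nat \<Rightarrow> bool" where
  "word_value n S e1 e2 v \<longleftrightarrow> changed n S v \<or> (\<exists>u<n. Suc u = v \<and> changed n S u) \<or> (\<exists>c\<in>Q. v = c) \<or> v = e1 \<or> v = e2"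

definition segment_step :: "nat \<Rightarrow> 'a sym struct \<Rightarrow> nat \<Rightarrow> nat \<Rightarrow> nat \<Rightarrow> nat \<Rightarrow> bool" where
  "segment_step n S i q j q' \<longleftrightarrow> (i \<le> j \<and> (\<forall>k<n. i \<le> k \<and> k < j \<longrightarrow> \<not> changed n S k) \<and> old_run S i q j q') \<or>
     (Suc i = j \<and> letter_step S i q q')"

definition word_round :: "nat \<Rightarrow> 'a sym struct \<Rightarrow> nat \<Rightarrow> nat \<Rightarrow> nat \<Rightarrow> nat \<Rightarrow> nat \<Rightarrow> nat \<Rightarrow> bool" where
  "word_round n S e1 e2 x1 x2 y1 y2 \<longleftrightarrow>
     word_value n S e1 e2 x1 \<and> word_value n S e1 e2 x2 \<and> word_value n S e1 e2 y1 \<and> word_value n S e1 e2 y2 \<and>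
     ((x1 = y1 \<and> x2 = y2) \<or> segment_step n S x1 x2 y1 y2 \<or>
      chain n (word_value n S e1 e2) (\<lambda>s1 s2 t1 t2. [e1, e2, s1, s2, t1, t2] \<in> S Iter) x1 x2 y1 y2)"

definition new_run :: "'a sym struct \<Rightarrow> nat \<Rightarrow> nat \<Rightarrow> nat \<Rightarrow> nat \<Rightarrow> bool" where
  "new_run S i q j q' \<longleftrightarrow> (\<exists>c\<in>Q. q = c) \<and> (\<exists>c\<in>Q. q' = c) \<and> [i, j, i, q, j, q'] \<in> S Iter"

definition accepts :: "nat \<Rightarrow> 'a sym struct \<Rightarrow> bool" where
  "accepts n S \<longleftrightarrow> (\<exists>z<n. \<exists>l<n. \<exists>p<n. \<exists>q<n. \<exists>q'<n. z = 0 \<and> (\<forall>k<n. k \<le> l) \<and> p = q0 \<and>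
     new_run S z p l q \<and> letter_step S l q q' \<and> (\<exists>c\<in>F. q' = c))"

text \<open>The two size conditions say \<open>length w = n\<close> by means of membership of
  constants in the domain. The quantifiers over \<open>w\<close>, \<open>i\<close> and
  \<open>a\<close> are finite and unfold to Boolean combinations.\<close>

definition short_word_in :: "nat \<Rightarrow> nat \<Rightarrow> 'a list set \<Rightarrow> 'a sym struct \<Rightarrow> bool" where
  "short_word_in n0 n L S \<longleftrightarrow> (\<exists>w\<in>{w. length w \<le> n0 \<and> word_of w \<in> L}.
     \<not> length w < n \<and> (length w = 0 \<or> length w - 1 < n) \<and>
     (\<forall>i\<in>{..<length w}. \<forall>a\<in>UNIV.
        ((\<exists>x<n. x = i \<and> [x] \<in> S (Inp a)) \<and> w ! i = Some a) \<or>
        (\<not> (\<exists>x<n. x = i \<and> [x] \<in> S (Inp a)) \<and> w ! i \<noteq> Some a)))"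

section \<open>Definability of the word rounds\<close>

lemmas definable_bounded = definable_bex_finite[OF Q(1)] definable_bex_finite[OF finite_subset[OF Q(3) Q(1)]]
  definable_bex_finite[OF finite_UNIV] definable_ball_finite[OF finite_UNIV] definable_ball_finite[OF finite_lessThan]

lemma definable_letter_step: "i < k \<Longrightarrow> q < k \<Longrightarrow> q' < k \<Longrightarrow> definable word_arity k (\<lambda>n S a. letter_step S (a i) (a q) (a q'))"
  unfolding letter_step_def
  apply (rule definable_bounded definable_letter definable_intros definable_eq_const definable_const | (simp; fail))+
  done

lemma definable_old_run: "i < k \<Longrightarrow> q < k \<Longrightarrow> j < k \<Longrightarrow> q' < k \<Longrightarrow>
    definable word_arity k (\<lambda>n S a. old_run S (a i) (a q) (a j) (a q'))"
  unfolding old_run_def by (rule definable_rel4) (simp_all add: word_arity[unfolded One_nat_def])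

lemma definable_changed: "i < k \<Longrightarrow> definable word_arity k (\<lambda>n S a. changed n S (a i))"
  unfolding changed_def
  apply (rule definable_intros definable_Suc definable_old_run definable_letter_step | (simp; fail))+
  done

lemma definable_word_value: "e1 < k \<Longrightarrow> e2 < k \<Longrightarrow> i < k \<Longrightarrow> definable word_arity k (\<lambda>n S a. word_value n S (a e1) (a e2) (a i))"
  unfolding word_value_def
  apply (rule definable_bounded definable_intros definable_Suc definable_changed definable_eq_const | (simp; fail))+
  done

lemma definable_segment_step: "i < k \<Longrightarrow> q < k \<Longrightarrow> j < k \<Longrightarrow> q' < k \<Longrightarrow>
    definable word_arity k (\<lambda>n S a. segment_step n S (a i) (a q) (a j) (a q'))"
  unfolding segment_step_def
  apply (rule definable_intros definable_Suc definable_changed definable_old_run definable_letter_step | (simp; fail))+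
  done

lemma definable_word_round: "definable word_arity 6 (\<lambda>n S a. word_round n S (a 0) (a 1) (a 2) (a 3) (a 4) (a 5))"
proof -
  have chain: "definable word_arity 6 (\<lambda>n S a. chain n (word_value n S (a 0) (a 1))
      (\<lambda>s1 s2 t1 t2. [a 0, a 1, s1, s2, t1, t2] \<in> S Iter) (a 2) (a 3) (a 4) (a 5))"
    apply (rule definable_chain[where V = "\<lambda>n S a. word_value n S (a 0) (a 1)" and
          R = "\<lambda>n S a s1 s2 t1 t2. [a 0, a 1, s1, s2, t1, t2] \<in> S Iter"])
           apply (rule definable_word_value definable_word_Iter | (simp; fail))+
    done
  show ?thesis
    unfolding word_round_def
    apply (rule definable_intros definable_word_value definable_segment_step chain | (simp; fail))+
    done
qed

lemma definable_new_run: "i < k \<Longrightarrow> q < k \<Longrightarrow> j < k \<Longrightarrow> q' < k \<Longrightarrow>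
    definable word_arity k (\<lambda>n S a. new_run S (a i) (a q) (a j) (a q'))"
  unfolding new_run_def
  apply (rule definable_bounded definable_intros definable_word_Iter definable_eq_const | (simp; fail))+
  done

lemma definable_accepts: "definable word_arity k (\<lambda>n S a. accepts n S)"
  unfolding accepts_def
  apply (rule definable_bounded definable_intros definable_new_run definable_letter_step definable_eq_const | (simp; fail))+
  done

lemma definable_short_word_in: "definable word_arity k (\<lambda>n S a. short_word_in n0 n L S)"
proof -
  have fin: "finite {w :: 'a option list. length w \<le> n0 \<and> word_of w \<in> L}"
    by (rule finite_subset[OF _ finite_lists_length_le[of "UNIV :: 'a option set" n0]]) auto
  show ?thesis
    unfolding short_word_in_def
    apply (rule definable_bex_finite[OF fin] definable_bounded definable_size_gt definable_letter definable_intros definable_eq_const definable_const | (simp; fail))+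
    done
qed

end

section \<open>Runs between positions and their composition\<close>

context automaton
begin

definition delta_opt :: "nat \<Rightarrow> 'a option \<Rightarrow> nat" where
  "delta_opt q x = (case x of None \<Rightarrow> q | Some a \<Rightarrow> \<delta> q a)"

definition run :: "'a option list \<Rightarrow> nat \<Rightarrow> nat \<Rightarrow> nat \<Rightarrow> nat" where
  "run w i j q = foldl (\<lambda>q k. delta_opt q (w ! k)) q [i..<j]"

lemma delta_opt_closed: "q \<in> Q \<Longrightarrow> delta_opt q x \<in> Q"
  using \<delta> by (simp add: delta_opt_def split: option.split)

lemma run_refl [simp]: "run w i i q = q"
  by (simp add: run_def)

lemma run_Suc: "i \<le> j \<Longrightarrow> run w i (Suc j) q = delta_opt (run w i j q) (w ! j)"
  by (simp add: run_def)

lemma run_trans: "i \<le> j \<Longrightarrow> j \<le> k \<Longrightarrow> run w j k (run w i j q) = run w i k q"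
proof -
  assume "i \<le> j" "j \<le> k"
  then have "[i..<k] = [i..<j] @ [j..<k]" using upt_add_eq_append[of i j "k - j"] by simp
  then show ?thesis by (simp add: run_def)
qed

lemma run_closed: "q \<in> Q \<Longrightarrow> run w i j q \<in> Q"
proof (induction j)
  case (Suc j)
  then show ?case by (cases "i \<le> j") (simp_all add: run_Suc delta_opt_closed, simp add: run_def)
qed (simp add: run_def)

lemma foldl_word_of: "foldl \<delta> q (word_of w) = foldl delta_opt q w"
  by (induction w arbitrary: q) (auto simp: word_of_def delta_opt_def)

lemma foldl_eq_run: "foldl delta_opt q w = run w 0 (length w) q"
proof -
  have "foldl delta_opt q (map ((!) w) [0..<length w]) = run w 0 (length w) q"
    unfolding run_def foldl_map ..
  then show ?thesis by (simp only: map_nth)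
qed

lemma run_cong:
  assumes "\<And>k q. i \<le> k \<Longrightarrow> k < j \<Longrightarrow> q \<in> Q \<Longrightarrow> delta_opt q (w ! k) = delta_opt q (w' ! k)" "i \<le> j" "q \<in> Q"
  shows "run w i j q = run w' i j q"
  using assms(2,1)
proof (induction j rule: dec_induct)
  case (step j)
  have "run w i j q = run w' i j q" using step by simp
  then show ?case using step(1,4) run_closed[OF assms(3)] by (simp add: run_Suc)
qed simp

end

lemma word_struct_iff: "[i] \<in> word_struct w a \<longleftrightarrow> i < length w \<and> w ! i = Some a"
  by (simp add: word_struct_def)

text \<open>This identifies the word of the invariant with the one that the change refers
  to.\<close>

lemma word_struct_inj:
  assumes "word_struct w = word_struct w'" "length w = length w'"
  shows "w = w'"
proof (rule nth_equalityI[OF assms(2)])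
  fix i assume i: "i < length w"
  have "w ! i = Some a \<longleftrightarrow> w' ! i = Some a" for a
    using word_struct_iff[of i w a] word_struct_iff[of i w' a] assms i by simp
  then show "w ! i = w' ! i" by (metis not_None_eq)
qed

section \<open>Correctness of one update of the runs\<close>

locale word_update = automaton Q \<delta> q0 F
  for Q :: "nat set" and \<delta> :: "nat \<Rightarrow> 'a::finite \<Rightarrow> nat" and q0 F +
  fixes n r :: nat and w w' :: "'a option list" and A :: "nat \<Rightarrow> nat list set"
  assumes w: "length w = n" "length w' = n" and Qn: "Q \<subseteq> {..<n}"
    and aux: "A 1 = {[i, q, j, q'] | i q j q'. i \<le> j \<and> j < n \<and> q \<in> Q \<and> q' \<in> Q \<and> run w i j q = q'}"
    and cod: "\<And>e1 e2 W. W \<subseteq> {..<n} \<Longrightarrow>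
      W \<subseteq> {i. i < n \<and> w ! i \<noteq> w' ! i} \<union> Suc ` {i. i < n \<and> w ! i \<noteq> w' ! i} \<union> Q \<union> {e1, e2} \<Longrightarrow> codable n W r"
begin

abbreviation St :: "nat list set \<Rightarrow> 'a sym struct" where
  "St X \<equiv> combine (word_struct w') A X"

lemma letter_step:
  assumes "i < n"
  shows "letter_step (St X) i q q' \<longleftrightarrow> q \<in> Q \<and> q' \<in> Q \<and> delta_opt q (w' ! i) = q'"
proof -
  have "[i] \<in> St X (Inp a) \<longleftrightarrow> w' ! i = Some a" for a
    using assms w by (simp add: combine_def word_struct_iff)
  then show ?thesis unfolding letter_step_def delta_opt_def by (cases "w' ! i") auto
qed

lemma old_run: "old_run (St X) i q j q' \<longleftrightarrow> i \<le> j \<and> j < n \<and> q \<in> Q \<and> q' \<in> Q \<and> run w i j q = q'"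
  by (auto simp: old_run_def combine_def aux[unfolded One_nat_def])

text \<open>\<open>Suc i < n\<close> is required because the old action of a letter is read off the
  stored run from \<open>i\<close> to \<open>Suc i\<close>.\<close>

definition Ch :: "nat set" where "Ch = {i. Suc i < n \<and> (\<exists>q\<in>Q. delta_opt q (w ! i) \<noteq> delta_opt q (w' ! i))}"

lemma changed: "changed n (St X) i \<longleftrightarrow> i \<in> Ch"
proof (cases "Suc i < n")
  case True
  have E: "letter_step (St X) i q q' \<longleftrightarrow> q \<in> Q \<and> q' \<in> Q \<and> delta_opt q (w' ! i) = q'" for q q'
    using True by (intro letter_step) simp
  have R: "old_run (St X) i q (Suc i) q' \<longleftrightarrow> q \<in> Q \<and> q' \<in> Q \<and> delta_opt q (w ! i) = q'" for q q'
    using True by (simp add: old_run run_Suc)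
  have "changed n (St X) i \<longleftrightarrow> (\<exists>q<n. \<exists>q'<n. q \<in> Q \<and> q' \<in> Q \<and> (delta_opt q (w ! i) = q') \<noteq> (delta_opt q (w' ! i) = q'))"
    unfolding changed_def using True by (auto simp: E R)
  also have "\<dots> \<longleftrightarrow> i \<in> Ch"
  proof
    assume "\<exists>q<n. \<exists>q'<n. q \<in> Q \<and> q' \<in> Q \<and> (delta_opt q (w ! i) = q') \<noteq> (delta_opt q (w' ! i) = q')"
    then obtain q q' where q: "q \<in> Q" "(delta_opt q (w ! i) = q') \<noteq> (delta_opt q (w' ! i) = q')" by blast
    then have "delta_opt q (w ! i) \<noteq> delta_opt q (w' ! i)" by auto
    with q(1) show "i \<in> Ch" unfolding Ch_def using True by blast
  next
    assume "i \<in> Ch"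
    then obtain q where q: "q \<in> Q" "delta_opt q (w ! i) \<noteq> delta_opt q (w' ! i)" unfolding Ch_def by blast
    have "delta_opt q (w ! i) \<in> Q" using q(1) by (rule delta_opt_closed)
    moreover have "q < n" "delta_opt q (w ! i) < n" using q(1) calculation Qn by auto
    ultimately show "\<exists>q<n. \<exists>q'<n. q \<in> Q \<and> q' \<in> Q \<and> (delta_opt q (w ! i) = q') \<noteq> (delta_opt q (w' ! i) = q')"
      using q by (intro exI[of _ q] conjI exI[of _ "delta_opt q (w ! i)"]) auto
  qed
  finally show ?thesis .
next
  case False
  then show ?thesis by (auto simp: changed_def Ch_def)
qed

definition V :: "nat \<Rightarrow> nat \<Rightarrow> nat set" where
  "V e1 e2 = Ch \<union> Suc ` Ch \<union> Q \<union> {e1, e2}"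

lemma Ch_less: "i \<in> Ch \<Longrightarrow> Suc i < n"
  by (simp add: Ch_def)

lemma word_value: "word_value n (St X) e1 e2 = (\<lambda>v. v \<in> V e1 e2)"
proof
  fix v
  have "(\<exists>u<n. Suc u = v \<and> changed n (St X) u) \<longleftrightarrow> v \<in> Suc ` Ch"
    using Ch_less unfolding changed by force
  then show "word_value n (St X) e1 e2 v \<longleftrightarrow> v \<in> V e1 e2"
    unfolding word_value_def V_def changed by auto
qed

lemma V_less: "e1 < n \<Longrightarrow> e2 < n \<Longrightarrow> V e1 e2 \<subseteq> {..<n}"
  using Qn Ch_less by (auto simp: V_def dest: Ch_less)

lemma V_codable:
  assumes "e1 < n" "e2 < n"
  shows "codable n (V e1 e2) r"
proof (rule cod[OF V_less[OF assms]])
  have "Ch \<subseteq> {i. i < n \<and> w ! i \<noteq> w' ! i}" by (auto simp: Ch_def)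
  then show "V e1 e2 \<subseteq> {i. i < n \<and> w ! i \<noteq> w' ! i} \<union> Suc ` {i. i < n \<and> w ! i \<noteq> w' ! i} \<union> Q \<union> {e1, e2}"
    unfolding V_def by blast
qed

lemma run_unchanged:
  assumes "i \<le> j" "j < n" "q \<in> Q" "\<And>k. i \<le> k \<Longrightarrow> k < j \<Longrightarrow> k \<notin> Ch"
  shows "run w i j q = run w' i j q"
proof (rule run_cong[OF _ assms(1,3)])
  fix k q assume "i \<le> k" "k < j" "q \<in> Q"
  then show "delta_opt q (w ! k) = delta_opt q (w' ! k)" using assms(2) assms(4)[of k] unfolding Ch_def by auto
qed

definition T :: "((nat \<times> nat) \<times> (nat \<times> nat)) set" where
  "T = {((i, q), (j, q')). j < n \<and> q \<in> Q \<and> q' \<in> Q \<and>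
     ((i \<le> j \<and> (\<forall>k. i \<le> k \<and> k < j \<longrightarrow> k \<notin> Ch) \<and> run w i j q = q') \<or> (Suc i = j \<and> delta_opt q (w' ! i) = q'))}"

lemma segment_step:
  assumes "i < n" "j < n"
  shows "segment_step n (St X) i q j q' \<longleftrightarrow> ((i, q), (j, q')) \<in> T"
proof -
  have "(\<forall>k<n. i \<le> k \<and> k < j \<longrightarrow> k \<notin> Ch) \<longleftrightarrow> (\<forall>k. i \<le> k \<and> k < j \<longrightarrow> k \<notin> Ch)"
    using assms by (meson order.strict_trans)
  then show ?thesis unfolding segment_step_def T_def changed old_run letter_step[OF assms(1)] using assms(2) by auto
qed

text \<open>Every step of \<open>T\<close> is a run on the new word: old runs are used only across
  letters whose action is unchanged. Steps compose by \<open>run_trans\<close>.\<close>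

lemma T_sound:
  assumes "((i, q), (j, q')) \<in> (restrict_nodes (V e1 e2) T)\<^sup>*" "q \<in> Q"
  shows "i \<le> j \<and> q' \<in> Q \<and> run w' i j q = q'"
proof -
  have "i \<le> fst z \<and> snd z \<in> Q \<and> run w' i (fst z) q = snd z" if "((i, q), z) \<in> (restrict_nodes (V e1 e2) T)\<^sup>*" for z
    using that
  proof (induction rule: rtrancl_induct)
    case base
    then show ?case using assms(2) by simp
  next
    case (step y z)
    obtain j p where y: "y = (j, p)" by (cases y)
    obtain k s where z: "z = (k, s)" by (cases z)
    have T: "((j, p), (k, s)) \<in> T" using step(2) by (simp add: y z restrict_nodes_def)
    have IH: "i \<le> j" "p \<in> Q" "run w' i j q = p" using step.IH by (auto simp: y)
    from T have s: "s \<in> Q" and k: "k < n" by (auto simp: T_def)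
    from T consider "j \<le> k" "\<And>l. j \<le> l \<Longrightarrow> l < k \<Longrightarrow> l \<notin> Ch" "run w j k p = s" | "Suc j = k" "delta_opt p (w' ! j) = s"
      unfolding T_def by blast
    then have "j \<le> k \<and> run w' j k p = s"
    proof cases
      case 1
      then show ?thesis using run_unchanged[of j k p] k IH by simp
    next
      case 2
      then show ?thesis using run_Suc[of j j w' p] by auto
    qed
    then show ?case using IH s run_trans[of i j k w' q] by (simp add: z)
  qed
  from this[OF assms(1)] show ?thesis by simp
qed

text \<open>The run is cut at the first changed position \<open>k\<close>: an old run leads to
  \<open>k\<close>, a single new letter to \<open>Suc k\<close>, and the remaining stretch is
  shorter. Both cut points are values in \<open>V\<close>.\<close>

lemma T_complete:
  assumes "i \<in> V e1 e2" "j \<in> V e1 e2" "i \<le> j" "j < n" "q \<in> Q"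
  shows "((i, q), (j, run w' i j q)) \<in> (restrict_nodes (V e1 e2) T)\<^sup>*"
  using assms
proof (induction "j - i" arbitrary: i q rule: less_induct)
  case less
  have QV: "p \<in> V e1 e2" if "p \<in> Q" for p using that by (simp add: V_def)
  show ?case
  proof (cases "\<exists>k. i \<le> k \<and> k < j \<and> k \<in> Ch")
    case False
    then have "run w i j q = run w' i j q" using less.prems by (intro run_unchanged) auto
    then have "((i, q), (j, run w' i j q)) \<in> T"
      unfolding T_def using less.prems False run_closed[of q w' i j] by auto
    then have "((i, q), (j, run w' i j q)) \<in> restrict_nodes (V e1 e2) T"
      unfolding restrict_nodes_def using less.prems QV run_closed[of q w' i j] by simp
    then show ?thesis by blast
  next
    case True
    define k where "k = (LEAST k. i \<le> k \<and> k < j \<and> k \<in> Ch)"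
    have k: "i \<le> k" "k < j" "k \<in> Ch" using LeastI_ex[OF True] by (auto simp: k_def)
    have min: "l \<notin> Ch" if "i \<le> l" "l < k" for l
      using not_less_Least[of l "\<lambda>k. i \<le> k \<and> k < j \<and> k \<in> Ch"] that k by (auto simp: k_def)
    let ?p = "run w' i k q" and ?s = "run w' i (Suc k) q"
    have p: "?p \<in> Q" "?s \<in> Q" using run_closed less.prems by auto
    have kV: "k \<in> V e1 e2" "Suc k \<in> V e1 e2" using k by (auto simp: V_def)
    have "run w i k q = ?p" using less.prems k min by (intro run_unchanged) auto
    then have "((i, q), (k, ?p)) \<in> T" unfolding T_def using k min p less.prems by auto
    then have 1: "((i, q), (k, ?p)) \<in> restrict_nodes (V e1 e2) T"
      unfolding restrict_nodes_def using less.prems kV p QV by simp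
    have "((k, ?p), (Suc k, ?s)) \<in> T"
      unfolding T_def using k p less.prems by (auto simp: run_Suc)
    then have 2: "((k, ?p), (Suc k, ?s)) \<in> restrict_nodes (V e1 e2) T"
      unfolding restrict_nodes_def using kV p QV by simp
    have "((Suc k, ?s), (j, run w' (Suc k) j ?s)) \<in> (restrict_nodes (V e1 e2) T)\<^sup>*"
      using k less.prems kV p by (intro less.hyps) auto
    moreover have "run w' (Suc k) j ?s = run w' i j q" using k by (intro run_trans) auto
    ultimately show ?thesis using 1 2 by (metis converse_rtrancl_into_rtrancl)
  qed
qed

definition step :: "nat list set \<Rightarrow> nat list set" where
  "step X = {t. length t = 6 \<and> set t \<subseteq> {..<n} \<and>
     word_round n (St X) (t ! 0) (t ! 1) (t ! 2) (t ! 3) (t ! 4) (t ! 5)}"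

definition rel :: "nat list set \<Rightarrow> nat \<Rightarrow> nat \<Rightarrow> ((nat \<times> nat) \<times> (nat \<times> nat)) set" where
  "rel X e1 e2 = {((x1, x2), (y1, y2)). [e1, e2, x1, x2, y1, y2] \<in> X}"

lemma chain_rel: "chain n (word_value n (St X) e1 e2)
    (\<lambda>s1 s2 t1 t2. [e1, e2, s1, s2, t1, t2] \<in> St X Iter) x1 x2 y1 y2 \<longleftrightarrow>
    chain n (\<lambda>s. s \<in> V e1 e2) (\<lambda>s1 s2 t1 t2. ((s1, s2), (t1, t2)) \<in> rel X e1 e2) x1 x2 y1 y2"
proof -
  have "[e1, e2, s1, s2, t1, t2] \<in> St X Iter \<longleftrightarrow> ((s1, s2), (t1, t2)) \<in> rel X e1 e2" for s1 s2 t1 t2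
    by (simp add: rel_def combine_def)
  then show ?thesis by (simp only: word_value)
qed

lemma round_step:
  assumes "e1 < n" "e2 < n"
  shows "rel (step X) e1 e2 = closure_step n (V e1 e2) T (rel X e1 e2)"
proof (intro set_eqI)
  fix z :: "(nat \<times> nat) \<times> nat \<times> nat"
  obtain x1 x2 y1 y2 where z: "z = ((x1, x2), (y1, y2))" by (cases z) auto
  have "z \<in> rel (step X) e1 e2 \<longleftrightarrow> word_round n (St X) e1 e2 x1 x2 y1 y2"
  proof -
    have "x1 < n \<and> x2 < n \<and> y1 < n \<and> y2 < n" if "word_round n (St X) e1 e2 x1 x2 y1 y2"
      using that V_less[OF assms] unfolding word_round_def word_value by blast
    then show ?thesis using assms by (auto simp: z rel_def step_def)
  qed
  also have "\<dots> \<longleftrightarrow> z \<in> closure_step n (V e1 e2) T (rel X e1 e2)"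
  proof (cases "x1 \<in> V e1 e2 \<and> y1 \<in> V e1 e2")
    case True
    then have "x1 < n" "y1 < n" using V_less[OF assms] by auto
    then have "word_round n (St X) e1 e2 x1 x2 y1 y2 \<longleftrightarrow>
        x1 \<in> V e1 e2 \<and> x2 \<in> V e1 e2 \<and> y1 \<in> V e1 e2 \<and> y2 \<in> V e1 e2 \<and>
        ((x1 = y1 \<and> x2 = y2) \<or> ((x1, x2), (y1, y2)) \<in> T \<or>
         chain n (\<lambda>s. s \<in> V e1 e2) (\<lambda>s1 s2 t1 t2. ((s1, s2), (t1, t2)) \<in> rel X e1 e2) x1 x2 y1 y2)"
      unfolding word_round_def chain_rel by (simp only: segment_step word_value)
    then show ?thesis unfolding closure_step_def z by simp
  next
    case False
    then show ?thesis unfolding word_round_def closure_step_def z word_value by auto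
  qed
  finally show "z \<in> rel (step X) e1 e2 \<longleftrightarrow> z \<in> closure_step n (V e1 e2) T (rel X e1 e2)" .
qed

lemma result:
  assumes "i < n" "j < n" "q \<in> Q" "q' \<in> Q" "r < m"
  shows "[i, j, i, q, j, q'] \<in> (step ^^ m) {} \<longleftrightarrow> i \<le> j \<and> run w' i j q = q'"
proof -
  have V: "i \<in> V i j" "j \<in> V i j" "q \<in> V i j" "q' \<in> V i j" using assms by (auto simp: V_def)
  have "rel ((step ^^ m) {}) i j = node_closure (V i j) T"
  proof (rule rounds_eq_node_closure[OF V_less[OF assms(1,2)] V_codable[OF assms(1,2)],
        where R = "\<lambda>m. rel ((step ^^ m) {}) i j"])
    show "rel ((step ^^ 0) {}) i j \<subseteq> node_closure (V i j) T" by (auto simp: rel_def)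
    show "rel ((step ^^ Suc m) {}) i j = closure_step n (V i j) T (rel ((step ^^ m) {}) i j)" for m
      using round_step[OF assms(1,2)] by simp
  qed (rule assms)
  then have "[i, j, i, q, j, q'] \<in> (step ^^ m) {} \<longleftrightarrow> ((i, q), (j, q')) \<in> node_closure (V i j) T"
    by (auto simp: rel_def set_eq_iff)
  also have "\<dots> \<longleftrightarrow> ((i, q), (j, q')) \<in> (restrict_nodes (V i j) T)\<^sup>*"
    using V by (simp add: node_closure_def restrict_nodes_def)
  also have "\<dots> \<longleftrightarrow> i \<le> j \<and> run w' i j q = q'"
    using T_sound[of i q j q' i j] T_complete[OF V(1,2) _ assms(2,3)] assms(3) by blast
  finally show ?thesis .
qed

end

section \<open>Invariant and dynamic program for regular languages\<close>

context automaton
begin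

definition runs :: "nat \<Rightarrow> 'a option list \<Rightarrow> nat list set" where
  "runs n w = {[i, q, j, q'] | i q j q'. i \<le> j \<and> j < n \<and> q \<in> Q \<and> q' \<in> Q \<and> run w i j q = q'}"

definition word_inv :: "'a list set \<Rightarrow> nat \<Rightarrow> nat \<Rightarrow> 'a struct \<Rightarrow> (nat \<Rightarrow> nat list set) \<Rightarrow> bool" where
  "word_inv L n0 n I A \<longleftrightarrow> (\<exists>w. length w = n \<and> I = word_struct w \<and>
     A 0 = (if word_of w \<in> L then {[]} else {}) \<and> (n0 < n \<longrightarrow> A 1 = runs n w))"

lemma short_word_in_iff:
  assumes "length w = n" "n \<le> n0"
  shows "short_word_in n0 n L (combine (word_struct w) A X) \<longleftrightarrow> word_of w \<in> L"
proof -
  let ?S = "combine (word_struct w) A X"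
  have S: "[x] \<in> ?S (Inp a) \<longleftrightarrow> x < n \<and> w ! x = Some a" for x a
    using assms by (simp add: combine_def word_struct_iff)
  have "v = w" if v: "\<not> length v < n" "length v = 0 \<or> length v - 1 < n"
    "\<forall>i\<in>{..<length v}. \<forall>a\<in>UNIV.
        ((\<exists>x<n. x = i \<and> [x] \<in> ?S (Inp a)) \<and> v ! i = Some a) \<or>
        (\<not> (\<exists>x<n. x = i \<and> [x] \<in> ?S (Inp a)) \<and> v ! i \<noteq> Some a)" for v
  proof (rule nth_equalityI)
    show len: "length v = length w" using v(1,2) assms by auto
    fix i assume i: "i < length v"
    then have "v ! i = Some a \<longleftrightarrow> w ! i = Some a" for a
      using v(3) len assms(1) unfolding S by fastforce
    then show "v ! i = w ! i" by (metis not_None_eq)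
  qed
  moreover have "\<forall>i\<in>{..<length w}. \<forall>a\<in>UNIV.
        ((\<exists>x<n. x = i \<and> [x] \<in> ?S (Inp a)) \<and> w ! i = Some a) \<or>
        (\<not> (\<exists>x<n. x = i \<and> [x] \<in> ?S (Inp a)) \<and> w ! i \<noteq> Some a)"
    unfolding S using assms(1) by auto
  moreover have "\<not> length w < n" "length w = 0 \<or> length w - 1 < n" using assms(1) by linarith+
  ultimately show ?thesis unfolding short_word_in_def using assms by blast
qed

lemma word_inv_step:
  assumes inv: "word_inv L n0 n I A" and ch: "word_changes s n c I I'"
    and L: "L = {w. foldl \<delta> q0 w \<in> F}" and n0: "1 \<le> n0" "Q \<subseteq> {..<n0}"
    and cod: "\<And>W. n0 < n \<Longrightarrow> W \<subseteq> {..<n} \<Longrightarrow> real (card W) \<le> real (card Q + 4) * (1 + s n) \<Longrightarrow> codable n W r"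
    and X: "X = ((\<lambda>X. {t. length t = 6 \<and> set t \<subseteq> {..<n} \<and>
      word_round n (combine I' A X) (t ! 0) (t ! 1) (t ! 2) (t ! 3) (t ! 4) (t ! 5)}) ^^ m) {}"
    and m: "n0 < n \<Longrightarrow> r < m"
    and A0: "A' 0 = {t. length t = 0 \<and> set t \<subseteq> {..<n} \<and>
      ((n0 < n \<and> accepts n (combine I' A X)) \<or> (\<not> n0 < n \<and> short_word_in n0 n L (combine I' A X)))}"
    and A1: "A' 1 = {t. length t = 4 \<and> set t \<subseteq> {..<n} \<and>
      new_run (combine I' A X) (t ! 0) (t ! 1) (t ! 2) (t ! 3)}"
  shows "word_inv L n0 n I' A'"
proof -
  obtain w where w: "length w = n" "I = word_struct w" "n0 < n \<longrightarrow> A 1 = runs n w"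
    using inv unfolding word_inv_def by blast
  obtain v w' where w': "length v = n" "length w' = n" "I = word_struct v" "I' = word_struct w'"
    "real (card {i. i < n \<and> v ! i \<noteq> w' ! i}) \<le> s n"
    using ch unfolding word_changes_def by blast
  have "v = w" using word_struct_inj[of v w] w w' by simp
  note w' = w'[unfolded \<open>v = w\<close>]
  show ?thesis
  proof (cases "n0 < n")
    case False
    then have "A' 0 = (if word_of w' \<in> L then {[]} else {})"
      unfolding A0 w'(4) using short_word_in_iff[OF w'(2), of n0 L A X] by auto
    then show ?thesis unfolding word_inv_def using w' False by blast
  next
    case True
    interpret word_update Q \<delta> q0 F n r w w' A
    proof
      show "Q \<subseteq> {..<n}" using n0(2) True by auto
      show "A 1 = {[i, q, j, q'] | i q j q'. i \<le> j \<and> j < n \<and> q \<in> Q \<and> q' \<in> Q \<and> run w i j q = q'}"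
        using w(3) True by (simp add: runs_def)
      fix e1 e2 W assume W: "W \<subseteq> {..<n}"
        "W \<subseteq> {i. i < n \<and> w ! i \<noteq> w' ! i} \<union> Suc ` {i. i < n \<and> w ! i \<noteq> w' ! i} \<union> Q \<union> {e1, e2}"
      let ?D = "{i. i < n \<and> w ! i \<noteq> w' ! i}"
      show "codable n W r"
      proof (rule cod[OF True W(1)])
        have "card W \<le> card (?D \<union> Suc ` ?D \<union> Q \<union> {e1, e2})"
          using W(2) Q(1) by (intro card_mono) auto
        also have "\<dots> \<le> card (?D \<union> Suc ` ?D \<union> Q) + card {e1, e2}" by (rule card_Un_le)
        also have "\<dots> \<le> (card (?D \<union> Suc ` ?D) + card Q) + 2"
          by (intro add_mono card_Un_le) (simp add: card_insert_if)
        also have "\<dots> \<le> ((card ?D + card (Suc ` ?D)) + card Q) + 2"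
          by (intro add_mono card_Un_le order.refl)
        also have "\<dots> \<le> ((card ?D + card ?D) + card Q) + 2"
          by (intro add_mono card_image_le order.refl) simp
        finally have "real (card W) \<le> 2 * real (card ?D) + real (card Q) + 2" by linarith
        also have "\<dots> \<le> 2 * s n + real (card Q) + 2" using w'(5) by linarith
        \<comment> \<open>Each changed position contributes itself and its successor; the states and
          two parameters are added.\<close>
        also have "\<dots> \<le> real (card Q + 4) * (1 + s n)"
        proof -
          have "0 \<le> s n" using w'(5) by (meson of_nat_0_le_iff order.trans)
          then have "0 \<le> real (card Q) * s n" by simp
          with \<open>0 \<le> s n\<close> show ?thesis by (simp add: algebra_simps)
        qed
        finally show "real (card W) \<le> real (card Q + 4) * (1 + s n)" .
      qed
    qed (use w w' in auto)
    have X_eq: "X = (step ^^ m) {}"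
      unfolding X w'(4) by (rule arg_cong[where f = "\<lambda>f. (f ^^ m) {}"]) (simp add: fun_eq_iff step_def)
    have "[i, j, i, q, j, q'] \<in> St X Iter \<longleftrightarrow> i \<le> j \<and> run w' i j q = q'"
      if "i < n" "j < n" "q \<in> Q" "q' \<in> Q" for i j q q'
      using result[OF that m[OF True]] unfolding X_eq by (simp add: combine_def)
    then have wRes: "new_run (St X) i q j q' \<longleftrightarrow> q \<in> Q \<and> q' \<in> Q \<and> i \<le> j \<and> run w' i j q = q'"
      if "i < n" "j < n" for i j q q'
      unfolding new_run_def using that by auto
    have "A' 1 = runs n w'"
    proof (intro set_eqI iffI)
      fix t assume "t \<in> A' 1"
      then obtain i q j q' where "t = [i, q, j, q']" "i < n" "j < n" "new_run (St X) i q j q'"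
        unfolding A1 w'(4) by (auto simp: length_4_iff)
      then show "t \<in> runs n w'" unfolding runs_def using wRes by blast
    next
      fix t assume "t \<in> runs n w'"
      then obtain i q j q' where t: "t = [i, q, j, q']" "i \<le> j" "j < n" "q \<in> Q" "q' \<in> Q" "run w' i j q = q'"
        unfolding runs_def by blast
      then have "new_run (St X) i q j q'" using wRes[of i j] by simp
      moreover have "set t \<subseteq> {..<n}" using t Qn by auto
      ultimately show "t \<in> A' 1" unfolding A1 w'(4) by (simp add: t(1))
    qed
    moreover have "accepts n (St X) \<longleftrightarrow> word_of w' \<in> L"
    proof -
      obtain l where l: "n = Suc l" using True by (cases n) auto
      have last: "(\<forall>k<n. k \<le> i) \<longleftrightarrow> i = l" if "i < n" for i using that l by auto
      have "foldl \<delta> q0 (word_of w') = delta_opt (run w' 0 l q0) (w' ! l)"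
        unfolding foldl_word_of foldl_eq_run w'(2) l by (simp add: run_Suc)
      moreover have "accepts n (St X) \<longleftrightarrow> delta_opt (run w' 0 l q0) (w' ! l) \<in> F"
      proof
        assume "accepts n (St X)"
        then obtain i q q' where "i < n" "\<forall>k<n. k \<le> i" "new_run (St X) 0 q0 i q" "letter_step (St X) i q q'" "q' \<in> F"
          unfolding accepts_def by blast
        then show "delta_opt (run w' 0 l q0) (w' ! l) \<in> F" using wRes[of 0 i q0 q] last[of i] l by (auto simp: letter_step)
      next
        assume acc: "delta_opt (run w' 0 l q0) (w' ! l) \<in> F"
        have r: "run w' 0 l q0 \<in> Q" "delta_opt (run w' 0 l q0) (w' ! l) \<in> Q"
          using Q run_closed delta_opt_closed by auto
        have "new_run (St X) 0 q0 l (run w' 0 l q0)" using wRes[of 0 l] l Q(2) r by simp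
        moreover have "letter_step (St X) l (run w' 0 l q0) (delta_opt (run w' 0 l q0) (w' ! l))"
          using letter_step[of l] l r by simp
        moreover have "\<forall>k<n. k \<le> l" using l by auto
        moreover have "0 < n" "l < n" "q0 < n" "run w' 0 l q0 < n" "delta_opt (run w' 0 l q0) (w' ! l) < n"
          using l r Q(2) Qn by auto
        ultimately show "accepts n (St X)" unfolding accepts_def using acc by blast
      qed
      ultimately show ?thesis unfolding L by simp
    qed
    then have "A' 0 = (if word_of w' \<in> L then {[]} else {})"
      unfolding A0 w'(4) using True by auto
    ultimately show ?thesis unfolding word_inv_def using w' by blast
  qed
qed

theorem word_membership_automaton:
  assumes L: "L = {w. foldl \<delta> q0 w \<in> F}"
  shows "in_DynFOLL (word_membership L (batch_size e))"
proof -
  obtain c n1 where cn: "\<And>n. n \<ge> n1 \<Longrightarrow> 1 \<le> c * loglog n"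
     "\<And>n V. n \<ge> n1 \<Longrightarrow> V \<subseteq> {..<n} \<Longrightarrow> real (card V) \<le> real (card Q + 4) * (1 + batch_size e n) \<Longrightarrow>
        codable n V (c * loglog n - 1)"
    using codable_eventually[of "card Q + 4" e] by blast
  obtain b where b: "Q \<subseteq> {..<b}" using Q(1) unfolding finite_nat_set_iff_bounded by auto
  \<comment> \<open>The summand \<open>b\<close> makes all states domain elements as soon as
    \<open>n0 < n\<close>.\<close>
  define n0 where "n0 = Suc (n1 + b)"
  obtain \<phi> where \<phi>: "wf_fo word_arity {..<6} \<phi>"
    "\<And>n S. defined_rel n S 6 \<phi> = {t. length t = 6 \<and> set t \<subseteq> {..<n} \<and>
      word_round n S (t ! 0) (t ! 1) (t ! 2) (t ! 3) (t ! 4) (t ! 5)}"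
    by (rule definable_defined_rel[OF definable_word_round]) simp
  have fo0: "definable word_arity 0 (\<lambda>n S a. (n0 < n \<and> accepts n S) \<or> (\<not> n0 < n \<and> short_word_in n0 n L S))"
    by (intro definable_disj definable_conj definable_not definable_size_gt definable_accepts definable_short_word_in)
  obtain \<psi>0 where \<psi>0: "wf_fo word_arity {..<0} \<psi>0"
    "\<And>n S. defined_rel n S 0 \<psi>0 = {t. length t = 0 \<and> set t \<subseteq> {..<n} \<and>
      ((n0 < n \<and> accepts n S) \<or> (\<not> n0 < n \<and> short_word_in n0 n L S))}"
    by (rule definable_defined_rel[OF fo0], rule that)
  have fo1: "definable word_arity 4 (\<lambda>n S a. new_run S (a 0) (a 1) (a 2) (a 3))"
    by (rule definable_new_run) simp_all
  obtain \<psi>1 where \<psi>1: "wf_fo word_arity {..<4} \<psi>1"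
    "\<And>n S. defined_rel n S 4 \<psi>1 = {t. length t = 4 \<and> set t \<subseteq> {..<n} \<and>
      new_run S (t ! 0) (t ! 1) (t ! 2) (t ! 3)}"
    by (rule definable_defined_rel[OF fo1]) simp
  \<comment> \<open>On the initial word no position carries a letter, so every run remains in its
    state.\<close>
  have foi: "definable (Some \<circ> (\<lambda>_::'a. 1)) 4 (\<lambda>n S a. a 0 \<le> a 2 \<and> (\<exists>x\<in>Q. a 1 = x) \<and> a 1 = a 3)"
    apply (rule definable_bex_finite[OF Q(1)] definable_intros definable_eq_const | (simp; fail))+
    done
  obtain \<iota> where \<iota>: "wf_fo (Some \<circ> (\<lambda>_::'a. 1)) {..<4} \<iota>"
    "\<And>n S. defined_rel n S 4 \<iota> = {t. length t = 4 \<and> set t \<subseteq> {..<n} \<and>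
      t ! 0 \<le> t ! 2 \<and> (\<exists>x\<in>Q. t ! 1 = x) \<and> t ! 1 = t ! 3}"
    by (rule definable_defined_rel[OF foi]) simp
  obtain \<iota>0 where \<iota>0: "wf_fo (Some \<circ> (\<lambda>_::'a. 1)) {..<0} \<iota>0"
    "\<And>n S. defined_rel n S 0 \<iota>0 = {t. length t = 0 \<and> set t \<subseteq> {..<n} \<and> [] \<in> L}"
    by (rule definable_defined_rel[OF definable_const[of _ 0 "[] \<in> L"]], rule that)
  define P :: "('a, unit) dyn_prog" where
    "P = \<lparr>aux_arities = [0, 4], init_formula = (\<lambda>i. if i = 0 then \<iota>0 else \<iota>),
      update = (\<lambda>_ i. \<lparr>iter_arity = 6, iter_formula = \<phi>, iter_factor = c,
        result_formula = (if i = 0 then \<psi>0 else \<psi>1)\<rparr>), answer = 0\<rparr>"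
  have less2: "i < Suc (Suc 0) \<longleftrightarrow> i = 0 \<or> i = Suc 0" for i by auto
  have "wf_prog (\<lambda>_. 1) P"
    unfolding wf_prog_def P_def using \<phi>(1) \<psi>0(1) \<psi>1(1) \<iota>(1) \<iota>0(1) by (auto simp: less2)
  moreover have "maintains P (word_membership L (batch_size e))"
  proof -
    have "word_inv L n0 n I A" if "reaches (word_membership L (batch_size e)) P n I A" for n I A
      using that
    proof induction
      case start
      define w :: "'a option list" where "w = replicate n None"
      have w: "length w = n" "empty_input = word_struct w" "word_of w = []"
        by (auto simp: w_def empty_input_def word_struct_def word_of_def fun_eq_iff)
      have "init_aux n P 0 = (if word_of w \<in> L then {[]} else {})"
        by (auto simp: init_aux_def P_def \<iota>0(2) w(3))
      moreover have "init_aux n P 1 = runs n w" if "n0 < n"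
      proof -
        have "w ! k = None" if "k < n" for k using that by (simp add: w_def)
        then have r: "run w i j q = q" if "i \<le> j" "j < n" for i j q
          using that(2,1)
        proof (induction j)
          case (Suc j)
          then show ?case by (cases "i = Suc j") (simp_all add: run_Suc delta_opt_def)
        qed simp
        have "init_aux n P 1 = {t. length t = 4 \<and> set t \<subseteq> {..<n} \<and>
            t ! 0 \<le> t ! 2 \<and> (\<exists>x\<in>Q. t ! 1 = x) \<and> t ! 1 = t ! 3}"
          by (simp add: init_aux_def P_def \<iota>(2))
        also have "\<dots> = runs n w"
        proof (intro set_eqI iffI)
          fix t assume "t \<in> {t. length t = 4 \<and> set t \<subseteq> {..<n} \<and>
            t ! 0 \<le> t ! 2 \<and> (\<exists>x\<in>Q. t ! 1 = x) \<and> t ! 1 = t ! 3}"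
          then obtain i q j where "t = [i, q, j, q]" "i \<le> j" "j < n" "q \<in> Q"
            by (auto simp: length_4_iff)
          then show "t \<in> runs n w" unfolding runs_def using r by auto
        next
          fix t assume "t \<in> runs n w"
          then obtain i q j where t: "t = [i, q, j, q]" "i \<le> j" "j < n" "q \<in> Q"
            unfolding runs_def using r by auto
          moreover have "q < n" using t(4) b that by (auto simp: n0_def)
          ultimately show "t \<in> {t. length t = 4 \<and> set t \<subseteq> {..<n} \<and>
            t ! 0 \<le> t ! 2 \<and> (\<exists>x\<in>Q. t ! 1 = x) \<and> t ! 1 = t ! 3}"
            by simp
        qed
        finally show ?thesis .
      qed
      ultimately show ?case unfolding word_inv_def using w by blast
    next
      case (change I A c' I')
      define X where "X = ((\<lambda>X. defined_rel n (combine I' A X) 6 \<phi>) ^^ (c * loglog n)) {}"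
      show ?case
      proof (rule word_inv_step[OF change.IH _ L, where r = "c * loglog n - 1"])
        show "word_changes (batch_size e) n c' I I'"
          using change.hyps(2) by (simp add: word_membership_def)
        show "1 \<le> n0" by (simp add: n0_def)
        show "Q \<subseteq> {..<n0}" using b by (auto simp: n0_def)
        show "codable n W (c * loglog n - 1)"
          if "n0 < n" "W \<subseteq> {..<n}" "real (card W) \<le> real (card Q + 4) * (1 + batch_size e n)" for W
          by (rule cn(2)) (use that in \<open>simp_all add: n0_def\<close>)
        show "c * loglog n - 1 < c * loglog n" if "n0 < n"
        proof -
          have "1 \<le> c * loglog n" by (rule cn(1)) (use that in \<open>simp add: n0_def\<close>)
          then show ?thesis by linarith
        qed
        have "update_aux n P c' I' A 0 = defined_rel n (combine I' A X) 0 \<psi>0"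
          by (simp add: update_aux_def run_update_def Let_def P_def X_def)
        then show "update_aux n P c' I' A 0 = {t. length t = 0 \<and> set t \<subseteq> {..<n} \<and>
            ((n0 < n \<and> accepts n (combine I' A X)) \<or> (\<not> n0 < n \<and> short_word_in n0 n L (combine I' A X)))}"
          by (simp only: \<psi>0(2))
        have "update_aux n P c' I' A 1 = defined_rel n (combine I' A X) 4 \<psi>1"
          by (simp add: update_aux_def run_update_def Let_def P_def X_def)
        then show "update_aux n P c' I' A 1 = {t. length t = 4 \<and> set t \<subseteq> {..<n} \<and>
            new_run (combine I' A X) (t ! 0) (t ! 1) (t ! 2) (t ! 3)}"
          by (simp only: \<psi>1(2))
      qed (simp only: X_def \<phi>(2))
    qed
    moreover have "A 0 = membership_query L n I" if inv: "word_inv L n0 n I A" for n I A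
    proof -
      obtain w where w: "length w = n" "I = word_struct w" "A 0 = (if word_of w \<in> L then {[]} else {})"
        using inv unfolding word_inv_def by blast
      have "v = w" if "length v = n" "I = word_struct v" for v
        using word_struct_inj[of v w] w that by simp
      then show ?thesis using w unfolding membership_query_def by auto
    qed
    ultimately show ?thesis
      unfolding maintains_def by (auto simp: word_membership_def P_def)
  qed
  ultimately show ?thesis
    unfolding in_DynFOLL_def by (intro exI[of _ P]) (simp add: word_membership_def)
qed

end

theorem word_membership_in_DynFOLL:
  fixes L :: "'a::finite list set"
  assumes "regular L"
  shows "in_DynFOLL (word_membership L (batch_size e))"
proof -
  obtain Q and \<delta> :: "nat \<Rightarrow> 'a \<Rightarrow> nat" and q0 F where *: "finite Q" "q0 \<in> Q" "F \<subseteq> Q" "\<forall>q\<in>Q. \<forall>a. \<delta> q a \<in> Q" "L = {w. foldl \<delta> q0 w \<in> F}"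
    using assms unfolding regular_def by blast
  then have "automaton Q \<delta> q0 F" by unfold_locales auto
  then show ?thesis using *(5) by (rule automaton.word_membership_automaton)
qed

theorem theorem4:
  "(\<forall>e :: real. in_DynFOLL (undirected_reachability (batch_size e))) \<and>
   (\<forall>(L :: 'a::finite list set) (e :: real).
      regular L \<longrightarrow> in_DynFOLL (word_membership L (batch_size e)))"
  using undirected_reachability_in_DynFOLL word_membership_in_DynFOLL by blast

end
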